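(* Consider the problem $\min_{x\in\mathcal{M}} f(x)=\frac1n\sum_{i=1}^n f_i(x)$, $f_i(x)=\mathbb{E}_{\xi_i\sim\mathcal{D}_i}[F_i(x,\xi_i)]$, and suppose assumptions (A1), (A2), (A3) of the context hold. Let $x^k$ be the iterates of the zeroth-order projection-based Riemannian federated learning algorithm described in the context, run for $K$ communication rounds with $\tau$ local steps, batch size $m$ and smoothing parameter $\mu>0$. If the step sizes satisfy $\eta_g=\sqrt{n}$ and $$\tilde\eta:=\eta_g\eta\tau\le\min\left\{\frac{1}{24ML},\ \frac{\gamma}{6\max\{\chi_G,\chi\}},\ \frac{1}{\chi L_{\mathcal{P}}}\right\},$$ then $$\frac1K\sum_{k=1}^K\left\|\mathcal{G}_{\tilde\eta}(\mathcal{P}_{\mathcal{M}}(x^k))\right\|^2\le\frac{8\Omega^1}{\sqrt n\,\eta\tau K}+\frac{64}{n\tau}\left(\chi_1\mu^2+\frac{\chi_2}{m}\right)+\frac{16(3+n)(\chi_G+\chi)\chi_f}{n}\,\mu,$$ where $\Omega^1>0$ is a constant related to initialization (defined in the context). Specifically, if the smoothing parameter is set to $\mu=\mathcal{O}\left(1/(p\,r\,n\,\tau K)\right)$, then $$\frac1K\sum_{k=1}^K\left\|\mathcal{G}_{\tilde\eta}(\mathcal{P}_{\mathcal{M}}(x^k))\right\|^2=\mathcal{O}\left(\frac{1}{\sqrt n\,\tau K}+\frac{1}{n\tau m}\right).$$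
   Context: **Manifold.** $\mathcal{M}$ is a compact smooth submanifold embedded in $\mathbb{R}^{p\times r}$, with the Euclidean inner product $\langle x,y\rangle=\operatorname{Tr}(x^\top y)$, the Frobenius norm $\|\cdot\|$ and the induced Riemannian metric. $\operatorname{grad}h(x)$ denotes the Riemannian gradient of $h$ at $x$, i.e. the orthogonal projection of the Euclidean gradient $\nabla h(x)$ onto the tangent space $\mathrm{T}_x\mathcal{M}$. For $s\in\mathbb{R}^{p\times r}$, $\mathcal{P}_{\mathcal{M}}(s)\in\operatorname{argmin}_{x\in\mathcal{M}}\frac12\|s-x\|^2$. Let $\operatorname{dist}(x,\mathcal{M})=\min_{u\in\mathcal{M}}\|u-x\|$ and $\overline{U}_{\mathcal{M}}(\gamma)=\{x:\operatorname{dist}(x,\mathcal{M})\le\gamma\}$. **Assumptions.** (A1) $\mathcal{M}$ is $2\gamma$-proximally smooth ($\gamma>0$): $\mathcal{P}_{\mathcal{M}}(x)$ is unique whenever $\operatorname{dist}(x,\mathcal{M})<2\gamma$. (A2) For any $x\in\mathbb{R}^{p\times r}$ and every client $i\in\{1,\dots,n\}$, the zeroth-order oracle outputs an estimator $F_i(x,\xi_i)$ of $f_i(x)$ such that $\mathbb{E}_{\xi_i}[F_i(x,\xi_i)]=f_i(x)$, $\mathbb{E}_{\xi_i}[\operatorname{grad}F_i(x,\xi_i)]=\operatorname{grad}f_i(x)$ and $\mathbb{E}_{\xi_i}\left[\|\operatorname{grad}F_i(x,\xi_i)-\operatorname{grad}f_i(x)\|^2\right]\le\sigma^2$. (A3)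 There is a constant $\chi>0$ such that for each $F_i$, $\max_{x\in\mathcal{M}}\|\nabla F_i(x,\xi_i)\|\le\chi$ almost surely. Moreover each $F_i$ is $l_i$-smooth on the convex hull of $\mathcal{M}$ in the Euclidean sense: for any $x,y\in\operatorname{conv}(\mathcal{M})$, $\|\nabla F_i(x,\xi)-\nabla F_i(y,\xi)\|\le l_i\|x-y\|$ almost surely. **Zeroth-order estimator.** For client $i$, $x\in\mathcal{M}$ and smoothing parameter $\mu>0$, with independent $\xi_j\sim\mathcal{D}_i$ and independent $u_j$ uniform on the unit sphere of $\mathbb{R}^{p\times r}$, $j=1,\dots,m$, $$G_{\mu}(x)=\frac{pr}{m}\sum_{j=1}^m\frac{F_i(\mathcal{P}_{\mathcal{M}}(x+\mu u_j),\xi_j)-F_i(x,\xi_j)}{\mu}\,u_j .$$ **Constants.** - $L>0$ is a constant such that for every $i$ and any $x,y\in\mathcal{M}$, almost surely, $F_i(y,\xi)-F_i(x,\xi)\le\langle\operatorname{grad}F_i(x,\xi),y-x\rangle+\frac L2\|x-y\|^2$ and $\|\operatorname{grad}F_i(x,\xi)-\operatorname{grad}F_i(y,\xi)\|\le L\|x-y\|$. - $M>0$ is a constant such that $\|\mathcal{P}_{\mathcal{M}}(x+u)-x\|\le M\|u\|$ for all $x\in\mathcal{M}$, $u\in\mathbb{R}^{p\times r}$. - $L_{\mathcal{P}}=\max_{x\in\overline{U}_{\mathcal{M}}(\gamma)}\|\mathrm{D}^2\mathcal{P}_{\mathcal{M}}(x)\|$, where $\mathrm{D}^2\mathcal{P}_{\mathcal{M}}$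 is the second-order differential of $\mathcal{P}_{\mathcal{M}}$. - $\chi_G=\mathcal{O}(pr)$, $\chi_f=\mathcal{O}(pr)$, $\chi_1=\mathcal{O}(p^2r^2)$, $\chi_2=\mathcal{O}(p^2r^2+\sigma^2)$ are the constants for which the estimator with smoothing parameter $\mu\le\gamma$ satisfies, for each client $i$ and $x\in\mathcal{M}$: $\|G_\mu(x)\|\le\chi_G$, $\|\mathbb{E}[G_\mu(x)]-\operatorname{grad}f_i(x)\|\le\chi_f\mu$, and $\mathbb{E}\left[\|G_\mu(x)-\operatorname{grad}f_i(x)\|^2\right]\le\chi_1\mu^2+\chi_2/m$ (expectations over all $u_j$ and $\xi_j$). **Algorithm.** Input: $K$, $\tau$, step sizes $\eta,\eta_g$, an initial $x^1$, and $c_i^1=0$ for all $i=1,\dots,n$. For $k=1,\dots,K$: (1) Each client $i$ sets $\hat z_i^{k,0}=z_i^{k,0}=\mathcal{P}_{\mathcal{M}}(x^k)$; for $t=0,\dots,\tau-1$ it independently samples $\xi_{i,j}^{k,t}\sim\mathcal{D}_i$ and $u_{i,j}^{k,t}$ uniform on the unit sphere of $\mathbb{R}^{p\times r}$, $j=1,\dots,m$, forms the estimator $G_i^{k,t}$ at $z_i^{k,t}$ from these samples, and updates $\hat z_i^{k,t+1}=\hat z_i^{k,t}-\eta(G_i^{k,t}+c_i^k)$, $z_i^{k,t+1}=\mathcal{P}_{\mathcal{M}}(\hat z_i^{k,t+1})$. (2) The server sets $x^{k+1}=\mathcal{P}_{\mathcal{M}}(x^k)+\eta_g\left(\frac1n\sum_{i=1}^n\hat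 z_i^{k,\tau}-\mathcal{P}_{\mathcal{M}}(x^k)\right)$. (3) Each client sets $c_i^{k+1}=\frac{1}{\eta_g\eta\tau}\left(\mathcal{P}_{\mathcal{M}}(x^k)-x^{k+1}\right)-\frac1\tau\sum_{t=0}^{\tau-1}G_i^{k,t}$. Output: $\mathcal{P}_{\mathcal{M}}(x^{K+1})$. **Suboptimality measure.** $\mathcal{G}_{\tilde\eta}(\mathcal{P}_{\mathcal{M}}(x^k))=\left(\mathcal{P}_{\mathcal{M}}(x^k)-\tilde x^{k+1}\right)/\tilde\eta$, where $\tilde x^{k+1}=\mathcal{P}_{\mathcal{M}}\left(\mathcal{P}_{\mathcal{M}}(x^k)-\tilde\eta\operatorname{grad}f(\mathcal{P}_{\mathcal{M}}(x^k))\right)$. **Initialization constant.** With $f^*$ the optimal value of the problem and $y^1=\mathcal{P}_{\mathcal{M}}(x^1)$, $$\Omega^1=f(y^1)-f^*+\frac{\eta^2\tau^2}{n\tilde\eta}\sum_{i=1}^n\left\|\operatorname{grad}f_i(y^1)-\operatorname{grad}f(y^1)\right\|^2 .$$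
   Formalization: The iterates are random and the bounds fail on unlucky sample paths, so both bounds are stated for the expectation of the averaged squared suboptimality measure over all samples; μ ≤ γ, the range in which the constants χ are defined. *)

theory Defs
  imports "HOL-Probability.Probability"
begin

section \<open>Submanifolds of a Euclidean space\<close>

primrec Ck_on :: "nat \<Rightarrow> 'a::euclidean_space set \<Rightarrow> ('a \<Rightarrow> 'b::real_normed_vector) \<Rightarrow> bool" where
  "Ck_on 0 S f \<longleftrightarrow> continuous_on S f"
| "Ck_on (Suc k) S f \<longleftrightarrow>
     (\<forall>x\<in>S. f differentiable (at x)) \<and> (\<forall>v. Ck_on k S (\<lambda>x. frechet_derivative f (at x) v))"

text \<open>Only used for open sets \<open>S\<close>.\<close>
definition smooth_on :: "'a::euclidean_space set \<Rightarrow> ('a \<Rightarrow> 'b::real_normed_vector) \<Rightarrow> bool" where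
  "smooth_on S f \<longleftrightarrow> (\<forall>k. Ck_on k S f)"

text \<open>Slice charts: near each of its points, \<open>S\<close> is carried onto an open piece of a
  \<open>d\<close>-dimensional linear subspace by a diffeomorphism between open sets of the ambient space.\<close>
definition smooth_submanifold :: "'a::euclidean_space set \<Rightarrow> bool" where
  "smooth_submanifold S \<longleftrightarrow>
     (\<exists>d. \<forall>x\<in>S. \<exists>(U :: 'a set) (V :: 'a set) \<phi> \<psi> H.
        open U \<and> x \<in> U \<and> open V \<and> homeomorphism U V \<phi> \<psi> \<and> smooth_on U \<phi> \<and> smooth_on V \<psi> \<and>
        subspace H \<and> dim H = d \<and> \<phi> ` (U \<inter> S) = V \<inter> H)"

text \<open>Velocities at \<open>x\<close> of smooth curves in \<open>S\<close>; empty when \<open>x \<notin> S\<close>.\<close>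
definition tangent_space :: "'a::euclidean_space set \<Rightarrow> 'a \<Rightarrow> 'a set" where
  "tangent_space S x =
     {v. \<exists>(c :: real \<Rightarrow> 'a) e. 0 < e \<and> smooth_on {-e<..<e} c \<and> c ` {-e<..<e} \<subseteq> S \<and> c 0 = x \<and>
           (c has_vector_derivative v) (at 0)}"

definition orth_proj :: "'a::real_inner set \<Rightarrow> 'a \<Rightarrow> 'a" where
  "orth_proj T v = (THE w. w \<in> T \<and> (\<forall>t\<in>T. (v - w) \<bullet> t = 0))"

definition euclid_grad :: "('a::euclidean_space \<Rightarrow> real) \<Rightarrow> 'a \<Rightarrow> 'a" where
  "euclid_grad h x = (THE g. GDERIV h x :> g)"

definition riem_grad :: "'a::euclidean_space set \<Rightarrow> ('a \<Rightarrow> real) \<Rightarrow> 'a \<Rightarrow> 'a" where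
  "riem_grad S h x = orth_proj (tangent_space S x) (euclid_grad h x)"

definition is_nearest :: "'a::euclidean_space set \<Rightarrow> 'a \<Rightarrow> 'a \<Rightarrow> bool" where
  "is_nearest S s u \<longleftrightarrow> is_arg_min (\<lambda>y. 1/2 * (norm (s - y))\<^sup>2) (\<lambda>y. y \<in> S) u"

definition prox_smooth :: "real \<Rightarrow> 'a::euclidean_space set \<Rightarrow> bool" where
  "prox_smooth \<rho> S \<longleftrightarrow> (\<forall>x. infdist x S < \<rho> \<longrightarrow> (\<exists>!u. is_nearest S x u))"

definition tube :: "'a::euclidean_space set \<Rightarrow> real \<Rightarrow> 'a set" where
  "tube S \<gamma> = {x. infdist x S \<le> \<gamma>}"

text \<open>An arbitrary selection of nearest points. Far from \<open>S\<close>, where they need not be unique, it is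
  required to be Borel measurable, so that expectations of its values make sense.\<close>
definition projection_on :: "'a::euclidean_space set \<Rightarrow> ('a \<Rightarrow> 'a) \<Rightarrow> bool" where
  "projection_on S P \<longleftrightarrow> (\<forall>s. is_nearest S s (P s)) \<and> P \<in> borel_measurable borel"

definition twice_differentiable_at :: "('a::euclidean_space \<Rightarrow> 'a) \<Rightarrow> 'a \<Rightarrow> bool" where
  "twice_differentiable_at P x \<longleftrightarrow>
     (\<forall>\<^sub>F y in nhds x. P differentiable (at y)) \<and>
     (\<lambda>y. Blinfun (frechet_derivative P (at y))) differentiable (at x)"

text \<open>The operator norm of \<open>u \<mapsto> D\<^sup>2P(x)[u]\<close> into the linear maps with their operator norm is the
  norm of the bilinear map \<open>D\<^sup>2P(x)\<close>.\<close>
definition D2_norm :: "('a::euclidean_space \<Rightarrow> 'a) \<Rightarrow> 'a \<Rightarrow> real" where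
  "D2_norm P x = onorm (frechet_derivative (\<lambda>y. Blinfun (frechet_derivative P (at y))) (at x))"

text \<open>\<open>LP\<close> is the maximum over the tube of the norm of the second differential; this includes that the
  second differential exists there.\<close>
definition is_max_D2 :: "'a::euclidean_space set \<Rightarrow> ('a \<Rightarrow> 'a) \<Rightarrow> real \<Rightarrow> real \<Rightarrow> bool" where
  "is_max_D2 S P \<gamma> LP \<longleftrightarrow>
     (\<forall>x\<in>tube S \<gamma>. twice_differentiable_at P x) \<and>
     LP \<in> D2_norm P ` tube S \<gamma> \<and> (\<forall>x\<in>tube S \<gamma>. D2_norm P x \<le> LP)"


section \<open>The stochastic problem\<close>

text \<open>Clients are numbered \<open>0, \<dots>, n - 1\<close>; \<open>D i\<close> is the data distribution and
  \<open>F i x \<xi>\<close> the sample loss of client \<open>i\<close>.\<close>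

definition client_obj :: "(nat \<Rightarrow> 'x measure) \<Rightarrow> (nat \<Rightarrow> 'a \<Rightarrow> 'x \<Rightarrow> real) \<Rightarrow> nat \<Rightarrow> 'a \<Rightarrow> real" where
  "client_obj D F i x = (\<integral>\<xi>. F i x \<xi> \<partial>D i)"

definition global_obj ::
    "nat \<Rightarrow> (nat \<Rightarrow> 'x measure) \<Rightarrow> (nat \<Rightarrow> 'a \<Rightarrow> 'x \<Rightarrow> real) \<Rightarrow> 'a \<Rightarrow> real" where
  "global_obj n D F x = (\<Sum>i<n. client_obj D F i x) / real n"

text \<open>Riemannian gradients are only meaningful on \<open>S\<close>, so the gradient conditions are imposed there;
  \<open>E[F\<^sub>i(x, \<xi>)] = f\<^sub>i(x)\<close> is the definition of \<open>client_obj\<close>.\<close>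
definition oracle_assm :: "'a::euclidean_space set \<Rightarrow> real \<Rightarrow> nat \<Rightarrow> (nat \<Rightarrow> 'x measure) \<Rightarrow>
    (nat \<Rightarrow> 'a \<Rightarrow> 'x \<Rightarrow> real) \<Rightarrow> bool" where
  "oracle_assm S \<sigma> n D F \<longleftrightarrow>
     (\<forall>i<n. prob_space (D i) \<and>
        (\<lambda>(x, \<xi>). F i x \<xi>) \<in> borel_measurable (borel \<Otimes>\<^sub>M D i) \<and>
        (\<forall>x. integrable (D i) (F i x)) \<and>
        (\<forall>x\<in>S. client_obj D F i differentiable (at x) \<and>
           integrable (D i) (\<lambda>\<xi>. riem_grad S (\<lambda>y. F i y \<xi>) x) \<and>
           (\<integral>\<xi>. riem_grad S (\<lambda>y. F i y \<xi>) x \<partial>D i) = riem_grad S (client_obj D F i) x \<and>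
           integrable (D i)
             (\<lambda>\<xi>. (norm (riem_grad S (\<lambda>y. F i y \<xi>) x - riem_grad S (client_obj D F i) x))\<^sup>2) \<and>
           (\<integral>\<xi>. (norm (riem_grad S (\<lambda>y. F i y \<xi>) x - riem_grad S (client_obj D F i) x))\<^sup>2 \<partial>D i)
             \<le> \<sigma>\<^sup>2))"

definition gradient_assm :: "'a::euclidean_space set \<Rightarrow> real \<Rightarrow> nat \<Rightarrow> (nat \<Rightarrow> 'x measure) \<Rightarrow>
    (nat \<Rightarrow> 'a \<Rightarrow> 'x \<Rightarrow> real) \<Rightarrow> bool" where
  "gradient_assm S chi n D F \<longleftrightarrow>
     (\<forall>i<n.
        (AE \<xi> in D i. \<forall>x\<in>convex hull S. (\<lambda>y. F i y \<xi>) differentiable (at x)) \<and>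
        (AE \<xi> in D i. \<forall>x\<in>S. norm (euclid_grad (\<lambda>y. F i y \<xi>) x) \<le> chi) \<and>
        (\<exists>l. \<forall>x\<in>convex hull S. \<forall>y\<in>convex hull S. AE \<xi> in D i.
           norm (euclid_grad (\<lambda>z. F i z \<xi>) x - euclid_grad (\<lambda>z. F i z \<xi>) y) \<le> l * norm (x - y)))"

definition riem_smooth_const :: "'a::euclidean_space set \<Rightarrow> real \<Rightarrow> nat \<Rightarrow> (nat \<Rightarrow> 'x measure) \<Rightarrow>
    (nat \<Rightarrow> 'a \<Rightarrow> 'x \<Rightarrow> real) \<Rightarrow> bool" where
  "riem_smooth_const S L n D F \<longleftrightarrow>
     (\<forall>i<n. \<forall>x\<in>S. \<forall>y\<in>S. AE \<xi> in D i.
        F i y \<xi> - F i x \<xi> \<le> riem_grad S (\<lambda>z. F i z \<xi>) x \<bullet> (y - x) + L / 2 * (norm (x - y))\<^sup>2 \<and>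
        norm (riem_grad S (\<lambda>z. F i z \<xi>) x - riem_grad S (\<lambda>z. F i z \<xi>) y) \<le> L * norm (x - y))"


section \<open>The zeroth-order estimator\<close>

text \<open>The inner product and norm of \<^typ>\<open>real^'r^'p\<close> are the trace inner product and the
  Frobenius norm.\<close>

text \<open>The radial projection of the uniform distribution on the unit ball is the uniform distribution
  on the unit sphere.\<close>
definition sphere_unif :: "'a::euclidean_space measure" where
  "sphere_unif = distr (uniform_measure lborel (ball 0 1)) borel (\<lambda>x. x /\<^sub>R norm x)"

text \<open>Law of one sample \<open>(\<xi>, u)\<close> with independent components.\<close>
definition sample_law :: "'x measure \<Rightarrow> ('x \<times> 'a::euclidean_space) measure" where
  "sample_law Di = Di \<Otimes>\<^sub>M sphere_unif"

definition zo_est :: "(real^'r^'p \<Rightarrow> real^'r^'p) \<Rightarrow> real \<Rightarrow> nat \<Rightarrow> (real^'r^'p \<Rightarrow> 'x \<Rightarrow> real) \<Rightarrow>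
    (nat \<Rightarrow> 'x \<times> (real^'r^'p)) \<Rightarrow> real^'r^'p \<Rightarrow> real^'r^'p" where
  "zo_est P \<mu> m Fi s x =
     (real (CARD('p) * CARD('r)) / real m) *\<^sub>R
       (\<Sum>j<m. case s j of (\<xi>, u) \<Rightarrow> ((Fi (P (x + \<mu> *\<^sub>R u)) \<xi> - Fi x \<xi>) / \<mu>) *\<^sub>R u)"

definition batch_law :: "'x measure \<Rightarrow> nat \<Rightarrow> (nat \<Rightarrow> 'x \<times> 'a::euclidean_space) measure" where
  "batch_law Di m = (\<Pi>\<^sub>M j\<in>{..<m}. sample_law Di)"

definition estimator_consts :: "(real^'r^'p) set \<Rightarrow> (real^'r^'p \<Rightarrow> real^'r^'p) \<Rightarrow> real \<Rightarrow>
    real \<Rightarrow> real \<Rightarrow> real \<Rightarrow> real \<Rightarrow> nat \<Rightarrow> (nat \<Rightarrow> 'x measure) \<Rightarrow>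
    (nat \<Rightarrow> real^'r^'p \<Rightarrow> 'x \<Rightarrow> real) \<Rightarrow> bool" where
  "estimator_consts S P \<gamma> chiG chif chi1 chi2 n D F \<longleftrightarrow>
     (\<forall>\<mu> m. 0 < \<mu> \<longrightarrow> \<mu> \<le> \<gamma> \<longrightarrow> 0 < m \<longrightarrow> (\<forall>i<n. \<forall>x\<in>S.
        (AE s in batch_law (D i) m. norm (zo_est P \<mu> m (F i) s x) \<le> chiG) \<and>
        norm ((\<integral>s. zo_est P \<mu> m (F i) s x \<partial>batch_law (D i) m) - riem_grad S (client_obj D F i) x)
          \<le> chif * \<mu> \<and>
        (\<integral>s. (norm (zo_est P \<mu> m (F i) s x - riem_grad S (client_obj D F i) x))\<^sup>2
            \<partial>batch_law (D i) m)
          \<le> chi1 * \<mu>\<^sup>2 + chi2 / real m))"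


section \<open>The federated algorithm\<close>

text \<open>The pair after \<open>t\<close> local steps is \<open>(zhat, z)\<close>; \<open>y\<close> is the projected server iterate, \<open>c\<close> the
  correction and \<open>g t z\<close> the gradient estimate at \<open>z\<close> in step \<open>t\<close>.\<close>
primrec local_iter :: "('a::real_vector \<Rightarrow> 'a) \<Rightarrow> real \<Rightarrow> 'a \<Rightarrow> (nat \<Rightarrow> 'a \<Rightarrow> 'a) \<Rightarrow> 'a \<Rightarrow> nat \<Rightarrow> 'a \<times> 'a"
  where
  "local_iter P \<eta> c g y 0 = (y, y)"
| "local_iter P \<eta> c g y (Suc t) =
     (let (zh, z) = local_iter P \<eta> c g y t; zh' = zh - \<eta> *\<^sub>R (g t z + c) in (zh', P zh'))"

text \<open>\<open>s k i t j\<close> is the sample \<open>(\<xi>, u)\<close> number \<open>j\<close> of client \<open>i\<close> in local step \<open>t\<close> of round \<open>k\<close>.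
  Rounds and batch positions are numbered from \<open>0\<close>, so \<open>fed_state \<dots> k\<close> is the pair
  \<open>(x, c)\<close> at the beginning of the \<open>(k + 1)\<close>-st round.\<close>
primrec fed_state :: "(real^'r^'p \<Rightarrow> real^'r^'p) \<Rightarrow> (nat \<Rightarrow> real^'r^'p \<Rightarrow> 'x \<Rightarrow> real) \<Rightarrow>
    nat \<Rightarrow> nat \<Rightarrow> nat \<Rightarrow> real \<Rightarrow> real \<Rightarrow> real \<Rightarrow> real^'r^'p \<Rightarrow>
    (nat \<Rightarrow> nat \<Rightarrow> nat \<Rightarrow> nat \<Rightarrow> 'x \<times> (real^'r^'p)) \<Rightarrow> nat \<Rightarrow> (real^'r^'p) \<times> (nat \<Rightarrow> real^'r^'p)" where
  "fed_state P F n \<tau> m \<mu> \<eta> \<eta>g x1 s 0 = (x1, \<lambda>i. 0)"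
| "fed_state P F n \<tau> m \<mu> \<eta> \<eta>g x1 s (Suc k) =
     (let (x, c) = fed_state P F n \<tau> m \<mu> \<eta> \<eta>g x1 s k;
          g = (\<lambda>i t z. zo_est P \<mu> m (F i) (s k i t) z);
          loc = (\<lambda>i. local_iter P \<eta> (c i) (g i) (P x));
          x' = P x + \<eta>g *\<^sub>R ((1 / real n) *\<^sub>R (\<Sum>i<n. fst (loc i \<tau>)) - P x)
      in (x', \<lambda>i. (1 / (\<eta>g * \<eta> * real \<tau>)) *\<^sub>R (P x - x')
                  - (1 / real \<tau>) *\<^sub>R (\<Sum>t<\<tau>. g i t (snd (loc i t)))))"

definition server_iterate :: "(real^'r^'p \<Rightarrow> real^'r^'p) \<Rightarrow> (nat \<Rightarrow> real^'r^'p \<Rightarrow> 'x \<Rightarrow> real) \<Rightarrow>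
    nat \<Rightarrow> nat \<Rightarrow> nat \<Rightarrow> real \<Rightarrow> real \<Rightarrow> real \<Rightarrow> real^'r^'p \<Rightarrow>
    (nat \<Rightarrow> nat \<Rightarrow> nat \<Rightarrow> nat \<Rightarrow> 'x \<times> (real^'r^'p)) \<Rightarrow> nat \<Rightarrow> real^'r^'p" where
  "server_iterate P F n \<tau> m \<mu> \<eta> \<eta>g x1 s k = fst (fed_state P F n \<tau> m \<mu> \<eta> \<eta>g x1 s k)"

text \<open>All samples are independent, and each has the law of an independent pair: thus all \<open>\<xi>\<close>'s and
  \<open>u\<close>'s together are mutually independent.\<close>
definition sampling :: "'w measure \<Rightarrow> (nat \<Rightarrow> 'x measure) \<Rightarrow> nat \<Rightarrow> nat \<Rightarrow> nat \<Rightarrow> nat \<Rightarrow>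
    (nat \<Rightarrow> nat \<Rightarrow> nat \<Rightarrow> nat \<Rightarrow> 'w \<Rightarrow> 'x \<times> 'a::euclidean_space) \<Rightarrow> bool" where
  "sampling W D n \<tau> m K Z \<longleftrightarrow>
     prob_space W \<and>
     prob_space.indep_vars W (\<lambda>(k, i, t, j). sample_law (D i)) (\<lambda>(k, i, t, j). Z k i t j)
       ({..<K} \<times> {..<n} \<times> {..<\<tau>} \<times> {..<m}) \<and>
     (\<forall>k<K. \<forall>i<n. \<forall>t<\<tau>. \<forall>j<m. distr W (sample_law (D i)) (Z k i t j) = sample_law (D i))"


section \<open>Suboptimality\<close>

definition grad_map :: "'a::euclidean_space set \<Rightarrow> ('a \<Rightarrow> 'a) \<Rightarrow> ('a \<Rightarrow> real) \<Rightarrow> real \<Rightarrow> 'a \<Rightarrow> 'a" where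
  "grad_map S P f \<eta>t y = (1 / \<eta>t) *\<^sub>R (y - P (y - \<eta>t *\<^sub>R riem_grad S f y))"

definition mean_subopt :: "(real^'r^'p) set \<Rightarrow> (real^'r^'p \<Rightarrow> real^'r^'p) \<Rightarrow> (nat \<Rightarrow> 'x measure) \<Rightarrow>
    (nat \<Rightarrow> real^'r^'p \<Rightarrow> 'x \<Rightarrow> real) \<Rightarrow> nat \<Rightarrow> nat \<Rightarrow> nat \<Rightarrow> nat \<Rightarrow> real \<Rightarrow> real \<Rightarrow> real \<Rightarrow>
    real^'r^'p \<Rightarrow> (nat \<Rightarrow> nat \<Rightarrow> nat \<Rightarrow> nat \<Rightarrow> 'x \<times> (real^'r^'p)) \<Rightarrow> real" where
  "mean_subopt S P D F n \<tau> m K \<mu> \<eta> \<eta>g x1 s =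
     (\<Sum>k<K. (norm (grad_map S P (global_obj n D F) (\<eta>g * \<eta> * real \<tau>)
                (P (server_iterate P F n \<tau> m \<mu> \<eta> \<eta>g x1 s k))))\<^sup>2) / real K"

definition Omega1 :: "(real^'r^'p) set \<Rightarrow> (real^'r^'p \<Rightarrow> real^'r^'p) \<Rightarrow> (nat \<Rightarrow> 'x measure) \<Rightarrow>
    (nat \<Rightarrow> real^'r^'p \<Rightarrow> 'x \<Rightarrow> real) \<Rightarrow> nat \<Rightarrow> nat \<Rightarrow> real \<Rightarrow> real \<Rightarrow> real^'r^'p \<Rightarrow> real" where
  "Omega1 S P D F n \<tau> \<eta> \<eta>g x1 =
     (let f = global_obj n D F; y1 = P x1 in
        f y1 - (INF x\<in>S. f x)
        + \<eta>\<^sup>2 * (real \<tau>)\<^sup>2 / (real n * (\<eta>g * \<eta> * real \<tau>)) *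
          (\<Sum>i<n. (norm (riem_grad S (client_obj D F i) y1 - riem_grad S f y1))\<^sup>2))"

text \<open>A run of the algorithm under the standing assumptions, without the step size restriction.\<close>
definition zo_fed_run :: "(real^'r^'p) set \<Rightarrow> (real^'r^'p \<Rightarrow> real^'r^'p) \<Rightarrow>
    real \<Rightarrow> real \<Rightarrow> real \<Rightarrow> real \<Rightarrow> real \<Rightarrow> real \<Rightarrow> real \<Rightarrow> real \<Rightarrow>
    nat \<Rightarrow> nat \<Rightarrow> nat \<Rightarrow> nat \<Rightarrow> real \<Rightarrow> real \<Rightarrow>
    (nat \<Rightarrow> 'x measure) \<Rightarrow> (nat \<Rightarrow> real^'r^'p \<Rightarrow> 'x \<Rightarrow> real) \<Rightarrow> 'w measure \<Rightarrow>
    (nat \<Rightarrow> nat \<Rightarrow> nat \<Rightarrow> nat \<Rightarrow> 'w \<Rightarrow> 'x \<times> (real^'r^'p)) \<Rightarrow> bool" where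
  "zo_fed_run S P \<gamma> \<sigma> chi L chiG chif chi1 chi2 n \<tau> m K \<mu> \<eta> D F W Z \<longleftrightarrow>
     0 < n \<and> 0 < \<tau> \<and> 0 < m \<and> 0 < K \<and> 0 < \<mu> \<and> \<mu> \<le> \<gamma> \<and> 0 < \<eta> \<and>
     oracle_assm S \<sigma> n D F \<and> gradient_assm S chi n D F \<and> riem_smooth_const S L n D F \<and>
     estimator_consts S P \<gamma> chiG chif chi1 chi2 n D F \<and>
     sampling W D n \<tau> m K Z"

text \<open>The third condition is \<open>\<eta>t \<le> 1 / (chi * LP)\<close>, with the convention \<open>1 / 0 = \<infinity>\<close>.\<close>
definition step_size_cond :: "real \<Rightarrow> real \<Rightarrow> real \<Rightarrow> real \<Rightarrow> real \<Rightarrow> real \<Rightarrow> real \<Rightarrow> bool" where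
  "step_size_cond M L \<gamma> chiG chi LP \<eta>t \<longleftrightarrow>
     \<eta>t \<le> 1 / (24 * M * L) \<and> \<eta>t \<le> \<gamma> / (6 * max chiG chi) \<and> \<eta>t * (chi * LP) \<le> 1"

end

theory Submission
  imports Defs
begin

text \<open>Near \<open>S\<close> the metric projection \<open>P\<close> is nonexpansive up to a factor \<open>6/5\<close> and satisfies
  a variational inequality: \<open>DP\<close> annihilates the radial direction, so by Gronwall's inequality \<open>P\<close> is constant
  along normal segments of length \<open>\<gamma>\<close>. Since the corrections sum to zero, the server iterate is
  \<open>y - h * g\<close> with \<open>h\<close> the effective step size and \<open>g\<close> the average of all estimates of the round,
  and one round decreases the objective like a projected stochastic gradient step. The error of \<open>g\<close> splits
  into the bias of the estimator, the drift of the local iterates, and a noise with conditional mean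
  zero given all other samples. The drift is absorbed by the Lyapunov function consisting of the
  objective and the variance of the corrected client gradients; the noises of different clients and
  steps are orthogonal, which gives the factor \<open>1 / (n \<tau>)\<close>. If the bias exceeds \<open>3/40 * chi\<close> the
  bound holds trivially, because the gradient mapping has norm at most \<open>12/11 * chi\<close>; this is why
  no quadratic bias term appears.\<close>

section \<open>Tangent spaces and gradients\<close>

text \<open>The choice \<open>\<eta>g = sqrt (real n)\<close> makes the effective step
  \<open>h\<close> larger than the local scale \<open>\<eta> * real \<tau>\<close> by
  \<open>sqrt (real n)\<close>. The condition on \<open>h\<close> therefore gives every contribution
  to the mean squared drift a factor \<open>1 / real n\<close>, so the gradient variance needs only
  the weight \<open>8 / real n\<close> in the Lyapunov function, and the noise entering through
  local steps and corrections inherits that factor. The drift also contains the squared norm of the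
  global gradient; it can be absorbed because this norm is at most twice that of the gradient
  mapping, which is what the bound on the second differential of \<open>P\<close> is for. The exact
  projected step from \<open>y\<close>, unlike the actual one, is a function of the state at the
  start of the round: the noise paired with it has mean zero, and what remains is quadratic in the
  error of \<open>g\<close>. The analysis of a round is deterministic, for a fixed realisation of
  the samples. Expectations are taken on the product space of all samples, where conditioning on
  everything but one batch is integration over a block of coordinates.\<close>

lemma Ck_on_cong:
  assumes "open S" and "\<And>x. x \<in> S \<Longrightarrow> f x = g x" and "Ck_on k S f"
  shows "Ck_on k S g"
  using assms(2,3)
proof (induction k arbitrary: f g)
  case 0
  then show ?case
    using continuous_on_cong by (metis Ck_on.simps(1))
next
  case (Suc k)
  have fg: "(g has_derivative frechet_derivative f (at x)) (at x)" if "x \<in> S" for x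
  proof -
    have "(f has_derivative frechet_derivative f (at x)) (at x)"
      using Suc.prems(2) that by (auto simp: frechet_derivative_works)
    then show ?thesis
      using has_derivative_transform_within_open[OF _ assms(1) that] Suc.prems(1) by metis
  qed
  have "Ck_on k S (\<lambda>x. frechet_derivative g (at x) v)" for v
  proof (rule Suc.IH)
    show "frechet_derivative f (at x) v = frechet_derivative g (at x) v" if "x \<in> S" for x
      using frechet_derivative_at[OF fg[OF that]] by simp
    show "Ck_on k S (\<lambda>x. frechet_derivative f (at x) v)"
      using Suc.prems(2) by simp
  qed
  then show ?case
    using fg by (auto simp: differentiable_def)
qed

text \<open>The derivative of the composite along \<open>v\<close> is the derivative of
  \<open>\<psi>\<close> along the constant vector \<open>v *\<^sub>R h\<close>, again a function on
  \<open>V\<close> composed with the same line. The induction thus closes once \<open>\<psi>\<close>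
  is generalised, without a chain rule for arbitrary \<open>Ck_on\<close> maps.\<close>

lemma Ck_on_compose_line:
  fixes \<psi> :: "'a::euclidean_space \<Rightarrow> 'b::real_normed_vector" and T :: "real set"
  assumes "open T" and "\<And>t. t \<in> T \<Longrightarrow> p + t *\<^sub>R h \<in> V" and "Ck_on k V \<psi>"
  shows "Ck_on k T (\<lambda>t. \<psi> (p + t *\<^sub>R h))"
  using assms(3)
proof (induction k arbitrary: \<psi>)
  case 0
  then show ?case
    using assms(2) by (auto intro!: continuous_on_compose2[of V \<psi>] continuous_intros)
next
  case (Suc k)
  have der: "((\<lambda>t. \<psi> (p + t *\<^sub>R h)) has_derivative
      (\<lambda>v. frechet_derivative \<psi> (at (p + t *\<^sub>R h)) (v *\<^sub>R h))) (at t)" if "t \<in> T" for t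
  proof -
    have "(\<psi> has_derivative frechet_derivative \<psi> (at (p + t *\<^sub>R h))) (at (p + t *\<^sub>R h))"
      using Suc.prems assms(2)[OF that] by (auto simp: frechet_derivative_works)
    moreover have "((\<lambda>t. p + t *\<^sub>R h) has_derivative (\<lambda>v. v *\<^sub>R h)) (at t)"
      by (auto intro!: derivative_eq_intros)
    ultimately show ?thesis
      by (rule has_derivative_compose[rotated])
  qed
  have "Ck_on k T (\<lambda>t. frechet_derivative (\<lambda>t. \<psi> (p + t *\<^sub>R h)) (at t) v)" for v
  proof (rule Ck_on_cong[OF assms(1)])
    show "frechet_derivative \<psi> (at (p + t *\<^sub>R h)) (v *\<^sub>R h)
        = frechet_derivative (\<lambda>t. \<psi> (p + t *\<^sub>R h)) (at t) v" if "t \<in> T" for t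
      using frechet_derivative_at[OF der[OF that]] by metis
    show "Ck_on k T (\<lambda>t. frechet_derivative \<psi> (at (p + t *\<^sub>R h)) (v *\<^sub>R h))"
      using Suc.prems by (intro Suc.IH[of "\<lambda>x. frechet_derivative \<psi> (at x) (v *\<^sub>R h)"]) auto
  qed
  then show ?case
    using der by (auto simp: differentiable_def)
qed

section \<open>Tangent spaces through slice charts\<close>

lemma has_vector_derivative_imp_quotient_tendsto:
  assumes "(f has_vector_derivative v) (at 0)"
  shows "((\<lambda>t. (f t - f 0) /\<^sub>R t) \<longlongrightarrow> v) (at 0)"
proof -
  have "((\<lambda>t. norm (f t - f 0 - t *\<^sub>R v) / norm t) \<longlongrightarrow> 0) (at 0)"
    using assms by (simp add: has_vector_derivative_def has_derivative_at)
  moreover have "\<forall>\<^sub>F t in at 0. norm (f t - f 0 - t *\<^sub>R v) / norm t = norm ((f t - f 0) /\<^sub>R t - v)"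
  proof (intro eventually_mono[OF eventually_neq_at_within[of 0]])
    fix t :: real assume "t \<noteq> 0"
    then have "(f t - f 0) /\<^sub>R t - v = inverse t *\<^sub>R (f t - f 0 - t *\<^sub>R v)"
      by (simp add: scaleR_diff_right)
    then show "norm (f t - f 0 - t *\<^sub>R v) / norm t = norm ((f t - f 0) /\<^sub>R t - v)"
      by (simp add: divide_inverse mult.commute)
  qed
  ultimately have "((\<lambda>t. norm ((f t - f 0) /\<^sub>R t - v)) \<longlongrightarrow> 0) (at 0)"
    by (rule Lim_transform_eventually)
  then show ?thesis
    by (simp add: tendsto_norm_zero_iff LIM_zero_iff)
qed

text \<open>A set of velocities is not visibly a subspace; a preimage of \<open>H\<close> under a
  linear map is. If \<open>c\<close> runs in \<open>S\<close>, the difference quotients of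
  \<open>\<phi> (c t)\<close> lie in the closed subspace \<open>H\<close>, hence so does their
  limit. Conversely \<open>\<psi>\<close> carries the straight line through \<open>\<phi> x\<close>
  in a direction of \<open>H\<close> to a curve in \<open>S\<close>.\<close>

lemma tangent_space_chart:
  assumes "open U" "x \<in> U" "open V" "homeomorphism U V \<phi> \<psi>" "smooth_on U \<phi>" "smooth_on V \<psi>"
    and "subspace H" and "\<phi> ` (U \<inter> S) = V \<inter> H" and "x \<in> S"
  shows "tangent_space S x = {v. frechet_derivative \<phi> (at x) v \<in> H}"
proof -
  let ?A = "frechet_derivative \<phi> (at x)" and ?B = "frechet_derivative \<psi> (at (\<phi> x))"
  have hom: "\<And>u. u \<in> U \<Longrightarrow> \<psi> (\<phi> u) = u" "\<And>w. w \<in> V \<Longrightarrow> \<phi> (\<psi> w) = w" "\<phi> ` U = V" "\<psi> ` V = U"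
    using assms(4) by (auto simp: homeomorphism_def)
  have phx: "\<phi> x \<in> V" "\<phi> x \<in> H"
    using hom(3) assms(2,8,9) by auto
  have "Ck_on (Suc 0) U \<phi>" "Ck_on (Suc 0) V \<psi>"
    using assms(5,6) by (auto simp: smooth_on_def)
  then have dA: "(\<phi> has_derivative ?A) (at x)" and dB: "(\<psi> has_derivative ?B) (at (\<phi> x))"
    using assms(2) phx by (auto simp: frechet_derivative_works)
  \<comment> \<open>The derivatives of \<open>\<phi>\<close> and \<open>\<psi>\<close> compose to
    the identity because \<open>\<psi> (\<phi> u) = u\<close> on the open set \<open>U\<close>; this
    makes the lifted curve have velocity exactly \<open>v\<close>.\<close>
  have BA: "?B (?A v) = v" for v
  proof -
    have 1: "((\<lambda>u. \<psi> (\<phi> u)) has_derivative (\<lambda>v. ?B (?A v))) (at x)"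
      using has_derivative_compose[OF dA dB] .
    have 2: "((\<lambda>u. \<psi> (\<phi> u)) has_derivative (\<lambda>v. v)) (at x)"
      by (rule has_derivative_transform_within_open[OF has_derivative_ident assms(1,2)])
        (simp add: hom)
    show ?thesis
      using has_derivative_unique[OF 1 2] by metis
  qed
  show ?thesis
  proof (intro set_eqI iffI CollectI)
    fix v assume "v \<in> tangent_space S x"
    then obtain c and e :: real where c: "0 < e" "c ` {-e<..<e} \<subseteq> S" "c 0 = x"
        "(c has_vector_derivative v) (at 0)"
      by (auto simp: tangent_space_def)
    have "isCont c 0"
      using c(4) has_vector_derivative_continuous by blast
    then have "\<forall>\<^sub>F t in at 0. c t \<in> U"
      using assms(1,2) c(3) unfolding isCont_def by (metis topological_tendstoD)
    moreover have "\<forall>\<^sub>F t in at 0. t \<in> {-e<..<e}"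
      using c(1) by (intro eventually_at_in_open') auto
    ultimately have ev: "\<forall>\<^sub>F t in at 0. \<phi> (c t) \<in> H"
      by eventually_elim (use c(2) assms(8) in blast)
    have "((\<lambda>t. \<phi> (c t)) has_vector_derivative ?A v) (at 0)"
    proof -
      have "(\<phi> has_derivative ?A) (at (c 0))"
        using dA c(3) by simp
      from has_derivative_compose[OF c(4)[unfolded has_vector_derivative_def] this]
      have "((\<lambda>t. \<phi> (c t)) has_derivative (\<lambda>t. ?A (t *\<^sub>R v))) (at 0)" .
      then show ?thesis
        using has_derivative_linear[OF dA] by (simp add: has_vector_derivative_def linear_cmul)
    qed
    then have lim: "((\<lambda>t. (\<phi> (c t) - \<phi> x) /\<^sub>R t) \<longlongrightarrow> ?A v) (at 0)"
      using c(3) has_vector_derivative_imp_quotient_tendsto[of "\<lambda>t. \<phi> (c t)"] by simp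
    have "\<forall>\<^sub>F t in at (0::real). (\<phi> (c t) - \<phi> x) /\<^sub>R t \<in> H"
      using ev by eventually_elim (use assms(7) phx in \<open>auto intro: subspace_scale subspace_diff\<close>)
    then show "?A v \<in> H"
      using Lim_in_closed_set[OF closed_subspace[OF assms(7)] _ _ lim] by simp
  next
    fix v assume "v \<in> {v. ?A v \<in> H}"
    then have v: "?A v \<in> H" by simp
    obtain r where r: "0 < r" "ball (\<phi> x) r \<subseteq> V"
      using assms(3) phx openE by metis
    \<comment> \<open>The summand 1 avoids division by zero when \<open>?A v = 0\<close> and makes
      the estimate below strict.\<close>
    define e where "e = r / (1 + norm (?A v))"
    have e: "0 < e"
      using r by (auto simp: e_def intro!: divide_pos_pos add_pos_nonneg)
    have inV: "\<phi> x + t *\<^sub>R ?A v \<in> V" if "t \<in> {-e<..<e}" for t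
    proof -
      have "\<bar>t\<bar> * norm (?A v) \<le> e * norm (?A v)"
        using that by (intro mult_right_mono) auto
      also have "\<dots> < e * (1 + norm (?A v))"
        using e by simp
      also have "\<dots> = r"
        by (simp add: e_def) (smt (verit) norm_ge_zero)
      finally have "norm (t *\<^sub>R ?A v) < r" by simp
      then show ?thesis
        using r(2) by (auto simp: dist_norm subset_iff)
    qed
    define c where "c = (\<lambda>t. \<psi> (\<phi> x + t *\<^sub>R ?A v))"
    have "smooth_on {-e<..<e} c"
      using assms(6) inV unfolding smooth_on_def c_def by (auto intro!: Ck_on_compose_line[where V = V])
    moreover have "c ` {-e<..<e} \<subseteq> S"
    proof clarify
      fix t assume "t \<in> {-e<..<e}"
      then have "\<phi> x + t *\<^sub>R ?A v \<in> V \<inter> H"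
        using inV assms(7) phx v by (auto intro: subspace_add subspace_scale)
      then obtain u where "u \<in> U" "u \<in> S" "\<phi> u = \<phi> x + t *\<^sub>R ?A v"
        using assms(8) by (metis IntE imageE)
      then show "c t \<in> S"
        using hom(1) unfolding c_def by metis
    qed
    moreover have "c 0 = x"
      by (simp add: c_def hom assms)
    moreover have "(c has_vector_derivative v) (at 0)"
    proof -
      have 1: "((\<lambda>t. \<phi> x + t *\<^sub>R ?A v) has_derivative (\<lambda>t. t *\<^sub>R ?A v)) (at 0)"
        by (auto intro!: derivative_eq_intros)
      have "(\<psi> has_derivative ?B) (at (\<phi> x + 0 *\<^sub>R ?A v))"
        using dB by simp
      from has_derivative_compose[OF 1 this]
      show ?thesis
        using has_derivative_linear[OF dB] BA
        by (simp add: has_vector_derivative_def linear_cmul c_def)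
    qed
    ultimately show "v \<in> tangent_space S x"
      using e by (auto simp: tangent_space_def)
  qed
qed

lemma subspace_tangent_space:
  fixes S :: "'a::euclidean_space set"
  assumes "smooth_submanifold S" and "x \<in> S"
  shows "subspace (tangent_space S x)"
proof -
  obtain U \<phi> \<psi> and V H :: "'a set" where ch: "homeomorphism U V \<phi> \<psi>" "open U" "x \<in> U" "open V"
      "smooth_on U \<phi>" "smooth_on V \<psi>" "subspace H" "\<phi> ` (U \<inter> S) = V \<inter> H"
    using assms unfolding smooth_submanifold_def by metis
  have "Ck_on (Suc 0) U \<phi>"
    using ch(5) by (auto simp: smooth_on_def)
  then have "linear (frechet_derivative \<phi> (at x))"
    using ch(3) by (auto intro: linear_frechet_derivative)
  from linear_subspace_vimage[OF this ch(7)] show ?thesis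
    using tangent_space_chart[OF ch(2-4,1,5-8) assms(2)] by (simp add: vimage_def)
qed

section \<open>Orthogonal projections and gradients\<close>

lemma orth_proj_unique:
  assumes "subspace T" and "w \<in> T" and "\<And>t. t \<in> T \<Longrightarrow> (v - w) \<bullet> t = 0"
  shows "orth_proj T v = w"
  unfolding orth_proj_def
proof (rule the_equality)
  show "w \<in> T \<and> (\<forall>t\<in>T. (v - w) \<bullet> t = 0)" using assms by simp
  fix u assume u: "u \<in> T \<and> (\<forall>t\<in>T. (v - u) \<bullet> t = 0)"
  then have "u - w \<in> T" using assms by (auto intro: subspace_diff)
  then have "(u - w) \<bullet> (u - w) = (v - w) \<bullet> (u - w) - (v - u) \<bullet> (u - w)"
    by (simp add: inner_diff_left)
  also have "\<dots> = 0" using u assms(3) \<open>u - w \<in> T\<close> by simp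
  finally show "u = w" by simp
qed

lemma orth_proj_in_and_orthogonal:
  fixes T :: "'a::euclidean_space set"
  assumes "subspace T"
  shows "orth_proj T v \<in> T" and "t \<in> T \<Longrightarrow> (v - orth_proj T v) \<bullet> t = 0"
proof -
  obtain y z where yz: "y \<in> span T" "\<And>w. w \<in> span T \<Longrightarrow> orthogonal z w" "v = y + z"
    using orthogonal_subspace_decomp_exists by metis
  have sp: "span T = T" using assms by (simp add: span_eq_iff)
  have *: "(v - y) \<bullet> t = 0" if "t \<in> T" for t
    using yz(2)[of t] that sp yz(3) by (simp add: orthogonal_def)
  have "orth_proj T v = y"
    using yz(1) sp * by (intro orth_proj_unique[OF assms]) auto
  then show "orth_proj T v \<in> T" "t \<in> T \<Longrightarrow> (v - orth_proj T v) \<bullet> t = 0"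
    using yz(1) sp * by auto
qed

lemma norm_orth_proj_le:
  fixes T :: "'a::euclidean_space set"
  assumes "subspace T"
  shows "norm (orth_proj T v) \<le> norm v"
proof -
  let ?w = "orth_proj T v"
  have "(v - ?w) \<bullet> ?w = 0"
    using orth_proj_in_and_orthogonal[OF assms] by blast
  then have "norm ?w * norm ?w = v \<bullet> ?w"
    by (simp add: inner_diff_left power2_norm_eq_inner flip: power2_eq_square)
  also have "\<dots> \<le> norm v * norm ?w" by (rule norm_cauchy_schwarz)
  finally show ?thesis
    by (metis mult_right_le_imp_le norm_ge_zero order_le_less)
qed

lemma linear_orth_proj:
  fixes T :: "'a::euclidean_space set"
  assumes "subspace T"
  shows "linear (orth_proj T)"
proof (rule linearI)
  note oi = orth_proj_in_and_orthogonal[OF assms]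
  show "orth_proj T (u + v) = orth_proj T u + orth_proj T v" for u v
    using oi(1)[of u] oi(1)[of v] oi(2)[of _ u] oi(2)[of _ v]
    by (intro orth_proj_unique[OF assms] subspace_add[OF assms])
      (simp_all add: inner_diff_left inner_add_left)
  show "orth_proj T (c *\<^sub>R v) = c *\<^sub>R orth_proj T v" for c v
    using oi(1)[of v] oi(2)[of _ v]
    by (intro orth_proj_unique[OF assms] subspace_scale[OF assms])
      (simp_all add: inner_diff_left)
qed

lemma euclid_grad_works:
  fixes h :: "'a::euclidean_space \<Rightarrow> real"
  assumes "h differentiable (at x)"
  shows "GDERIV h x :> euclid_grad h x"
proof -
  obtain D where D: "(h has_derivative D) (at x)"
    using assms by (auto simp: differentiable_def)
  then have lin: "linear D" by (rule has_derivative_linear)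
  define g where "g = (\<Sum>b\<in>Basis. D b *\<^sub>R b)"
  have "D = (\<lambda>v. v \<bullet> g)"
  proof
    fix v
    have "D v = D (\<Sum>b\<in>Basis. (v \<bullet> b) *\<^sub>R b)"
      by (simp add: euclidean_representation)
    also have "\<dots> = v \<bullet> g"
      using lin by (simp add: linear_sum linear_cmul g_def inner_sum_right mult.commute)
    finally show "D v = v \<bullet> g" .
  qed
  then have g: "GDERIV h x :> g"
    using D by (simp add: gderiv_def)
  have "g' = g" if "GDERIV h x :> g'" for g'
  proof -
    have "(\<lambda>v. v \<bullet> g') = (\<lambda>v. v \<bullet> g)"
      using has_derivative_unique that g unfolding gderiv_def by blast
    then show ?thesis by (metis vector_eq_ldot)
  qed
  then show ?thesis
    unfolding euclid_grad_def using g by (metis theI)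
qed

lemma euclid_grad_eqI:
  fixes h :: "'a::euclidean_space \<Rightarrow> real"
  assumes "GDERIV h x :> g"
  shows "euclid_grad h x = g"
proof -
  have "h differentiable (at x)"
    using assms by (auto simp: gderiv_def differentiable_def)
  from euclid_grad_works[OF this] have "(\<lambda>v. v \<bullet> euclid_grad h x) = (\<lambda>v. v \<bullet> g)"
    using has_derivative_unique assms unfolding gderiv_def by blast
  then show ?thesis by (metis vector_eq_ldot)
qed

lemma riem_grad_global_obj:
  assumes "smooth_submanifold S" and "x \<in> S"
    and "\<And>i. i < n \<Longrightarrow> client_obj D F i differentiable (at x)"
  shows "riem_grad S (global_obj n D F) x = (1 / real n) *\<^sub>R (\<Sum>i<n. riem_grad S (client_obj D F i) x)"
proof -
  note lin = linear_orth_proj[OF subspace_tangent_space[OF assms(1,2)]]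
  have "GDERIV (global_obj n D F) x :> (1 / real n) *\<^sub>R (\<Sum>i<n. euclid_grad (client_obj D F i) x)"
    unfolding gderiv_def global_obj_def
    using euclid_grad_works[OF assms(3)] unfolding gderiv_def
    by (auto intro!: derivative_eq_intros simp: inner_sum_right sum_divide_distrib)
  then have "euclid_grad (global_obj n D F) x = (1 / real n) *\<^sub>R (\<Sum>i<n. euclid_grad (client_obj D F i) x)"
    by (rule euclid_grad_eqI)
  then show ?thesis
    by (simp add: riem_grad_def linear_cmul[OF lin] linear_sum[OF lin])
qed

section \<open>The metric projection near a submanifold\<close>

locale smooth_projection =
  fixes S :: "'a::euclidean_space set" and P :: "'a \<Rightarrow> 'a" and \<gamma> LP :: real
  assumes compact: "compact S" and submanifold: "smooth_submanifold S"
    and gamma_pos: "0 < \<gamma>"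
    and proj: "projection_on S P" and max_D2: "is_max_D2 S P \<gamma> LP"
begin

abbreviation DP :: "'a \<Rightarrow> 'a \<Rightarrow> 'a" where
  "DP s \<equiv> frechet_derivative P (at s)"

lemma P_in: "P s \<in> S"
  and P_nearest: "z \<in> S \<Longrightarrow> norm (s - P s) \<le> norm (s - z)"
proof -
  have "is_arg_min (\<lambda>y. 1/2 * (norm (s - y))\<^sup>2) (\<lambda>y. y \<in> S) (P s)"
    using proj by (simp add: projection_on_def is_nearest_def)
  then have *: "P s \<in> S" "\<And>z. z \<in> S \<Longrightarrow> \<not> (norm (s - z))\<^sup>2 < (norm (s - P s))\<^sup>2"
    by (auto simp: is_arg_min_def)
  show "P s \<in> S" by (rule *)
  assume "z \<in> S"
  from *(2)[OF this] show "norm (s - P s) \<le> norm (s - z)"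
    by (meson linorder_not_less norm_ge_zero power_strict_mono zero_less_numeral)
qed

lemma P_fixed: "y \<in> S \<Longrightarrow> P y = y"
  using P_nearest[of y y] by simp

lemma in_tube: "y \<in> S \<Longrightarrow> norm (s - y) \<le> \<gamma> \<Longrightarrow> s \<in> tube S \<gamma>"
  using infdist_le[of y S s] by (simp add: tube_def dist_norm)

lemma twice: "s \<in> tube S \<gamma> \<Longrightarrow> twice_differentiable_at P s"
  using max_D2 by (simp add: is_max_D2_def)

lemma has_DP: "s \<in> tube S \<gamma> \<Longrightarrow> (P has_derivative DP s) (at s)"
  using twice[of s] eventually_nhds_x_imp_x
  unfolding twice_differentiable_at_def by (metis frechet_derivative_works)

lemma blinfun_DP: "s \<in> tube S \<gamma> \<Longrightarrow> blinfun_apply (Blinfun (DP s)) = DP s"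
  by (intro bounded_linear_Blinfun_apply has_derivative_bounded_linear[OF has_DP])

text \<open>Let \<open>z\<close> be the selected nearest point of the intermediate point. Optimality
  of \<open>z\<close> there and of \<open>P s\<close> at \<open>s\<close> give two opposite
  inequalities for \<open>(s - P s) \<bullet> (z - P s)\<close>, and together
  \<open>(1 - \<rho>) * (p \<bullet> p) \<le> 0\<close> for \<open>p = z - P s\<close>. No
  uniqueness of nearest points enters; at \<open>\<rho> = 1\<close> there is nothing to
  show.\<close>

lemma P_segment:
  assumes "0 \<le> \<rho>" "\<rho> \<le> 1"
  shows "P (P s + \<rho> *\<^sub>R (s - P s)) = P s"
proof (cases "\<rho> = 1")
  case False
  define e z where "e = s - P s" and "z = P (P s + \<rho> *\<^sub>R (s - P s))"
  define p where "p = z - P s"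
  have "norm (\<rho> *\<^sub>R e - p) \<le> norm (\<rho> *\<^sub>R e)"
    using P_nearest[OF P_in, of "P s + \<rho> *\<^sub>R (s - P s)" s]
    by (simp add: e_def p_def z_def algebra_simps)
  then have "(norm (\<rho> *\<^sub>R e - p))\<^sup>2 \<le> (norm (\<rho> *\<^sub>R e))\<^sup>2"
    by (simp add: power_mono)
  then have 1: "p \<bullet> p \<le> 2 * \<rho> * (e \<bullet> p)"
    by (simp add: power2_norm_eq_inner inner_diff_left inner_diff_right inner_commute
        del: norm_scaleR)
  have "norm e \<le> norm (e - p)"
    using P_nearest[OF P_in, of s] by (simp add: e_def p_def z_def)
  then have "(norm e)\<^sup>2 \<le> (norm (e - p))\<^sup>2"
    by (simp add: power_mono)
  then have "2 * (e \<bullet> p) \<le> p \<bullet> p"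
    by (simp add: power2_norm_eq_inner inner_diff_left inner_diff_right inner_commute
        del: norm_scaleR)
  then have "\<rho> * (2 * (e \<bullet> p)) \<le> \<rho> * (p \<bullet> p)"
    using assms(1) by (rule mult_left_mono)
  with 1 have "(1 - \<rho>) * (p \<bullet> p) \<le> 0"
    by (simp add: algebra_simps)
  then have "p \<bullet> p \<le> 0"
    using False assms(2) by (simp add: mult_le_0_iff)
  then have "p = 0"
    by (metis inner_eq_zero_iff inner_ge_zero order_antisym)
  then show ?thesis
    by (simp add: p_def z_def)
qed simp

text \<open>Constancy along the segment is known only up to \<open>s\<close> itself, so the
  derivative is computed at the endpoint 1 within \<open>{0..1}\<close>; vector derivatives are
  still unique there.\<close>

lemma DP_radial:
  assumes "s \<in> tube S \<gamma>"
  shows "DP s (s - P s) = 0"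
proof -
  let ?e = "s - P s"
  have 1: "((\<lambda>\<rho>. P s + \<rho> *\<^sub>R ?e) has_derivative (\<lambda>\<rho>. \<rho> *\<^sub>R ?e)) (at 1 within {0..1})"
    by (auto intro!: derivative_eq_intros)
  have "(P has_derivative DP s) (at (P s + 1 *\<^sub>R ?e))"
    using has_DP[OF assms] by simp
  from has_derivative_compose[OF 1 this]
  have "((\<lambda>\<rho>. P (P s + \<rho> *\<^sub>R ?e)) has_derivative (\<lambda>\<rho>. DP s (\<rho> *\<^sub>R ?e))) (at 1 within {0..1})" .
  then have d1: "((\<lambda>_. P s) has_derivative (\<lambda>\<rho>. DP s (\<rho> *\<^sub>R ?e))) (at 1 within {0..1})"
    by (rule has_derivative_transform[rotated 2]) (use P_segment in auto)
  have "((\<lambda>_. P s) has_vector_derivative DP s ?e) (at (1::real) within {0..1})"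
    using d1 has_derivative_linear[OF has_DP[OF assms]]
    by (simp add: has_vector_derivative_def linear_cmul)
  moreover have "((\<lambda>_. P s) has_vector_derivative 0) (at (1::real) within {0..1})"
    by simp
  ultimately show ?thesis
    by (rule vector_derivative_unique_within[rotated])
      (simp add: trivial_limit_within islimpt_Icc)
qed

text \<open>The curve \<open>\<phi> \<rho> = P (u + \<rho> e)\<close> satisfies \<open>\<phi>' = DP (\<phi> - u) / \<rho>\<close>, since \<open>DP\<close> annihilates the
  radial direction; by Gronwall's inequality it stays at \<open>u\<close>.\<close>
lemma P_ray:
  assumes "s \<noteq> P s" and "1 \<le> R" and "R * norm (s - P s) \<le> \<gamma>"
  shows "P (P s + R *\<^sub>R (s - P s)) = P s"
proof -
  define u e where "u = P s" and "e = s - u"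
  define q where "q = (\<lambda>\<rho>. u + \<rho> *\<^sub>R e)"
  define \<phi> where "\<phi> = (\<lambda>\<rho>. P (q \<rho>) - u)"
  have tb: "q \<rho> \<in> tube S \<gamma>" if "1 \<le> \<rho>" "\<rho> \<le> R" for \<rho>
  proof (rule in_tube[OF P_in[of s]])
    have "\<bar>\<rho>\<bar> * norm e \<le> R * norm e"
      using that by (intro mult_right_mono) auto
    then show "norm (q \<rho> - P s) \<le> \<gamma>"
      using assms(3) by (simp add: q_def u_def e_def)
  qed
  \<comment> \<open>Twice differentiability makes \<open>DP\<close> continuous along the ray, and
    compactness of \<open>{1..R}\<close> then supplies the Gronwall constant
    \<open>C\<close>.\<close>
  have "continuous_on {1..R} (\<lambda>\<rho>. norm (Blinfun (DP (q \<rho>))))"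
  proof (intro continuous_on_norm continuous_at_imp_continuous_on ballI)
    fix \<rho> assume "\<rho> \<in> {1..R}"
    then have "isCont (\<lambda>y. Blinfun (DP y)) (q \<rho>)"
      using twice[OF tb] unfolding twice_differentiable_at_def
      by (auto intro: differentiable_imp_continuous_within)
    moreover have "isCont q \<rho>"
      unfolding q_def by (intro continuous_intros)
    ultimately show "isCont (\<lambda>\<rho>. Blinfun (DP (q \<rho>))) \<rho>"
      by (rule isCont_o2[rotated])
  qed
  then have "bounded ((\<lambda>\<rho>. norm (Blinfun (DP (q \<rho>)))) ` {1..R})"
    by (intro compact_imp_bounded compact_continuous_image) auto
  then obtain C where "\<forall>\<rho>\<in>{1..R}. norm (Blinfun (DP (q \<rho>))) \<le> C"
    by (auto simp: bounded_iff)
  then have C: "norm (Blinfun (DP (q \<rho>))) \<le> C" if "1 \<le> \<rho>" "\<rho> \<le> R" for \<rho>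
    using that by simp
  have C0: "0 \<le> C"
    using C[of 1] assms(2) norm_ge_zero order_trans by blast
  \<comment> \<open>The integrating factor turns \<open>(\<phi> \<bullet> \<phi>)' \<le> 2 * C *
    (\<phi> \<bullet> \<phi>)\<close> into monotonicity of \<open>N\<close>, and
    \<open>N 1 = 0\<close>.\<close>
  define N where "N = (\<lambda>\<rho>. exp (- 2 * C * \<rho>) * (\<phi> \<rho> \<bullet> \<phi> \<rho>))"
  have "N R \<le> N 1"
  proof (rule DERIV_nonpos_imp_nonincreasing[OF assms(2)])
    fix \<rho> :: real assume \<rho>: "1 \<le> \<rho>" "\<rho> \<le> R"
    let ?D = "DP (q \<rho>)"
    have lin: "linear ?D"
      using has_derivative_linear[OF has_DP[OF tb[OF \<rho>]]] .
    have "(q has_derivative (\<lambda>t. t *\<^sub>R e)) (at \<rho>)"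
      unfolding q_def by (auto intro!: derivative_eq_intros)
    from has_derivative_compose[OF this has_DP[OF tb[OF \<rho>]]]
    have d\<phi>: "(\<phi> has_derivative (\<lambda>t. t *\<^sub>R ?D e)) (at \<rho>)"
      unfolding \<phi>_def by (auto intro!: derivative_eq_intros simp: linear_cmul[OF lin])
    have "?D (q \<rho> - P (q \<rho>)) = 0"
      by (rule DP_radial[OF tb[OF \<rho>]])
    moreover have "q \<rho> - P (q \<rho>) = \<rho> *\<^sub>R e - \<phi> \<rho>"
      by (simp add: q_def \<phi>_def)
    ultimately have eq: "\<rho> *\<^sub>R ?D e = ?D (\<phi> \<rho>)"
      by (simp add: linear_diff[OF lin] linear_cmul[OF lin])
    have "\<rho> * (\<phi> \<rho> \<bullet> ?D e) = \<phi> \<rho> \<bullet> ?D (\<phi> \<rho>)"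
      using eq by (metis inner_scaleR_right)
    also have "\<dots> \<le> norm (\<phi> \<rho>) * norm (?D (\<phi> \<rho>))"
      by (rule norm_cauchy_schwarz)
    also have "\<dots> \<le> norm (\<phi> \<rho>) * (C * norm (\<phi> \<rho>))"
    proof (intro mult_left_mono)
      have "norm (blinfun_apply (Blinfun ?D) (\<phi> \<rho>)) \<le> norm (Blinfun ?D) * norm (\<phi> \<rho>)"
        by (rule norm_blinfun)
      also have "\<dots> \<le> C * norm (\<phi> \<rho>)"
        using C \<rho> by (intro mult_right_mono) auto
      finally show "norm (?D (\<phi> \<rho>)) \<le> C * norm (\<phi> \<rho>)"
        by (simp add: blinfun_DP[OF tb[OF \<rho>]])
    qed simp
    also have "\<dots> = C * (\<phi> \<rho> \<bullet> \<phi> \<rho>)"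
      by (simp add: power2_norm_eq_inner[symmetric] power2_eq_square)
    \<comment> \<open>The range starts at 1, so inserting \<open>\<rho>\<close> only enlarges the
      nonnegative right side; afterwards \<open>\<rho>\<close> cancels.\<close>
    also have "\<dots> \<le> \<rho> * (C * (\<phi> \<rho> \<bullet> \<phi> \<rho>))"
      using mult_right_mono[of 1 \<rho> "C * (\<phi> \<rho> \<bullet> \<phi> \<rho>)"] C0 \<rho> by simp
    finally have le: "\<phi> \<rho> \<bullet> ?D e \<le> C * (\<phi> \<rho> \<bullet> \<phi> \<rho>)"
      using \<rho> by simp
    have "((\<lambda>\<rho>. \<phi> \<rho> \<bullet> \<phi> \<rho>) has_derivative (\<lambda>t. \<phi> \<rho> \<bullet> (t *\<^sub>R ?D e) + (t *\<^sub>R ?D e) \<bullet> \<phi> \<rho>)) (at \<rho>)"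
      by (rule has_derivative_inner[OF d\<phi> d\<phi>])
    then have "((\<lambda>\<rho>. \<phi> \<rho> \<bullet> \<phi> \<rho>) has_real_derivative 2 * (\<phi> \<rho> \<bullet> ?D e)) (at \<rho>)"
      unfolding has_field_derivative_def
      by (rule has_derivative_eq_rhs) (auto simp: inner_commute algebra_simps)
    then have "(N has_real_derivative exp (- 2 * C * \<rho>) * (2 * (\<phi> \<rho> \<bullet> ?D e))
        + exp (- 2 * C * \<rho>) * (- 2 * C) * (\<phi> \<rho> \<bullet> \<phi> \<rho>)) (at \<rho>)"
      unfolding N_def by (auto intro!: derivative_eq_intros)
    moreover have "exp (- 2 * C * \<rho>) * (2 * (\<phi> \<rho> \<bullet> ?D e))
        + exp (- 2 * C * \<rho>) * (- 2 * C) * (\<phi> \<rho> \<bullet> \<phi> \<rho>)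
        = 2 * exp (- 2 * C * \<rho>) * (\<phi> \<rho> \<bullet> ?D e - C * (\<phi> \<rho> \<bullet> \<phi> \<rho>))"
      by (simp add: algebra_simps)
    moreover have "\<dots> \<le> 0"
      using le by (intro mult_nonneg_nonpos) auto
    ultimately show "\<exists>y. (N has_real_derivative y) (at \<rho>) \<and> y \<le> 0"
      by metis
  qed
  also have "N 1 = 0"
    by (simp add: N_def \<phi>_def q_def e_def u_def)
  finally have "\<phi> R \<bullet> \<phi> R \<le> 0"
    by (simp add: N_def mult_le_0_iff not_less)
  then have "\<phi> R = 0"
    by (metis inner_eq_zero_iff inner_ge_zero order_antisym)
  then show ?thesis
    by (simp add: \<phi>_def q_def e_def u_def)
qed

text \<open>By \<open>P_ray\<close> the point at distance \<gamma> from \<open>P s\<close> in the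
  direction \<open>s - P s\<close> still projects to \<open>P s\<close>, so the open ball of radius
  \<gamma> around it misses \<open>S\<close>. Comparing its distances to \<open>P s\<close> and to
  \<open>z\<close> and expanding the squares gives the inequality; rescaling to \<open>s\<close>
  produces \<open>norm (s - P s) / (2 * \<gamma>)\<close>.\<close>

lemma P_variational:
  assumes "norm (s - P s) \<le> \<gamma>" and "z \<in> S"
  shows "(s - P s) \<bullet> (z - P s) \<le> norm (s - P s) / (2 * \<gamma>) * (norm (z - P s))\<^sup>2"
proof (cases "s = P s")
  case False
  define e p R where "e = s - P s" and "p = z - P s" and "R = \<gamma> / norm e"
  have e: "0 < norm e"
    using False by (simp add: e_def)
  have R: "1 \<le> R" "R * norm e = \<gamma>" "0 < R"
    using assms(1) e gamma_pos by (auto simp: R_def e_def)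
  have "P (P s + R *\<^sub>R e) = P s"
    using P_ray[OF False, of R] R by (simp add: e_def)
  then have "norm (R *\<^sub>R e) \<le> norm (R *\<^sub>R e - p)"
    using P_nearest[OF assms(2), of "P s + R *\<^sub>R e"] by (simp add: p_def algebra_simps)
  then have "(norm (R *\<^sub>R e))\<^sup>2 \<le> (norm (R *\<^sub>R e - p))\<^sup>2"
    by (simp add: power_mono)
  then have "2 * R * (e \<bullet> p) \<le> p \<bullet> p"
    by (simp add: power2_norm_eq_inner inner_diff_left inner_diff_right inner_commute
        del: norm_scaleR)
  then have "e \<bullet> p \<le> (p \<bullet> p) / (2 * R)"
    using R by (simp add: field_simps)
  also have "\<dots> = norm e / (2 * \<gamma>) * (norm p)\<^sup>2"
    by (simp add: R_def power2_norm_eq_inner)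
  finally show ?thesis
    by (simp add: e_def p_def)
qed simp

text \<open>Differentiate \<open>P (c t) = c t\<close> along a curve \<open>c\<close> in
  \<open>S\<close> with velocity \<open>v\<close>.\<close>

lemma DP_tangent:
  assumes "y \<in> S" and "v \<in> tangent_space S y"
  shows "DP y v = v"
proof -
  obtain c and e :: real where c: "0 < e" "c ` {-e<..<e} \<subseteq> S" "c 0 = y"
      "(c has_vector_derivative v) (at 0)"
    using assms(2) by (auto simp: tangent_space_def)
  have "y \<in> tube S \<gamma>"
    using in_tube[OF assms(1), of y] gamma_pos by simp
  then have P: "(P has_derivative DP y) (at (c 0))"
    using has_DP c(3) by simp
  have "((\<lambda>t. P (c t)) has_derivative (\<lambda>t. DP y (t *\<^sub>R v))) (at 0)"
    using has_derivative_compose[OF c(4)[unfolded has_vector_derivative_def] P] .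
  then have "((\<lambda>t. P (c t)) has_vector_derivative DP y v) (at 0)"
    using has_derivative_linear[OF P] by (simp add: has_vector_derivative_def linear_cmul)
  moreover have "((\<lambda>t. P (c t)) has_vector_derivative v) (at 0)"
    by (rule has_vector_derivative_transform_within_open[OF c(4), of "{-e<..<e}"])
      (use c P_fixed in \<open>auto simp: image_subset_iff\<close>)
  ultimately show ?thesis
    by (rule vector_derivative_unique_at)
qed

text \<open>Second order Taylor estimate: \<open>DP\<close> fixes \<open>v\<close> at
  \<open>y\<close> and is Lipschitz with constant \<open>LP\<close> along the segment, so the
  derivative of \<open>P (y + t *\<^sub>R v) - t *\<^sub>R v\<close> has norm at most
  \<open>LP * (norm v)\<^sup>2 * t\<close>. Integration over \<open>t\<close> gives the factor
  1/2.\<close>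

lemma P_tangent_step:
  assumes y: "y \<in> S" and v: "v \<in> tangent_space S y" "norm v \<le> \<gamma>"
  shows "norm (P (y + v) - y - v) \<le> LP / 2 * (norm v)\<^sup>2"
proof -
  have seg: "y + t *\<^sub>R v \<in> tube S \<gamma>" if "0 \<le> t" "t \<le> 1" for t
  proof (rule in_tube[OF y])
    have "t * norm v \<le> 1 * \<gamma>"
      using that v by (intro mult_mono) auto
    then show "norm (y + t *\<^sub>R v - y) \<le> \<gamma>" using that by simp
  qed
  have lip: "norm (DP (y + t *\<^sub>R v) v - v) \<le> LP * (norm v)\<^sup>2 * t" if t: "0 < t" "t < 1" for t
  proof -
    let ?B = "\<lambda>y. Blinfun (DP y)"
    let ?T = "closed_segment y (y + v)"
    have T: "?T \<subseteq> tube S \<gamma>"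
      using seg by (auto simp: closed_segment_def algebra_simps)
    have "norm (?B (y + t *\<^sub>R v) - ?B y) \<le> LP * norm (y + t *\<^sub>R v - y)"
    proof (rule differentiable_bound[OF convex_closed_segment[of y "y + v"]])
      fix x assume "x \<in> ?T"
      then have x: "x \<in> tube S \<gamma>" using T by auto
      show "(?B has_derivative frechet_derivative ?B (at x)) (at x within ?T)"
        using twice[OF x] has_derivative_at_withinI
        unfolding twice_differentiable_at_def by (metis frechet_derivative_works)
      show "onorm (frechet_derivative ?B (at x)) \<le> LP"
        using max_D2 x by (simp add: is_max_D2_def D2_norm_def)
    next
      show "y + t *\<^sub>R v \<in> ?T"
        using t by (auto simp: closed_segment_def algebra_simps intro!: exI[of _ t])
    qed auto
    then have "norm (blinfun_apply (?B (y + t *\<^sub>R v) - ?B y) v) \<le> (LP * norm (t *\<^sub>R v)) * norm v"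
      by (intro order_trans[OF norm_blinfun] mult_right_mono) auto
    moreover have "y \<in> tube S \<gamma>"
      using seg[of 0] by simp
    ultimately show ?thesis
      using t DP_tangent[OF y v(1)] seg[of t]
      by (simp add: blinfun.diff_left blinfun_DP power2_eq_square mult_ac)
  qed
  \<comment> \<open>The mean value comparison of \<open>?f\<close> with the scalar majorant
    \<open>?h\<close> replaces integration.\<close>
  let ?f = "\<lambda>t. P (y + t *\<^sub>R v) - t *\<^sub>R v"
  let ?h = "\<lambda>t. LP * (norm v)\<^sup>2 * (t\<^sup>2 / 2)"
  have f': "(?f has_vector_derivative (DP (y + t *\<^sub>R v) v - v)) (at t)" if "0 \<le> t" "t \<le> 1" for t
  proof -
    have 1: "((\<lambda>t. y + t *\<^sub>R v) has_derivative (\<lambda>t. t *\<^sub>R v)) (at t)"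
      by (auto intro!: derivative_eq_intros)
    have "((\<lambda>t. P (y + t *\<^sub>R v)) has_derivative (\<lambda>s. DP (y + t *\<^sub>R v) (s *\<^sub>R v))) (at t)"
      using has_derivative_compose[OF 1 has_DP[OF seg[OF that]]] .
    then have "((\<lambda>t. P (y + t *\<^sub>R v)) has_vector_derivative DP (y + t *\<^sub>R v) v) (at t)"
      using has_derivative_linear[OF has_DP[OF seg[OF that]]]
      by (simp add: has_vector_derivative_def linear_cmul)
    moreover have "((\<lambda>t. t *\<^sub>R v) has_vector_derivative v) (at t)"
      using has_derivative_scaleR_left[OF has_derivative_ident] by (simp add: has_vector_derivative_def)
    ultimately show ?thesis
      by (rule has_vector_derivative_diff)
  qed
  have "norm (?f 1 - ?f 0) \<le> ?h 1 - ?h 0"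
  proof (rule differentiable_bound_general)
    show "continuous_on {0..1} ?f"
      using has_vector_derivative_continuous[OF f'] by (intro continuous_at_imp_continuous_on) auto
    show "(?h has_vector_derivative (LP * (norm v)\<^sup>2 * t)) (at t)" for t
      unfolding has_real_derivative_iff_has_vector_derivative[symmetric]
      by (auto intro!: derivative_eq_intros)
  qed (use lip f' in \<open>auto intro!: continuous_intros\<close>)
  then show ?thesis
    using P_fixed[OF y] by (simp add: algebra_simps)
qed

end

section \<open>One communication round\<close>

lemma norm_sum_squared_le:
  fixes x :: "'i \<Rightarrow> 'a::real_normed_vector"
  shows "(norm (\<Sum>i\<in>I. x i))\<^sup>2 \<le> real (card I) * (\<Sum>i\<in>I. (norm (x i))\<^sup>2)"
proof -
  have "(norm (\<Sum>i\<in>I. x i))\<^sup>2 \<le> (\<Sum>i\<in>I. norm (x i))\<^sup>2"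
    by (intro power_mono norm_sum) auto
  also have "\<dots> \<le> real (card I) * (\<Sum>i\<in>I. (norm (x i))\<^sup>2)"
    using sum_squared_le_sum_of_squares[of "\<lambda>i. norm (x i)" I] by (simp add: mult.commute)
  finally show ?thesis .
qed

lemma norm_add_squared_le_weighted:
  fixes x y :: "'a::real_inner"
  assumes "0 < t"
  shows "(norm (x + y))\<^sup>2 \<le> (1 + t) * (norm x)\<^sup>2 + (1 + 1 / t) * (norm y)\<^sup>2"
proof -
  have "0 \<le> (norm (t *\<^sub>R x - y))\<^sup>2 / t"
    using assms by simp
  also have "(norm (t *\<^sub>R x - y))\<^sup>2 = t * (t * (norm x)\<^sup>2) - 2 * t * (x \<bullet> y) + (norm y)\<^sup>2"
    by (simp add: power2_norm_eq_inner inner_diff_left inner_diff_right inner_commute)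
  also have "\<dots> / t = t * (norm x)\<^sup>2 - 2 * (x \<bullet> y) + (norm y)\<^sup>2 / t"
    using assms by (simp add: add_divide_distrib diff_divide_distrib)
  finally show ?thesis
    by (simp add: power2_norm_eq_inner inner_add_left inner_add_right inner_commute algebra_simps)
qed

lemma norm_add_squared_le:
  fixes x y :: "'a::real_inner"
  shows "(norm (x + y))\<^sup>2 \<le> 2 * (norm x)\<^sup>2 + 2 * (norm y)\<^sup>2"
  using norm_add_squared_le_weighted[of 1 x y] by simp

lemma norm_diff_squared_le:
  fixes x y :: "'a::real_inner"
  shows "(norm (x - y))\<^sup>2 \<le> 2 * (norm x)\<^sup>2 + 2 * (norm y)\<^sup>2"
  using norm_add_squared_le[of x "- y"] by simp

text \<open>The mean minimises the sum of squared distances; here it is compared with the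
  origin.\<close>

lemma sum_norm_squared_centered_le:
  fixes q :: "nat \<Rightarrow> 'a::real_inner"
  shows "(\<Sum>i<n. (norm (q i - (1 / real n) *\<^sub>R (\<Sum>j<n. q j)))\<^sup>2) \<le> (\<Sum>i<n. (norm (q i))\<^sup>2)"
proof (cases "n = 0")
  case False
  define m where "m = (1 / real n) *\<^sub>R (\<Sum>j<n. q j)"
  have m: "(\<Sum>j<n. q j) = real n *\<^sub>R m"
    using False by (simp add: m_def)
  have "(\<Sum>i<n. (norm (q i - m))\<^sup>2) = (\<Sum>i<n. (norm (q i))\<^sup>2 - 2 * (q i \<bullet> m) + (norm m)\<^sup>2)"
    by (intro sum.cong) (auto simp: power2_norm_eq_inner inner_diff_left inner_diff_right inner_commute)
  also have "\<dots> = (\<Sum>i<n. (norm (q i))\<^sup>2) - 2 * ((\<Sum>i<n. q i) \<bullet> m) + real n * (norm m)\<^sup>2"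
    by (simp add: sum.distrib sum_subtractf inner_sum_left sum_distrib_left)
  also have "\<dots> \<le> (\<Sum>i<n. (norm (q i))\<^sup>2)"
    by (simp add: m power2_norm_eq_inner)
  finally show ?thesis
    by (simp add: m_def)
qed simp

text \<open>Bookkeeping for the average over \<open>T\<close> local steps, isolated from the
  vectors: \<open>X\<close> is a client's sum of squared drifts, \<open>Y\<close> its sum of squared
  partial noise sums. Dividing by \<open>T ^ 3\<close> combines the average over steps with the
  \<open>T\<^sup>2\<close> of the bound for one step.\<close>

lemma average_le:
  fixes T N X Y g l B :: real
  assumes "0 < T"
    and "576 * N * T\<^sup>2 * X \<le> T * (3 / 2 * (T\<^sup>2 * g))
      + 12 * (T * (T\<^sup>2 * l) + T * (T * X) + T * (T\<^sup>2 * B) + Y)"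
  shows "576 * N * (1 / T * X) \<le> 3 / 2 * g + 12 * (l + 1 / T * X + B + 1 / T ^ 3 * Y)"
proof -
  have "576 * N * (1 / T * X) = (576 * N * T\<^sup>2 * X) / T ^ 3"
    using assms(1) by (simp add: field_simps power2_eq_square power3_eq_cube)
  also have "\<dots> \<le> (T * (3 / 2 * (T\<^sup>2 * g))
      + 12 * (T * (T\<^sup>2 * l) + T * (T * X) + T * (T\<^sup>2 * B) + Y)) / T ^ 3"
    using assms by (intro divide_right_mono) auto
  also have "\<dots> = 3 / 2 * g + 12 * (l + 1 / T * X + B + 1 / T ^ 3 * Y)"
    using assms(1) by (simp add: field_simps power2_eq_square power3_eq_cube)
  finally show ?thesis .
qed

section \<open>Projections of short steps from the submanifold\<close>

context smooth_projection
begin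

text \<open>As \<open>y\<close> lies in \<open>S\<close>, the point \<open>y + v\<close> is within
  \<gamma> / 6 of its projection, and 1/12 is 1/6 divided by the 2 in
  \<open>P_variational\<close>.\<close>

lemma P_step_variational:
  assumes "y \<in> S" "norm v \<le> \<gamma> / 6" "z \<in> S"
  shows "(y + v - P (y + v)) \<bullet> (z - P (y + v)) \<le> (norm (z - P (y + v)))\<^sup>2 / 12"
proof -
  let ?s = "y + v"
  have 1: "norm (?s - P ?s) \<le> \<gamma> / 6"
    using P_nearest[OF assms(1), of ?s] assms(2) by simp
  then have "(?s - P ?s) \<bullet> (z - P ?s) \<le> norm (?s - P ?s) / (2 * \<gamma>) * (norm (z - P ?s))\<^sup>2"
    using assms(3) gamma_pos by (intro P_variational) auto
  also have "\<dots> \<le> 1 / 12 * (norm (z - P ?s))\<^sup>2"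
    using 1 gamma_pos by (intro mult_right_mono) (auto simp: field_simps)
  finally show ?thesis by simp
qed

text \<open>Add the variational inequalities of the two points, each tested with the projection of
  the other. The two errors of 1/12 leave the factor 5/6 of a firmly nonexpansive map.\<close>

lemma P_step_lipschitz:
  assumes "y \<in> S" "norm v \<le> \<gamma> / 6" "norm v' \<le> \<gamma> / 6"
  shows "norm (P (y + v) - P (y + v')) \<le> 6 / 5 * norm (v - v')"
proof -
  let ?u = "P (y + v)" and ?u' = "P (y + v')"
  have "(y + v - ?u) \<bullet> (?u' - ?u) \<le> (norm (?u' - ?u))\<^sup>2 / 12"
    "(y + v' - ?u') \<bullet> (?u - ?u') \<le> (norm (?u - ?u'))\<^sup>2 / 12"
    using P_step_variational[OF assms(1,2) P_in] P_step_variational[OF assms(1,3) P_in] by auto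
  then have "5 / 6 * (norm (?u - ?u'))\<^sup>2 \<le> (v - v') \<bullet> (?u - ?u')"
    by (simp add: power2_norm_eq_inner inner_diff_left inner_diff_right inner_add_left inner_commute)
  also have "\<dots> \<le> norm (v - v') * norm (?u - ?u')"
    by (rule norm_cauchy_schwarz)
  finally have "5 / 6 * norm (?u - ?u') * norm (?u - ?u') \<le> norm (v - v') * norm (?u - ?u')"
    by (simp add: power2_eq_square)
  then have "5 / 6 * norm (?u - ?u') \<le> norm (v - v')"
    by (cases "?u = ?u'") auto
  then show ?thesis by simp
qed

text \<open>The variational inequality tested with \<open>z = y\<close>.\<close>

lemma P_step_inner:
  assumes "y \<in> S" "norm v \<le> \<gamma> / 6"
  shows "11 / 12 * (norm (P (y + v) - y))\<^sup>2 \<le> v \<bullet> (P (y + v) - y)"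
  using P_step_variational[OF assms assms(1)]
  by (simp add: power2_norm_eq_inner inner_diff_left inner_diff_right inner_add_left
      inner_add_right inner_commute)

lemma P_step_norm_le:
  assumes "y \<in> S" "norm v \<le> \<gamma> / 6"
  shows "norm (P (y + v) - y) \<le> 12 / 11 * norm v"
proof -
  have "11 / 12 * norm (P (y + v) - y) * norm (P (y + v) - y) \<le> norm v * norm (P (y + v) - y)"
    using order_trans[OF P_step_inner[OF assms] norm_cauchy_schwarz] by (simp add: power2_eq_square)
  then have "11 / 12 * norm (P (y + v) - y) \<le> norm v"
    by (cases "P (y + v) = y") auto
  then show ?thesis by simp
qed

end

text \<open>All that a round uses of the problem, free of probability: \<open>gr i\<close> stands
  for the Riemannian gradient of client \<open>i\<close>, \<open>\<beta>\<close> for a bound on the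
  estimator bias. \<open>h_chi\<close> and \<open>h_chiG\<close> keep exact and estimated steps
  below \<gamma> / 6, the range of the projection estimates above.\<close>

locale fed_objective = smooth_projection S P \<gamma> LP
  for S :: "'a::euclidean_space set" and P :: "'a \<Rightarrow> 'a" and \<gamma> LP +
  fixes f :: "'a \<Rightarrow> real" and gr :: "nat \<Rightarrow> 'a \<Rightarrow> 'a" and n \<tau> :: nat
    and L M chi chiG \<eta> h \<beta> :: real
  assumes n_pos: "0 < n" and tau_pos: "0 < \<tau>" and eta_pos: "0 < \<eta>"
    and L_pos: "0 < L" and M_pos: "0 < M" and chi_pos: "0 < chi" and beta_nonneg: "0 \<le> \<beta>"
    and h_eq: "h = sqrt (real n) * \<eta> * real \<tau>"
    and h_ML: "24 * M * L * h \<le> 1" and h_chiG: "h * chiG \<le> \<gamma> / 6" and h_chi: "h * chi \<le> \<gamma> / 6"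
    and h_LP: "h * (chi * LP) \<le> 1"
    and dist_M: "x \<in> S \<Longrightarrow> y \<in> S \<Longrightarrow> norm (y - x) \<le> M * norm (y - x)"
    and f_smooth: "x \<in> S \<Longrightarrow> y \<in> S \<Longrightarrow>
      f y - f x \<le> ((1 / real n) *\<^sub>R (\<Sum>i<n. gr i x)) \<bullet> (y - x) + L / 2 * (norm (x - y))\<^sup>2"
    and gr_lipschitz: "i < n \<Longrightarrow> x \<in> S \<Longrightarrow> y \<in> S \<Longrightarrow> norm (gr i x - gr i y) \<le> L * norm (x - y)"
    and gr_bound: "i < n \<Longrightarrow> x \<in> S \<Longrightarrow> norm (gr i x) \<le> chi"
    and gr_tangent: "x \<in> S \<Longrightarrow> (1 / real n) *\<^sub>R (\<Sum>i<n. gr i x) \<in> tangent_space S x"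
begin

definition gm :: "'a \<Rightarrow> 'a" where
  "gm x = (1 / real n) *\<^sub>R (\<Sum>i<n. gr i x)"

text \<open>For corrections summing to zero this is the variance of the corrected client gradients
  around their mean \<open>gm x\<close>; for zero corrections it is, up to its weight, the last term
  of the initialization constant.\<close>

definition hetero :: "'a \<Rightarrow> (nat \<Rightarrow> 'a) \<Rightarrow> real" where
  "hetero x c = (1 / real n) * (\<Sum>i<n. (norm (gr i x - gm x + c i))\<^sup>2)"

definition subopt :: "'a \<Rightarrow> real" where
  "subopt y = norm (y - P (y - h *\<^sub>R gm y)) / h"

lemma h_pos: "0 < h"
  using n_pos tau_pos eta_pos by (simp add: h_eq)

lemma norm_gm_le: "x \<in> S \<Longrightarrow> norm (gm x) \<le> chi"
proof -
  assume "x \<in> S"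
  then have "norm (\<Sum>i<n. gr i x) \<le> real n * chi"
    using sum_norm_bound[of "{..<n}" "\<lambda>i. gr i x" chi] gr_bound by simp
  then show ?thesis
    using n_pos by (simp add: gm_def field_simps)
qed

lemma norm_h_gm_le: "x \<in> S \<Longrightarrow> norm (- (h *\<^sub>R gm x)) \<le> \<gamma> / 6"
  using mult_left_mono[OF norm_gm_le, of x h] h_pos order_trans[OF _ h_chi] by simp

lemma subopt_nonneg: "0 \<le> subopt y"
  using h_pos by (simp add: subopt_def)

lemma subopt_le: "y \<in> S \<Longrightarrow> subopt y \<le> 12 / 11 * chi"
proof -
  assume y: "y \<in> S"
  have "norm (y - P (y - h *\<^sub>R gm y)) \<le> 12 / 11 * (h * norm (gm y))"
    using P_step_norm_le[OF y norm_h_gm_le[OF y]] h_pos by (simp add: norm_minus_commute)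
  also have "\<dots> \<le> 12 / 11 * (h * chi)"
    using norm_gm_le[OF y] h_pos by simp
  finally show ?thesis
    using h_pos by (simp add: subopt_def field_simps)
qed

text \<open>The gradient is tangent, so \<open>P_tangent_step\<close> applies to the step along it.
  By \<open>h * (chi * LP) \<le> 1\<close> the projection changes this step by at most half its
  length, and at least half of the step survives.\<close>

lemma norm_gm_le_subopt: "y \<in> S \<Longrightarrow> norm (gm y) \<le> 2 * subopt y"
proof -
  assume y: "y \<in> S"
  let ?g = "gm y"
  let ?v = "- (h *\<^sub>R ?g)"
  have "subspace (tangent_space S y)"
    by (rule subspace_tangent_space[OF submanifold y])
  then have "?v \<in> tangent_space S y"
    using gr_tangent[OF y] unfolding gm_def[symmetric] by (intro subspace_neg subspace_scale)
  then have "norm (P (y + ?v) - y - ?v) \<le> LP / 2 * (norm ?v)\<^sup>2"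
    using norm_h_gm_le[OF y] gamma_pos by (intro P_tangent_step[OF y]) auto
  also have "\<dots> = (h * (norm ?g * LP)) * (h * norm ?g / 2)"
    using h_pos by (simp add: power2_eq_square)
  also have "\<dots> \<le> 1 * (h * norm ?g / 2)"
  proof (intro mult_right_mono)
    show "h * (norm ?g * LP) \<le> 1"
    proof (cases "0 \<le> LP")
      case True
      then have "h * (norm ?g * LP) \<le> h * (chi * LP)"
        using norm_gm_le[OF y] h_pos by (intro mult_left_mono mult_right_mono) auto
      then show ?thesis using h_LP by simp
    next
      case False
      then have "h * (norm ?g * LP) \<le> 0"
        using h_pos by (intro mult_nonneg_nonpos) auto
      then show ?thesis by simp
    qed
  qed (use h_pos in auto)
  finally have "norm (P (y + ?v) - y - ?v) \<le> h * norm ?g / 2" by simp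
  moreover have "norm ?v \<le> norm (P (y + ?v) - y) + norm (P (y + ?v) - y - ?v)"
    by (metis norm_triangle_sub norm_minus_commute)
  ultimately have "h * norm ?g \<le> 2 * norm (y - P (y - h *\<^sub>R ?g))"
    using h_pos by (simp add: norm_minus_commute)
  then show ?thesis
    using h_pos by (simp add: subopt_def field_simps)
qed

text \<open>On a singleton \<open>S\<close> the constant \<open>M\<close> may be less than 1; the bound \<open>dist_M\<close> covers
  this case as well.\<close>
lemma L_h_norm_le: "x \<in> S \<Longrightarrow> y \<in> S \<Longrightarrow> 24 * (L * h * norm (y - x)) \<le> norm (y - x)"
proof -
  assume *: "x \<in> S" "y \<in> S"
  have "24 * (L * h * norm (y - x)) \<le> 24 * (L * h * (M * norm (y - x)))"
    using dist_M[OF *] L_pos h_pos by simp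
  also have "\<dots> = (24 * M * L * h) * norm (y - x)"
    by simp
  also have "\<dots> \<le> 1 * norm (y - x)"
    by (intro mult_right_mono h_ML) auto
  finally show ?thesis by simp
qed

end

text \<open>One realisation of a round: each estimate is the client gradient at the local iterate
  plus bias \<open>b\<close> plus noise \<open>w\<close>. Local iterates enter through membership in
  \<open>S\<close> and \<open>z_step\<close>; the global constant \<open>M\<close> controls them
  even when the unprojected points are far from \<open>S\<close>.\<close>

locale fed_round = fed_objective S P \<gamma> LP f gr n \<tau> L M chi chiG \<eta> h \<beta>
  for S :: "'a::euclidean_space set" and P :: "'a \<Rightarrow> 'a" and \<gamma> LP f gr n \<tau> L M chi chiG \<eta> h \<beta> +
  fixes y :: 'a and c :: "nat \<Rightarrow> 'a" and z G w b :: "nat \<Rightarrow> nat \<Rightarrow> 'a"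
  assumes y_in: "y \<in> S" and z_in: "i < n \<Longrightarrow> t < \<tau> \<Longrightarrow> z i t \<in> S"
    and G_eq: "i < n \<Longrightarrow> t < \<tau> \<Longrightarrow> G i t = gr i (z i t) + b i t + w i t"
    and b_le: "i < n \<Longrightarrow> t < \<tau> \<Longrightarrow> norm (b i t) \<le> \<beta>"
    and G_le: "i < n \<Longrightarrow> t < \<tau> \<Longrightarrow> norm (G i t) \<le> chiG"
    and z_step: "i < n \<Longrightarrow> t < \<tau> \<Longrightarrow> norm (z i t - y) \<le> M * norm (\<eta> *\<^sub>R (\<Sum>l<t. G i l + c i))"
    and c_sum: "(\<Sum>i<n. c i) = 0"
begin

definition Gm :: "nat \<Rightarrow> 'a" where "Gm i = (1 / real \<tau>) *\<^sub>R (\<Sum>t<\<tau>. G i t)"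
definition Gb :: 'a where "Gb = (1 / real n) *\<^sub>R (\<Sum>i<n. Gm i)"
definition yp :: 'a where "yp = P (y - h *\<^sub>R Gb)"
definition yt :: 'a where "yt = P (y - h *\<^sub>R gm y)"
definition \<delta> :: "nat \<Rightarrow> nat \<Rightarrow> 'a" where "\<delta> i t = gr i y - gr i (z i t)"
definition drift :: real where "drift = (1 / real n) * (\<Sum>i<n. (1 / real \<tau>) * (\<Sum>t<\<tau>. (norm (\<delta> i t))\<^sup>2))"
definition wm :: "nat \<Rightarrow> 'a" where "wm i = (1 / real \<tau>) *\<^sub>R (\<Sum>t<\<tau>. w i t)"
definition wb :: 'a where "wb = (1 / real n) *\<^sub>R (\<Sum>i<n. wm i)"
definition W_client :: real where "W_client = (1 / real n) * (\<Sum>i<n. (norm (wm i))\<^sup>2)"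
text \<open>The sums of noise up to step \<open>t\<close> move the local iterates. One factor
  \<open>real \<tau>\<close> averages over the steps, the other two come from the squared scale in
  \<open>drift_client\<close>.\<close>

definition W_partial :: real where
  "W_partial = (1 / real n) * (\<Sum>i<n. (1 / real \<tau> ^ 3) * (\<Sum>t<\<tau>. (norm (\<Sum>l<t. w i l))\<^sup>2))"
definition d :: real where "d = norm (yp - y) / h"

text \<open>Lipschitz continuity and \<open>z_step\<close> bound the drift by
  \<open>L * M * \<eta>\<close> times the norm of the accumulated update. With
  \<open>24 * M * L * h \<le> 1\<close> and \<open>h = sqrt (real n) * \<eta> * real \<tau>\<close>,
  this becomes a bound on \<open>24 * sqrt (real n) * real \<tau>\<close> times the drift, and 576
  is the square of 24.\<close>

lemma drift_client:
  assumes i: "i < n" and t: "t < \<tau>"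
  shows "576 * real n * (real \<tau>)\<^sup>2 * (norm (\<delta> i t))\<^sup>2 \<le>
    3 / 2 * ((real \<tau>)\<^sup>2 * (norm (gm y))\<^sup>2)
    + 12 * ((real \<tau>)\<^sup>2 * (norm (gr i y - gm y + c i))\<^sup>2 + real \<tau> * (\<Sum>l<\<tau>. (norm (\<delta> i l))\<^sup>2)
        + (real \<tau>)\<^sup>2 * \<beta>\<^sup>2 + (norm (\<Sum>l<t. w i l))\<^sup>2)"
proof -
  let ?r = "gr i y - gm y + c i"
  let ?v = "\<Sum>l<t. G i l + c i"
  have "24 * sqrt (real n) * real \<tau> * norm (\<delta> i t) \<le> 24 * sqrt (real n) * real \<tau> * (L * (M * (\<eta> * norm ?v)))"
  proof (intro mult_left_mono)
    have "norm (\<delta> i t) \<le> L * norm (z i t - y)"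
      using gr_lipschitz[OF i y_in z_in[OF i t]] by (simp add: \<delta>_def norm_minus_commute)
    also have "\<dots> \<le> L * (M * (\<eta> * norm ?v))"
      using z_step[OF i t] L_pos eta_pos by simp
    finally show "norm (\<delta> i t) \<le> L * (M * (\<eta> * norm ?v))" .
  qed auto
  also have "\<dots> = (24 * M * L * h) * norm ?v"
    by (simp add: h_eq mult_ac)
  also have "\<dots> \<le> 1 * norm ?v"
    by (intro mult_right_mono h_ML) auto
  finally have "(24 * sqrt (real n) * real \<tau> * norm (\<delta> i t))\<^sup>2 \<le> (norm ?v)\<^sup>2"
    by (intro power_mono) auto
  then have 1: "576 * real n * (real \<tau>)\<^sup>2 * (norm (\<delta> i t))\<^sup>2 \<le> (norm ?v)\<^sup>2"
    by (simp add: power_mult_distrib)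
  have t2: "(real t)\<^sup>2 \<le> (real \<tau>)\<^sup>2" and t1: "real t \<le> real \<tau>"
    using t by (auto intro: power_mono)
  let ?D = "\<Sum>l<t. \<delta> i l" and ?B = "\<Sum>l<t. b i l" and ?W = "\<Sum>l<t. w i l"
  have "?v = (\<Sum>l<t. gm y + (?r - \<delta> i l + b i l + w i l))"
    using i t by (intro sum.cong) (auto simp: G_eq \<delta>_def)
  also have "\<dots> = real t *\<^sub>R gm y + ((real t *\<^sub>R ?r - ?D) + (?B + ?W))"
    by (simp add: sum.distrib sum_subtractf sum_constant_scaleR algebra_simps)
  finally have v: "?v = real t *\<^sub>R gm y + ((real t *\<^sub>R ?r - ?D) + (?B + ?W))" .
  \<comment> \<open>The weight 1/2 is spent in favour of the gradient term, the only one that must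
    be paid for by the suboptimality; the other four terms together get 3 * 4 = 12.\<close>
  have "(norm ?v)\<^sup>2 \<le> 3 / 2 * (norm (real t *\<^sub>R gm y))\<^sup>2
      + 3 * (norm ((real t *\<^sub>R ?r - ?D) + (?B + ?W)))\<^sup>2"
    unfolding v
    using norm_add_squared_le_weighted[of "1/2" "real t *\<^sub>R gm y" "(real t *\<^sub>R ?r - ?D) + (?B + ?W)"]
    by (simp del: norm_scaleR)
  moreover have "(norm ((real t *\<^sub>R ?r - ?D) + (?B + ?W)))\<^sup>2
      \<le> 4 * ((norm (real t *\<^sub>R ?r))\<^sup>2 + (norm ?D)\<^sup>2 + (norm ?B)\<^sup>2 + (norm ?W)\<^sup>2)"
    using norm_add_squared_le[of "real t *\<^sub>R ?r - ?D" "?B + ?W"]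
      norm_diff_squared_le[of "real t *\<^sub>R ?r" ?D] norm_add_squared_le[of ?B ?W] by argo
  moreover have "(norm (real t *\<^sub>R gm y))\<^sup>2 \<le> (real \<tau>)\<^sup>2 * (norm (gm y))\<^sup>2"
    using t2 by (simp add: power_mult_distrib mult_right_mono)
  moreover have "(norm (real t *\<^sub>R ?r))\<^sup>2 \<le> (real \<tau>)\<^sup>2 * (norm ?r)\<^sup>2"
    using t2 by (simp add: power_mult_distrib mult_right_mono del: norm_add_rule_thm)
  moreover have "(norm ?D)\<^sup>2 \<le> real \<tau> * (\<Sum>l<\<tau>. (norm (\<delta> i l))\<^sup>2)"
  proof -
    have "(norm ?D)\<^sup>2 \<le> real t * (\<Sum>l<t. (norm (\<delta> i l))\<^sup>2)"
      using norm_sum_squared_le[of "\<delta> i" "{..<t}"] by simp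
    also have "\<dots> \<le> real \<tau> * (\<Sum>l<\<tau>. (norm (\<delta> i l))\<^sup>2)"
      using t by (intro mult_mono sum_mono2 sum_nonneg) auto
    finally show ?thesis .
  qed
  moreover have "(norm ?B)\<^sup>2 \<le> (real \<tau>)\<^sup>2 * \<beta>\<^sup>2"
  proof -
    have "norm ?B \<le> real t * \<beta>"
      using sum_norm_bound[of "{..<t}" "b i" \<beta>] b_le[OF i] t by simp
    also have "\<dots> \<le> real \<tau> * \<beta>"
      using t1 beta_nonneg by (rule mult_right_mono)
    finally have "(norm ?B)\<^sup>2 \<le> (real \<tau> * \<beta>)\<^sup>2"
      by (intro power_mono) auto
    then show ?thesis by (simp add: power_mult_distrib)
  qed
  ultimately show ?thesis
    using 1 by (simp only: distrib_left)
qed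

text \<open>Averages of \<open>drift_client\<close>. The drift also occurs on the right, as earlier
  steps disturb later ones; it is absorbed by \<open>drift \<le> real n * drift\<close>, so 564 =
  576 - 12 remains.\<close>

lemma drift_le: "564 * real n * drift \<le> 3 / 2 * (norm (gm y))\<^sup>2 + 12 * (hetero y c + \<beta>\<^sup>2 + W_partial)"
proof -
  define D where "D = (\<lambda>i. (1 / real \<tau>) * (\<Sum>t<\<tau>. (norm (\<delta> i t))\<^sup>2))"
  define Q where "Q = (\<lambda>i. (1 / real \<tau> ^ 3) * (\<Sum>t<\<tau>. (norm (\<Sum>l<t. w i l))\<^sup>2))"
  have cl: "576 * real n * D i \<le> 3 / 2 * (norm (gm y))\<^sup>2
      + 12 * ((norm (gr i y - gm y + c i))\<^sup>2 + D i + \<beta>\<^sup>2 + Q i)" if i: "i < n" for i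
  proof -
    have "(\<Sum>t<\<tau>. 576 * real n * (real \<tau>)\<^sup>2 * (norm (\<delta> i t))\<^sup>2) \<le> (\<Sum>t<\<tau>.
        3 / 2 * ((real \<tau>)\<^sup>2 * (norm (gm y))\<^sup>2)
        + 12 * ((real \<tau>)\<^sup>2 * (norm (gr i y - gm y + c i))\<^sup>2 + real \<tau> * (\<Sum>l<\<tau>. (norm (\<delta> i l))\<^sup>2)
        + (real \<tau>)\<^sup>2 * \<beta>\<^sup>2 + (norm (\<Sum>l<t. w i l))\<^sup>2))"
      by (intro sum_mono drift_client i) simp
    also have "\<dots> = real \<tau> * (3 / 2 * ((real \<tau>)\<^sup>2 * (norm (gm y))\<^sup>2))
        + 12 * (real \<tau> * ((real \<tau>)\<^sup>2 * (norm (gr i y - gm y + c i))\<^sup>2)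
          + real \<tau> * (real \<tau> * (\<Sum>l<\<tau>. (norm (\<delta> i l))\<^sup>2))
          + real \<tau> * ((real \<tau>)\<^sup>2 * \<beta>\<^sup>2) + (\<Sum>t<\<tau>. (norm (\<Sum>l<t. w i l))\<^sup>2))"
      by (simp add: sum.distrib sum_distrib_left[symmetric] distrib_left)
    finally show ?thesis
      unfolding D_def Q_def sum_distrib_left[symmetric] using tau_pos
      by (intro average_le) auto
  qed
  have "(1 / real n) * (\<Sum>i<n. 576 * real n * D i) \<le> (1 / real n) * (\<Sum>i<n. 3 / 2 * (norm (gm y))\<^sup>2
      + 12 * ((norm (gr i y - gm y + c i))\<^sup>2 + D i + \<beta>\<^sup>2 + Q i))"
    by (intro mult_left_mono sum_mono cl) auto
  also have "\<dots> = 3 / 2 * (norm (gm y))\<^sup>2 + 12 * (hetero y c + drift + \<beta>\<^sup>2 + W_partial)"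
    unfolding hetero_def drift_def W_partial_def D_def[symmetric] Q_def[symmetric] using n_pos
    by (simp add: sum.distrib sum_distrib_left[symmetric] distrib_left)
  finally have "576 * real n * drift \<le> 3 / 2 * (norm (gm y))\<^sup>2 + 12 * (hetero y c + drift + \<beta>\<^sup>2 + W_partial)"
    unfolding drift_def D_def[symmetric] sum_distrib_left[symmetric] using n_pos by simp
  moreover have "drift \<le> real n * drift"
  proof -
    have "0 \<le> drift"
      by (auto simp: drift_def intro!: mult_nonneg_nonneg divide_nonneg_nonneg sum_nonneg)
    then show ?thesis
      using n_pos by (simp add: mult_le_cancel_right1)
  qed
  ultimately show ?thesis by (simp add: distrib_left mult.assoc)
qed

text \<open>The corrections computed at the end of the round, in the form that the server step gives
  them.\<close>

definition cp :: "nat \<Rightarrow> 'a" where "cp i = Gb - Gm i"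
definition \<delta>m :: "nat \<Rightarrow> 'a" where "\<delta>m i = (1 / real \<tau>) *\<^sub>R (\<Sum>t<\<tau>. \<delta> i t)"
definition bm :: "nat \<Rightarrow> 'a" where "bm i = (1 / real \<tau>) *\<^sub>R (\<Sum>t<\<tau>. b i t)"

lemma yp_in: "yp \<in> S" and yt_in: "yt \<in> S"
  by (simp_all add: yp_def yt_def P_in)

lemma Gm_eq: "i < n \<Longrightarrow> Gm i = gr i y - \<delta>m i + bm i + wm i"
proof -
  assume i: "i < n"
  have "(\<Sum>t<\<tau>. G i t) = (\<Sum>t<\<tau>. gr i y - \<delta> i t + b i t + w i t)"
    using i by (intro sum.cong) (auto simp: G_eq \<delta>_def)
  then show ?thesis
    using tau_pos by (simp add: Gm_def \<delta>m_def bm_def wm_def sum.distrib sum_subtractf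
        sum_constant_scaleR scaleR_add_right scaleR_diff_right)
qed

lemma norm_\<delta>m_le: "(norm (\<delta>m i))\<^sup>2 \<le> (1 / real \<tau>) * (\<Sum>t<\<tau>. (norm (\<delta> i t))\<^sup>2)"
proof -
  have "(norm (\<delta>m i))\<^sup>2 = (norm (\<Sum>t<\<tau>. \<delta> i t))\<^sup>2 / (real \<tau>)\<^sup>2"
    by (simp add: \<delta>m_def power_divide)
  also have "\<dots> \<le> (real \<tau> * (\<Sum>t<\<tau>. (norm (\<delta> i t))\<^sup>2)) / (real \<tau>)\<^sup>2"
    using norm_sum_squared_le[of "\<delta> i" "{..<\<tau>}"] by (intro divide_right_mono) auto
  also have "\<dots> = (1 / real \<tau>) * (\<Sum>t<\<tau>. (norm (\<delta> i t))\<^sup>2)"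
    using tau_pos by (simp add: power2_eq_square)
  finally show ?thesis .
qed

lemma norm_bm_le: "i < n \<Longrightarrow> norm (bm i) \<le> \<beta>"
  using sum_norm_bound[of "{..<\<tau>}" "b i" \<beta>] b_le tau_pos by (simp add: bm_def field_simps)

text \<open>After the round the corrected gradient deviations are exactly the deviations of
  \<open>q i = gr i yp - Gm i\<close> from their mean, and centering only helps. Here
  \<open>q i\<close> consists of the change of the gradient between \<open>y\<close> and
  \<open>yp\<close>, the drift, the bias and the noise. The old corrections have disappeared from
  it, which is why the variance contracts.\<close>

lemma hetero_next_le: "hetero yp cp \<le> 2 * W_client + 6 * (d\<^sup>2 / 576 + drift + \<beta>\<^sup>2)"
proof -
  define q where "q i = gr i yp - Gm i" for i
  define \<Delta> where "\<Delta> i = (1 / real \<tau>) * (\<Sum>t<\<tau>. (norm (\<delta> i t))\<^sup>2)" for i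
  have q: "(norm (q i))\<^sup>2 \<le> 2 * (norm (wm i))\<^sup>2 + 6 * (d\<^sup>2 / 576 + \<Delta> i + \<beta>\<^sup>2)" if i: "i < n" for i
  proof -
    let ?A = "gr i yp - gr i y"
    have "24 * (h * norm ?A) \<le> 24 * (L * h * norm (yp - y))"
      using gr_lipschitz[OF i yp_in y_in] h_pos by simp
    also have "\<dots> \<le> norm (yp - y)"
      by (rule L_h_norm_le[OF y_in yp_in])
    finally have "norm ?A \<le> d / 24"
      using h_pos by (simp add: d_def field_simps)
    then have "(norm ?A)\<^sup>2 \<le> (d / 24)\<^sup>2"
      by (intro power_mono) auto
    then have A: "(norm ?A)\<^sup>2 \<le> d\<^sup>2 / 576"
      by (simp add: power_divide)
    have B: "(norm (bm i))\<^sup>2 \<le> \<beta>\<^sup>2"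
      using norm_bm_le[OF i] by (intro power_mono) auto
    \<comment> \<open>The weight 2 equalises the three terms: separating the noise costs a factor 2,
      and both 2 * 3 and 2 * (3/2) * 2 are 6.\<close>
    have "(norm (?A + (\<delta>m i - bm i)))\<^sup>2 \<le> 3 * (norm ?A)\<^sup>2 + 3 / 2 * (norm (\<delta>m i - bm i))\<^sup>2"
      using norm_add_squared_le_weighted[of 2 ?A "\<delta>m i - bm i"] by simp
    moreover have "q i = (?A + (\<delta>m i - bm i)) - wm i"
      using Gm_eq[OF i] by (simp add: q_def)
    ultimately show ?thesis
      using norm_diff_squared_le[of "?A + (\<delta>m i - bm i)" "wm i"] norm_diff_squared_le[of "\<delta>m i" "bm i"]
        norm_\<delta>m_le[of i] A B unfolding \<Delta>_def by (simp only: distrib_left)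
  qed
  have "hetero yp cp = (1 / real n) * (\<Sum>i<n. (norm (q i - (1 / real n) *\<^sub>R (\<Sum>j<n. q j)))\<^sup>2)"
    by (simp add: hetero_def gm_def cp_def Gb_def q_def sum_subtractf scaleR_diff_right algebra_simps)
  also have "\<dots> \<le> (1 / real n) * (\<Sum>i<n. (norm (q i))\<^sup>2)"
    by (intro mult_left_mono sum_norm_squared_centered_le) auto
  also have "\<dots> \<le> (1 / real n) * (\<Sum>i<n. 2 * (norm (wm i))\<^sup>2 + 6 * (d\<^sup>2 / 576 + \<Delta> i + \<beta>\<^sup>2))"
    by (intro mult_left_mono sum_mono q) auto
  also have "\<dots> = 2 * W_client + 6 * (d\<^sup>2 / 576 + drift + \<beta>\<^sup>2)"
    unfolding W_client_def drift_def \<Delta>_def[symmetric] using n_pos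
    by (simp add: sum.distrib sum_distrib_left[symmetric] add_divide_distrib)
  finally show ?thesis .
qed

lemma norm_Gb_le: "norm Gb \<le> chiG"
proof -
  have "norm (Gm i) \<le> chiG" if "i < n" for i
    using sum_norm_bound[of "{..<\<tau>}" "G i" chiG] G_le[OF that] tau_pos by (simp add: Gm_def field_simps)
  then show ?thesis
    using sum_norm_bound[of "{..<n}" "Gm" chiG] n_pos by (simp add: Gb_def field_simps)
qed

lemma norm_h_Gb_le: "norm (- (h *\<^sub>R Gb)) \<le> \<gamma> / 6"
  using mult_left_mono[OF norm_Gb_le, of h] h_pos order_trans[OF _ h_chiG] by simp

definition \<epsilon> :: 'a where "\<epsilon> = gm y - Gb"

lemma norm_yp_yt_le: "norm (yp - yt) \<le> 6 / 5 * (h * norm \<epsilon>)"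
proof -
  have "norm (yp - yt) \<le> 6 / 5 * norm (- (h *\<^sub>R Gb) - - (h *\<^sub>R gm y))"
    using P_step_lipschitz[OF y_in norm_h_Gb_le norm_h_gm_le[OF y_in]] by (simp add: yp_def yt_def)
  also have "- (h *\<^sub>R Gb) - - (h *\<^sub>R gm y) = h *\<^sub>R \<epsilon>"
    by (simp add: \<epsilon>_def scaleR_diff_right)
  finally show ?thesis
    using h_pos by simp
qed

lemma subopt_squared_le: "(subopt y)\<^sup>2 \<le> 2 * d\<^sup>2 + 72 / 25 * (norm \<epsilon>)\<^sup>2"
proof -
  have "norm (y - yt) / h \<le> (norm (yp - y) + norm (yp - yt)) / h"
    using h_pos norm_triangle_ineq4[of "yp - yt" "yp - y"] by (intro divide_right_mono) auto
  also have "\<dots> \<le> d + 6 / 5 * norm \<epsilon>"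
    using norm_yp_yt_le h_pos by (simp add: d_def field_simps)
  finally have "subopt y \<le> d + 6 / 5 * norm \<epsilon>"
    by (simp add: subopt_def yt_def)
  then have "(subopt y)\<^sup>2 \<le> (norm (d + 6 / 5 * norm \<epsilon>))\<^sup>2"
    using subopt_nonneg[of y] by (simp add: power_mono)
  also have "\<dots> \<le> 2 * d\<^sup>2 + 2 * (6 / 5 * norm \<epsilon>)\<^sup>2"
    using norm_add_squared_le[of d "6 / 5 * norm \<epsilon>"] by simp
  also have "\<dots> = 2 * d\<^sup>2 + 72 / 25 * (norm \<epsilon>)\<^sup>2"
    by (simp add: power_mult_distrib power_divide)
  finally show ?thesis .
qed

text \<open>Smoothness is combined with \<open>P_step_inner\<close>, and
  \<open>\<epsilon> \<bullet> (yp - y)\<close> is split at the exact step \<open>yt\<close>. The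
  part up to \<open>yt\<close> is quadratic in \<open>\<epsilon>\<close> because the projection is
  almost nonexpansive; the part from \<open>y\<close> to \<open>yt\<close> pairs the error with a
  vector free of the noise of the round. The constants are 43/6 = 8 * (11/12 - 1/48) and 48/5 = 8 *
  6/5.\<close>

lemma descent: "43 / 6 * d\<^sup>2 - 48 / 5 * (norm \<epsilon>)\<^sup>2 - 8 / h * (\<epsilon> \<bullet> (yt - y)) \<le> 8 / h * (f y - f yp)"
proof -
  have 1: "f yp - f y \<le> gm y \<bullet> (yp - y) + L / 2 * (norm (yp - y))\<^sup>2"
    using f_smooth[OF y_in yp_in] by (simp add: gm_def norm_minus_commute)
  have 2: "11 / 12 * (norm (yp - y))\<^sup>2 \<le> - h * (Gb \<bullet> (yp - y))"
    using P_step_inner[OF y_in norm_h_Gb_le] by (simp add: yp_def)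
  have "\<epsilon> \<bullet> (yp - yt) \<le> norm \<epsilon> * (6 / 5 * (h * norm \<epsilon>))"
    by (intro order_trans[OF norm_cauchy_schwarz] mult_left_mono norm_yp_yt_le) auto
  then have 3: "\<epsilon> \<bullet> (yp - yt) \<le> h * (6 / 5 * (norm \<epsilon>)\<^sup>2)"
    by (simp add: power2_eq_square mult_ac)
  have "24 * (L * h * norm (yp - y)) * norm (yp - y) \<le> norm (yp - y) * norm (yp - y)"
    by (intro mult_right_mono L_h_norm_le y_in yp_in) auto
  then have 4: "h * (L / 2 * (norm (yp - y))\<^sup>2) \<le> (norm (yp - y))\<^sup>2 / 48"
    by (simp add: power2_eq_square mult_ac)
  have "gm y \<bullet> (yp - y) = Gb \<bullet> (yp - y) + \<epsilon> \<bullet> (yp - yt) + \<epsilon> \<bullet> (yt - y)"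
    by (simp add: \<epsilon>_def inner_diff_left inner_diff_right)
  with 1 have "h * (f yp - f y) \<le> h * (Gb \<bullet> (yp - y) + \<epsilon> \<bullet> (yp - yt) + \<epsilon> \<bullet> (yt - y) + L / 2 * (norm (yp - y))\<^sup>2)"
    using h_pos by (intro mult_left_mono) auto
  also have "\<dots> = h * (Gb \<bullet> (yp - y)) + h * (\<epsilon> \<bullet> (yp - yt)) + h * (\<epsilon> \<bullet> (yt - y)) + h * (L / 2 * (norm (yp - y))\<^sup>2)"
    by (simp add: distrib_left)
  also have "\<dots> \<le> - (43 / 48 * (norm (yp - y))\<^sup>2) + h * (h * (6 / 5 * (norm \<epsilon>)\<^sup>2)) + h * (\<epsilon> \<bullet> (yt - y))"
    using 2 4 mult_left_mono[OF 3, of h] h_pos by linarith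
  also have "(norm (yp - y))\<^sup>2 = h\<^sup>2 * d\<^sup>2"
    using h_pos by (simp add: d_def power_divide)
  finally have "h * (f yp - f y) \<le> h * (- (43 / 48 * (h * d\<^sup>2)) + h * (6 / 5 * (norm \<epsilon>)\<^sup>2) + \<epsilon> \<bullet> (yt - y))"
    by (simp add: algebra_simps power2_eq_square)
  then have "f yp - f y \<le> - (43 / 48 * (h * d\<^sup>2)) + h * (6 / 5 * (norm \<epsilon>)\<^sup>2) + \<epsilon> \<bullet> (yt - y)"
    using h_pos by simp
  then have "8 / h * (43 / 48 * (h * d\<^sup>2) - h * (6 / 5 * (norm \<epsilon>)\<^sup>2) - \<epsilon> \<bullet> (yt - y)) \<le> 8 / h * (f y - f yp)"
    using h_pos by (intro mult_left_mono) auto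
  moreover have "8 / h * (43 / 48 * (h * d\<^sup>2) - h * (6 / 5 * (norm \<epsilon>)\<^sup>2) - \<epsilon> \<bullet> (yt - y))
      = 43 / 6 * d\<^sup>2 - 48 / 5 * (norm \<epsilon>)\<^sup>2 - 8 / h * (\<epsilon> \<bullet> (yt - y))"
    using h_pos by (simp add: right_diff_distrib)
  ultimately show ?thesis by simp
qed

definition \<delta>b :: 'a where "\<delta>b = (1 / real n) *\<^sub>R (\<Sum>i<n. \<delta>m i)"
definition bb :: 'a where "bb = (1 / real n) *\<^sub>R (\<Sum>i<n. bm i)"

lemma \<epsilon>_eq: "\<epsilon> = \<delta>b - bb - wb"
proof -
  have "(\<Sum>i<n. Gm i) = (\<Sum>i<n. gr i y - \<delta>m i + bm i + wm i)"
    by (intro sum.cong) (auto simp: Gm_eq)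
  then show ?thesis
    by (simp add: \<epsilon>_def Gb_def gm_def \<delta>b_def bb_def wb_def sum.distrib sum_subtractf
        scaleR_add_right scaleR_diff_right)
qed

lemma norm_bb_le: "norm bb \<le> \<beta>"
  using sum_norm_bound[of "{..<n}" bm \<beta>] norm_bm_le n_pos by (simp add: bb_def field_simps)

lemma norm_\<delta>b_le: "(norm \<delta>b)\<^sup>2 \<le> drift"
proof -
  have "(norm \<delta>b)\<^sup>2 = (norm (\<Sum>i<n. \<delta>m i))\<^sup>2 / (real n)\<^sup>2"
    by (simp add: \<delta>b_def power_divide)
  also have "\<dots> \<le> (real n * (\<Sum>i<n. (norm (\<delta>m i))\<^sup>2)) / (real n)\<^sup>2"
    using norm_sum_squared_le[of \<delta>m "{..<n}"] by (intro divide_right_mono) auto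
  also have "\<dots> = (1 / real n) * (\<Sum>i<n. (norm (\<delta>m i))\<^sup>2)"
    using n_pos by (simp add: power2_eq_square)
  also have "\<dots> \<le> drift"
    unfolding drift_def by (intro mult_left_mono sum_mono norm_\<delta>m_le) auto
  finally show ?thesis .
qed

lemma norm_\<epsilon>_squared_le: "(norm \<epsilon>)\<^sup>2 \<le> 2 * (norm wb)\<^sup>2 + 4 * \<beta>\<^sup>2 + 4 * drift"
proof -
  have "(norm bb)\<^sup>2 \<le> \<beta>\<^sup>2"
    using norm_bb_le by (intro power_mono) auto
  then show ?thesis
    using norm_diff_squared_le[of "\<delta>b - bb" wb] norm_diff_squared_le[of \<delta>b bb] norm_\<delta>b_le
    unfolding \<epsilon>_eq by linarith
qed

text \<open>The noise part is kept untouched, since only its expectation is small. The bias is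
  paired with \<open>subopt y \<le> 12 / 11 * chi\<close>, so it stays linear in
  \<open>\<beta>\<close>; the drift is separated by Young's inequality.\<close>

lemma \<epsilon>_inner_le:
  "8 / h * (\<epsilon> \<bullet> (yt - y)) \<le> (subopt y)\<^sup>2 + 16 * drift + 96 / 11 * (chi * \<beta>) - 8 / h * (wb \<bullet> (yt - y))"
proof -
  let ?a = "subopt y"
  have a: "norm (yt - y) = h * ?a"
    using h_pos by (simp add: subopt_def yt_def norm_minus_commute)
  have "(\<delta>b - bb) \<bullet> (yt - y) \<le> norm (\<delta>b - bb) * norm (yt - y)"
    by (rule norm_cauchy_schwarz)
  also have "\<dots> \<le> (norm \<delta>b + \<beta>) * (h * ?a)"
    unfolding a using norm_triangle_ineq4[of \<delta>b bb] norm_bb_le h_pos subopt_nonneg[of y]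
    by (intro mult_right_mono) auto
  finally have "8 / h * ((\<delta>b - bb) \<bullet> (yt - y)) \<le> 8 / h * ((norm \<delta>b + \<beta>) * (h * ?a))"
    using h_pos by (intro mult_left_mono) auto
  also have "\<dots> = 8 * (norm \<delta>b * ?a) + 8 * (\<beta> * ?a)"
    using h_pos by (simp add: field_simps)
  also have "8 * (norm \<delta>b * ?a) \<le> ?a\<^sup>2 + 16 * (norm \<delta>b)\<^sup>2"
    using zero_le_power2[of "?a - 4 * norm \<delta>b"] by (simp add: power2_diff power_mult_distrib mult_ac)
  also have "16 * (norm \<delta>b)\<^sup>2 \<le> 16 * drift"
    using norm_\<delta>b_le by simp
  also have "8 * (\<beta> * ?a) \<le> 8 * (\<beta> * (12 / 11 * chi))"
    using subopt_le[OF y_in] beta_nonneg by (intro mult_left_mono) auto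
  finally show ?thesis
    by (simp add: \<epsilon>_eq inner_diff_left right_diff_distrib mult_ac)
qed

text \<open>Descent of \<open>8 / h * f + 8 / real n * hetero\<close>. The hypothesis on
  \<open>\<beta>\<close> lets every \<open>\<beta>\<^sup>2\<close> be replaced by
  \<open>3 / 40 * (chi * \<beta>)\<close>.\<close>

theorem round_inequality:
  assumes beta_small: "40 * \<beta> \<le> 3 * chi"
  shows "(subopt y)\<^sup>2 \<le> 8 / h * (f y - f yp) + 8 / real n * (hetero y c - hetero yp cp)
    + 198 / 5 * (norm wb)\<^sup>2 + 16 / real n * W_client + 61 / 20 / real n * W_partial
    + (15 + 4 / real n) * (chi * \<beta>) - 8 / h * (wb \<bullet> (yt - y))"
proof -
  define N where "N = 1 / real n"
  have N: "0 < N" "N \<le> 1"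
    using n_pos by (auto simp: N_def)
  let ?A = "(subopt y)\<^sup>2" and ?B = "\<beta>\<^sup>2" and ?H = "hetero y c" and ?W = "W_partial"
  have nonneg: "0 \<le> drift" "0 \<le> ?H" "0 \<le> ?W"
    by (auto simp: drift_def hetero_def W_partial_def intro!: mult_nonneg_nonneg divide_nonneg_nonneg sum_nonneg)
  have g: "(norm (gm y))\<^sup>2 \<le> 4 * ?A"
    using power_mono[OF norm_gm_le_subopt[OF y_in], of 2] by (simp add: power_mult_distrib)
  have "drift = N * (564 * real n * drift) / 564"
    using n_pos by (simp add: N_def)
  also have "\<dots> \<le> N * (3 / 2 * (4 * ?A) + 12 * (?H + ?B + ?W)) / 564"
    using drift_le g N by (intro divide_right_mono mult_left_mono) auto
  also have "\<dots> = N * ?A / 94 + N * ?H / 47 + N * ?B / 47 + N * ?W / 47"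
    by (simp add: distrib_left)
  also have "N * ?A \<le> 1 * ?A"
    using N by (intro mult_right_mono) auto
  finally have dr: "drift \<le> ?A / 94 + N * ?H / 47 + N * ?B / 47 + N * ?W / 47" by simp
  have Ndr: "N * drift \<le> drift"
    using N nonneg by (simp add: mult_left_le_one_le)
  have Nd: "N * d\<^sup>2 \<le> d\<^sup>2"
    using N by (simp add: mult_left_le_one_le)
  have "N * hetero yp cp \<le> N * (2 * W_client + 6 * (d\<^sup>2 / 576 + drift + ?B))"
    using hetero_next_le N by (intro mult_left_mono) auto
  also have "\<dots> = 2 * (N * W_client) + N * d\<^sup>2 / 96 + 6 * (N * drift) + 6 * (N * ?B)"
    by (simp add: distrib_left)
  finally have hn: "N * hetero yp cp \<le> 2 * (N * W_client) + N * d\<^sup>2 / 96 + 6 * (N * drift) + 6 * (N * ?B)" .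
  have b: "?B \<le> 3 / 40 * (chi * \<beta>)"
    using mult_right_mono[OF beta_small beta_nonneg] by (simp add: power2_eq_square mult_ac)
  have Nb: "N * ?B \<le> 3 / 40 * (N * (chi * \<beta>))"
    using mult_left_mono[OF b, of N] N by simp
  have nn: "0 \<le> N * ?H" "0 \<le> N * (chi * \<beta>)" "0 \<le> chi * \<beta>" "0 \<le> ?A"
    using N nonneg chi_pos beta_nonneg by auto
  \<comment> \<open>A suitable combination takes \<open>subopt_squared_le\<close> with weight 85/24,
    using up the 43/6 - 1/12 of \<open>d\<^sup>2\<close> left after \<open>hn\<close>; the noise
    then gets 2 * (48/5 + 72/25 * 85/24) = 198/5. The total drift coefficient is 4 * 99/5 + 16 + 48
    = 716/5. By \<open>dr\<close> it costs 716/470 of \<open>?A\<close>, which leaves more than one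
    copy, and 716/235 of \<open>N * ?H\<close> and \<open>N * ?W\<close>, below 8 and 61/20.\<close>
  have "?A \<le> 8 / h * (f y - f yp) + (8 * (N * ?H) - 8 * (N * hetero yp cp))
    + 198 / 5 * (norm wb)\<^sup>2 + 16 * (N * W_client) + 61 / 20 * (N * ?W)
    + (15 * (chi * \<beta>) + 4 * (N * (chi * \<beta>))) - 8 / h * (wb \<bullet> (yt - y))"
    using dr Ndr Nd hn b Nb nn descent subopt_squared_le norm_\<epsilon>_squared_le \<epsilon>_inner_le
      mult_nonneg_nonneg[OF less_imp_le[OF N(1)] nonneg(3)] by linarith
  then show ?thesis
    by (simp add: N_def right_diff_distrib distrib_right)
qed

end

section \<open>Clients and estimators\<close>

lemma AE_prob_obtain:
  assumes "prob_space M" and "AE x in M. Q x"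
  obtains x where "x \<in> space M" "Q x"
proof -
  interpret prob_space M by fact
  have "\<not> (AE x in M. False)" by simp
  then have "\<not> (\<forall>x\<in>space M. \<not> Q x)"
    using assms(2) by (metis (no_types, lifting) AE_I2 AE_mp)
  then show ?thesis using that by blast
qed

text \<open>Integrability is not demanded: a nonintegrable function has integral 0, which the
  assumption \<open>0 \<le> c\<close> covers.\<close>

lemma prob_integral_mono_const:
  fixes g :: "'b \<Rightarrow> real"
  assumes "prob_space M" and "AE x in M. g x \<le> c" and "0 \<le> c"
  shows "(\<integral>x. g x \<partial>M) \<le> c"
proof -
  interpret prob_space M by fact
  show ?thesis
  proof (cases "integrable M g")
    case True
    then have "(\<integral>x. g x \<partial>M) \<le> (\<integral>x. c \<partial>M)"
      using assms by (intro integral_mono_AE) auto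
    then show ?thesis by (simp add: prob_space)
  qed (use assms in \<open>simp add: not_integrable_integral_eq\<close>)
qed

lemma norm_prob_integral_le:
  fixes g :: "'b \<Rightarrow> 'a::euclidean_space"
  assumes "prob_space M" and "AE x in M. norm (g x) \<le> c" and "0 \<le> c"
  shows "norm (\<integral>x. g x \<partial>M) \<le> c"
  using integral_norm_bound[of M g] prob_integral_mono_const[OF assms] by linarith

lemma client_obj_smooth:
  assumes "oracle_assm S \<sigma> n D F" "riem_smooth_const S L n D F" "i < n" "x \<in> S" "y \<in> S"
  shows "client_obj D F i y - client_obj D F i x
    \<le> riem_grad S (client_obj D F i) x \<bullet> (y - x) + L / 2 * (norm (x - y))\<^sup>2"
proof -
  interpret prob_space "D i"
    using assms(1,3) by (auto simp: oracle_assm_def)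
  let ?g = "\<lambda>\<xi>. riem_grad S (\<lambda>y. F i y \<xi>) x"
  have int: "integrable (D i) (F i x)" "integrable (D i) (F i y)" "integrable (D i) ?g"
    and mean: "(\<integral>\<xi>. ?g \<xi> \<partial>D i) = riem_grad S (client_obj D F i) x"
    using assms(1,3,4) by (auto simp: oracle_assm_def)
  have "client_obj D F i y - client_obj D F i x = (\<integral>\<xi>. F i y \<xi> - F i x \<xi> \<partial>D i)"
    using int by (simp add: client_obj_def)
  also have "\<dots> \<le> (\<integral>\<xi>. ?g \<xi> \<bullet> (y - x) + L / 2 * (norm (x - y))\<^sup>2 \<partial>D i)"
  proof (rule integral_mono_AE)
    show "AE \<xi> in D i. F i y \<xi> - F i x \<xi> \<le> ?g \<xi> \<bullet> (y - x) + L / 2 * (norm (x - y))\<^sup>2"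
      using assms(2-5) by (fastforce simp: riem_smooth_const_def)
  qed (use int in auto)
  also have "\<dots> = riem_grad S (client_obj D F i) x \<bullet> (y - x) + L / 2 * (norm (x - y))\<^sup>2"
    using int mean by (simp add: prob_space)
  finally show ?thesis .
qed

lemma client_grad_lipschitz:
  assumes "oracle_assm S \<sigma> n D F" "riem_smooth_const S L n D F" "0 \<le> L" "i < n" "x \<in> S" "y \<in> S"
  shows "norm (riem_grad S (client_obj D F i) x - riem_grad S (client_obj D F i) y) \<le> L * norm (x - y)"
proof -
  interpret prob_space "D i"
    using assms(1,4) by (auto simp: oracle_assm_def)
  let ?g = "\<lambda>x \<xi>. riem_grad S (\<lambda>y. F i y \<xi>) x"
  have "riem_grad S (client_obj D F i) x - riem_grad S (client_obj D F i) y = (\<integral>\<xi>. ?g x \<xi> - ?g y \<xi> \<partial>D i)"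
    using assms(1,4-6) by (simp add: oracle_assm_def)
  moreover have "AE \<xi> in D i. norm (?g x \<xi> - ?g y \<xi>) \<le> L * norm (x - y)"
    using assms(2,4-6) by (fastforce simp: riem_smooth_const_def)
  ultimately show ?thesis
    using norm_prob_integral_le[OF prob_space_axioms, of "\<lambda>\<xi>. ?g x \<xi> - ?g y \<xi>"] assms(3) by simp
qed

lemma client_grad_bound:
  assumes "smooth_submanifold S" "oracle_assm S \<sigma> n D F" "gradient_assm S chi n D F"
    and "0 \<le> chi" "i < n" "x \<in> S"
  shows "norm (riem_grad S (client_obj D F i) x) \<le> chi"
proof -
  interpret prob_space "D i"
    using assms(2,5) by (auto simp: oracle_assm_def)
  have "AE \<xi> in D i. \<forall>x\<in>S. norm (euclid_grad (\<lambda>y. F i y \<xi>) x) \<le> chi"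
    using assms(3,5) by (simp add: gradient_assm_def)
  then have "AE \<xi> in D i. norm (riem_grad S (\<lambda>y. F i y \<xi>) x) \<le> chi"
    by eventually_elim (use assms(6) norm_orth_proj_le[OF subspace_tangent_space[OF assms(1,6)]] in
        \<open>auto simp: riem_grad_def intro: order_trans\<close>)
  moreover have "riem_grad S (client_obj D F i) x = (\<integral>\<xi>. riem_grad S (\<lambda>y. F i y \<xi>) x \<partial>D i)"
    using assms(2,5,6) by (simp add: oracle_assm_def)
  ultimately show ?thesis
    using norm_prob_integral_le[OF prob_space_axioms] assms(4) by simp
qed

section \<open>Laws of the samples and measurability of the estimator\<close>

lemma prob_space_sphere_unif: "prob_space (sphere_unif :: 'a::euclidean_space measure)"
proof -
  have "emeasure lborel (ball (0::'a) 1) \<noteq> 0"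
    using content_ball_pos[of 1 "0::'a"] by (auto simp: measure_def)
  moreover have "emeasure lborel (ball (0::'a) 1) \<noteq> \<infinity>"
    using emeasure_lborel_ball_finite[of "0::'a" 1] by auto
  ultimately have "prob_space (uniform_measure lborel (ball (0::'a) 1))"
    by (rule prob_space_uniform_measure)
  then show ?thesis
    unfolding sphere_unif_def by (rule prob_space.prob_space_distr) measurable
qed

lemma sets_sphere_unif [measurable_cong]: "sets sphere_unif = sets borel"
  by (simp add: sphere_unif_def)

lemma prob_space_sample_law:
  assumes "prob_space Di"
  shows "prob_space (sample_law Di :: ('x \<times> 'a::euclidean_space) measure)"
proof -
  interpret A: prob_space Di by fact
  interpret B: prob_space "sphere_unif :: 'a measure" by (rule prob_space_sphere_unif)
  interpret pair_prob_space Di "sphere_unif :: 'a measure" ..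
  show ?thesis
    unfolding sample_law_def by unfold_locales
qed

lemma prob_space_batch_law: "prob_space Di \<Longrightarrow> prob_space (batch_law Di m)"
  unfolding batch_law_def by (intro prob_space_PiM prob_space_sample_law)

text \<open>Joint measurability in point and batch is required because the estimator is evaluated at
  random local iterates.\<close>

lemma measurable_zo_est:
  fixes P :: "real^'r^'p \<Rightarrow> real^'r^'p"
  assumes "(\<lambda>(x, \<xi>). Fi x \<xi>) \<in> borel_measurable (borel \<Otimes>\<^sub>M Di)" and P[measurable]: "P \<in> borel_measurable borel"
  shows "(\<lambda>(x, s). zo_est P \<mu> m Fi s x) \<in> borel_measurable (borel \<Otimes>\<^sub>M batch_law Di m)"
proof -
  let ?N = "(borel :: (real^'r^'p) measure) \<Otimes>\<^sub>M batch_law Di m"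
  have comp: "(\<lambda>p. snd p j) \<in> measurable ?N (Di \<Otimes>\<^sub>M sphere_unif)" if "j < m" for j
    unfolding batch_law_def sample_law_def using that
    by (intro measurable_compose[OF measurable_snd measurable_component_singleton]) auto
  have 1[measurable]: "(\<lambda>p. fst (snd p j)) \<in> measurable ?N Di" if "j < m" for j
    by (rule measurable_compose[OF comp[OF that] measurable_fst])
  have 2: "(\<lambda>p. snd (snd p j)) \<in> measurable ?N borel" if "j < m" for j
    using measurable_compose[OF comp[OF that] measurable_snd]
    by (simp add: measurable_cong_sets[OF refl sets_sphere_unif])
  have F: "(\<lambda>p. Fi (g p) (fst (snd p j))) \<in> borel_measurable ?N"
    if "j < m" "g \<in> borel_measurable ?N" for j g
    using measurable_compose[OF measurable_Pair[OF that(2) 1[OF that(1)]] assms(1)] by simp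
  have "(\<lambda>p. zo_est P \<mu> m Fi (snd p) (fst p)) \<in> borel_measurable ?N"
    unfolding zo_est_def case_prod_beta
  proof (intro borel_measurable_scaleR borel_measurable_const borel_measurable_sum
      borel_measurable_divide borel_measurable_diff F)
    fix j assume "j \<in> {..<m}"
    then have j: "j < m" by simp
    show "(\<lambda>p. P (fst p + \<mu> *\<^sub>R snd (snd p j))) \<in> borel_measurable ?N"
      using 2[OF j] by measurable
    show "j < m" "j < m" "(\<lambda>p. snd (snd p j)) \<in> borel_measurable ?N"
      using j 2[OF j] by auto
  qed auto
  then show ?thesis
    by (simp add: case_prod_beta')
qed

section \<open>Dependence of the iterates on the samples\<close>

lemma zo_est_cong:
  assumes "\<And>j. j < m \<Longrightarrow> s j = s' j"
  shows "zo_est P \<mu> m Fi s x = zo_est P \<mu> m Fi s' x"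
  using assms unfolding zo_est_def by (intro arg_cong2[where f = scaleR] refl sum.cong) auto

lemma local_iter_cong:
  assumes "\<And>l z. l < t \<Longrightarrow> g l z = g' l z"
  shows "local_iter P \<eta> c g y t = local_iter P \<eta> c g' y t"
  using assms by (induction t) (auto simp: Let_def split: prod.splits)

lemma fst_local_iter:
  "fst (local_iter P \<eta> c g y t) = y - \<eta> *\<^sub>R (\<Sum>l<t. g l (snd (local_iter P \<eta> c g y l)) + c)"
  by (induction t) (auto simp: Let_def scaleR_add_right algebra_simps split: prod.splits)

text \<open>The recursion starts at \<open>(y, y)\<close> without projecting, so
  \<open>P y = y\<close> is what makes \<open>t = 0\<close> conform.\<close>

lemma snd_local_iter:
  assumes "P y = y"
  shows "snd (local_iter P \<eta> c g y t) = P (fst (local_iter P \<eta> c g y t))"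
  using assms by (cases t) (auto simp: Let_def split: prod.splits)

text \<open>The state before round \<open>k\<close> is determined by the samples of earlier rounds.
  The corrections are compared for actual clients only, as the recursion also produces values for
  indices beyond \<open>n\<close>, built from unconstrained samples.\<close>

lemma fed_state_cong:
  assumes "\<And>l i t j. l < k \<Longrightarrow> i < n \<Longrightarrow> t < \<tau> \<Longrightarrow> j < m \<Longrightarrow> s l i t j = s' l i t j"
  shows "fst (fed_state P F n \<tau> m \<mu> \<eta> \<eta>g x1 s k) = fst (fed_state P F n \<tau> m \<mu> \<eta> \<eta>g x1 s' k)
    \<and> (\<forall>i<n. snd (fed_state P F n \<tau> m \<mu> \<eta> \<eta>g x1 s k) i = snd (fed_state P F n \<tau> m \<mu> \<eta> \<eta>g x1 s' k) i)"
  using assms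
proof (induction k)
  case (Suc k)
  let ?S = "fed_state P F n \<tau> m \<mu> \<eta> \<eta>g x1 s k" and ?S' = "fed_state P F n \<tau> m \<mu> \<eta> \<eta>g x1 s' k"
  let ?l = "\<lambda>s S i t. local_iter P \<eta> (snd S i) (\<lambda>t z. zo_est P \<mu> m (F i) (s k i t) z) (P (fst S)) t"
  have IH: "fst ?S = fst ?S'" "\<And>i. i < n \<Longrightarrow> snd ?S i = snd ?S' i"
    using Suc by auto
  have est: "zo_est P \<mu> m (F i) (s k i t) z = zo_est P \<mu> m (F i) (s' k i t) z"
    if "i < n" "t < \<tau>" for i t z
    using Suc.prems that by (intro zo_est_cong) auto
  have loc: "?l s ?S i t = ?l s' ?S' i t" if "i < n" "t \<le> \<tau>" for i t
    unfolding IH(1) IH(2)[OF that(1)] using that est by (intro local_iter_cong) auto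
  have x: "(\<Sum>i<n. fst (?l s ?S i \<tau>)) = (\<Sum>i<n. fst (?l s' ?S' i \<tau>))"
    using loc by (intro sum.cong) auto
  have G: "(\<Sum>t<\<tau>. zo_est P \<mu> m (F i) (s k i t) (snd (?l s ?S i t)))
      = (\<Sum>t<\<tau>. zo_est P \<mu> m (F i) (s' k i t) (snd (?l s' ?S' i t)))" if "i < n" for i
    using loc est that by (intro sum.cong) auto
  show ?case
    using IH(1) x G by (simp add: Let_def case_prod_beta)
qed simp

locale zo_fed = smooth_projection S P \<gamma> LP
  for S :: "(real^'r^'p) set" and P :: "real^'r^'p \<Rightarrow> real^'r^'p" and \<gamma> LP +
  fixes \<sigma> chi L M chiG chif chi1 chi2 \<mu> \<eta> :: real and n \<tau> m K :: nat
    and D :: "nat \<Rightarrow> 'x measure" and F :: "nat \<Rightarrow> real^'r^'p \<Rightarrow> 'x \<Rightarrow> real"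
    and x1 :: "real^'r^'p"
  assumes chi_pos: "0 < chi" and L_pos: "0 < L" and M_pos: "0 < M"
    and M_bound: "\<And>x u. x \<in> S \<Longrightarrow> norm (P (x + u) - x) \<le> M * norm u"
    and pos: "0 < n" "0 < \<tau>" "0 < m" "0 < K" "0 < \<mu>" "0 < \<eta>" and mu_le: "\<mu> \<le> \<gamma>"
    and client_oracle: "oracle_assm S \<sigma> n D F" and gradient: "gradient_assm S chi n D F"
    and smooth: "riem_smooth_const S L n D F"
    and estimator: "estimator_consts S P \<gamma> chiG chif chi1 chi2 n D F"
    and step: "step_size_cond M L \<gamma> chiG chi LP (sqrt (real n) * \<eta> * real \<tau>)"
begin

abbreviation gr :: "nat \<Rightarrow> real^'r^'p \<Rightarrow> real^'r^'p" where
  "gr i \<equiv> riem_grad S (client_obj D F i)"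

abbreviation batch :: "nat \<Rightarrow> (nat \<Rightarrow> 'x \<times> (real^'r^'p)) measure" where
  "batch i \<equiv> batch_law (D i) m"

abbreviation est :: "nat \<Rightarrow> real^'r^'p \<Rightarrow> (nat \<Rightarrow> 'x \<times> (real^'r^'p)) \<Rightarrow> real^'r^'p" where
  "est i x s \<equiv> zo_est P \<mu> m (F i) s x"

definition est_mean :: "nat \<Rightarrow> real^'r^'p \<Rightarrow> real^'r^'p" where
  "est_mean i x = (\<integral>s. est i x s \<partial>batch i)"

definition h :: real where "h = sqrt (real n) * \<eta> * real \<tau>"
definition \<beta> :: real where "\<beta> = chif * \<mu>"
definition V :: real where "V = chi1 * \<mu>\<^sup>2 + chi2 / real m"

lemma prob_D: "i < n \<Longrightarrow> prob_space (D i)"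
  using client_oracle by (simp add: oracle_assm_def)

lemma prob_batch: "i < n \<Longrightarrow> prob_space (batch i)"
  by (intro prob_space_batch_law prob_D)

lemma P_borel [measurable]: "P \<in> borel_measurable borel"
  using proj by (simp add: projection_on_def)

lemma measurable_est: "i < n \<Longrightarrow> (\<lambda>(x, s). est i x s) \<in> borel_measurable (borel \<Otimes>\<^sub>M batch i)"
  using client_oracle by (intro measurable_zo_est) (auto simp: oracle_assm_def)

lemma measurable_est_mean: "i < n \<Longrightarrow> est_mean i \<in> borel_measurable borel"
proof -
  assume i: "i < n"
  interpret prob_space "batch i" by (rule prob_batch[OF i])
  show ?thesis
    unfolding est_mean_def using measurable_est[OF i] by (rule borel_measurable_lebesgue_integral)
qed

lemma est_props:
  assumes "i < n" "x \<in> S"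
  shows "AE s in batch i. norm (est i x s) \<le> chiG"
    and "norm (est_mean i x - gr i x) \<le> \<beta>"
    and "(\<integral>s. (norm (est i x s - gr i x))\<^sup>2 \<partial>batch i) \<le> V"
  using estimator assms pos mu_le unfolding estimator_consts_def est_mean_def \<beta>_def V_def by blast+

lemma P_zero_in: "P 0 \<in> S"
  by (rule P_in)

text \<open>The sign is read off from the norm bound at a single sample, which exists because the
  batch law is a probability.\<close>

lemma chiG_nonneg: "0 \<le> chiG"
proof -
  obtain s where "norm (est 0 (P 0) s) \<le> chiG"
    using AE_prob_obtain[OF prob_batch[OF pos(1)] est_props(1)[OF pos(1) P_zero_in]] by metis
  then show ?thesis using norm_ge_zero order_trans by blast
qed

lemma beta_nonneg: "0 \<le> \<beta>"
  using est_props(2)[OF pos(1) P_zero_in] norm_ge_zero order_trans by blast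

lemma V_nonneg: "0 \<le> V"
proof -
  have "0 \<le> (\<integral>s. (norm (est 0 (P 0) s - gr 0 (P 0)))\<^sup>2 \<partial>batch 0)"
    by (intro Bochner_Integration.integral_nonneg) auto
  then show ?thesis
    using est_props(3)[OF pos(1) P_zero_in] by linarith
qed

lemma riem_grad_f: "x \<in> S \<Longrightarrow> riem_grad S (global_obj n D F) x = (1 / real n) *\<^sub>R (\<Sum>i<n. gr i x)"
  using client_oracle by (intro riem_grad_global_obj submanifold) (auto simp: oracle_assm_def)

sublocale fed_objective S P \<gamma> LP "global_obj n D F" gr n \<tau> L M chi chiG \<eta> h \<beta>
proof
  show "0 < n" "0 < \<tau>" "0 < \<eta>" "0 < L" "0 < M" "0 < chi"
    using pos L_pos M_pos chi_pos by auto
  show "0 \<le> \<beta>" by (rule beta_nonneg)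
  show "h = sqrt (real n) * \<eta> * real \<tau>" by (rule h_def)
  have st: "h \<le> 1 / (24 * M * L)" "h \<le> \<gamma> / (6 * max chiG chi)" "h * (chi * LP) \<le> 1"
    using step by (auto simp: step_size_cond_def h_def)
  have h0: "0 \<le> h"
    using pos by (simp add: h_def)
  show "24 * M * L * h \<le> 1"
    using st(1) M_pos L_pos by (simp add: field_simps)
  have "0 < max chiG chi"
    using chi_pos by auto
  then have mx: "h * max chiG chi \<le> \<gamma> / 6"
    using st(2) by (simp add: field_simps)
  show "h * chiG \<le> \<gamma> / 6" "h * chi \<le> \<gamma> / 6"
    using order_trans[OF mult_left_mono[OF _ h0] mx] by auto
  show "h * (chi * LP) \<le> 1" by (rule st)
  \<comment> \<open>The bound defining \<open>M\<close> with \<open>u = y - x\<close>, where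
    \<open>P\<close> fixes \<open>y\<close>.\<close>
  show "norm (y - x) \<le> M * norm (y - x)" if "x \<in> S" "y \<in> S" for x y
    using M_bound[OF that(1), of "y - x"] P_fixed[OF that(2)] by simp
  show "global_obj n D F y - global_obj n D F x
      \<le> ((1 / real n) *\<^sub>R (\<Sum>i<n. gr i x)) \<bullet> (y - x) + L / 2 * (norm (x - y))\<^sup>2"
    if "x \<in> S" "y \<in> S" for x y
  proof -
    have "global_obj n D F y - global_obj n D F x
        = (1 / real n) * (\<Sum>i<n. client_obj D F i y - client_obj D F i x)"
      by (simp add: global_obj_def sum_subtractf diff_divide_distrib)
    also have "\<dots> \<le> (1 / real n) * (\<Sum>i<n. gr i x \<bullet> (y - x) + L / 2 * (norm (x - y))\<^sup>2)"
      using that by (intro mult_left_mono sum_mono client_obj_smooth[OF client_oracle smooth]) auto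
    also have "\<dots> = ((1 / real n) *\<^sub>R (\<Sum>i<n. gr i x)) \<bullet> (y - x) + L / 2 * (norm (x - y))\<^sup>2"
      using pos(1) by (simp add: sum.distrib inner_sum_left add_divide_distrib)
    finally show ?thesis .
  qed
  show "norm (gr i x - gr i y) \<le> L * norm (x - y)" if "i < n" "x \<in> S" "y \<in> S" for i x y
    using client_grad_lipschitz[OF client_oracle smooth _ that] L_pos by simp
  show "norm (gr i x) \<le> chi" if "i < n" "x \<in> S" for i x
    using client_grad_bound[OF submanifold client_oracle gradient _ that] chi_pos by simp
  show "(1 / real n) *\<^sub>R (\<Sum>i<n. gr i x) \<in> tangent_space S x" if "x \<in> S" for x
    using orth_proj_in_and_orthogonal(1)[OF subspace_tangent_space[OF submanifold that]]
      riem_grad_f[OF that] by (metis riem_grad_def)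
qed

lemma gm_eq: "x \<in> S \<Longrightarrow> gm x = riem_grad S (global_obj n D F) x"
  by (simp add: gm_def riem_grad_f)

lemma norm_grad_map: "y \<in> S \<Longrightarrow> norm (grad_map S P (global_obj n D F) h y) = subopt y"
  using h_pos by (simp add: grad_map_def subopt_def gm_eq)

definition Y :: "nat \<Rightarrow> (nat \<Rightarrow> nat \<Rightarrow> nat \<Rightarrow> nat \<Rightarrow> 'x \<times> (real^'r^'p)) \<Rightarrow> real^'r^'p" where
  "Y k s = P (server_iterate P F n \<tau> m \<mu> \<eta> (sqrt (real n)) x1 s k)"

definition C :: "nat \<Rightarrow> (nat \<Rightarrow> nat \<Rightarrow> nat \<Rightarrow> nat \<Rightarrow> 'x \<times> (real^'r^'p)) \<Rightarrow> nat \<Rightarrow> real^'r^'p" where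
  "C k s i = snd (fed_state P F n \<tau> m \<mu> \<eta> (sqrt (real n)) x1 s k) i"

definition loc :: "nat \<Rightarrow> (nat \<Rightarrow> nat \<Rightarrow> nat \<Rightarrow> nat \<Rightarrow> 'x \<times> (real^'r^'p)) \<Rightarrow> nat \<Rightarrow> nat
    \<Rightarrow> (real^'r^'p) \<times> (real^'r^'p)" where
  "loc k s i = local_iter P \<eta> (C k s i) (\<lambda>t z. est i z (s k i t)) (Y k s)"

definition z :: "nat \<Rightarrow> (nat \<Rightarrow> nat \<Rightarrow> nat \<Rightarrow> nat \<Rightarrow> 'x \<times> (real^'r^'p)) \<Rightarrow> nat \<Rightarrow> nat \<Rightarrow> real^'r^'p" where
  "z k s i t = snd (loc k s i t)"

definition G :: "nat \<Rightarrow> (nat \<Rightarrow> nat \<Rightarrow> nat \<Rightarrow> nat \<Rightarrow> 'x \<times> (real^'r^'p)) \<Rightarrow> nat \<Rightarrow> nat \<Rightarrow> real^'r^'p" where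
  "G k s i t = est i (z k s i t) (s k i t)"

definition Gm :: "nat \<Rightarrow> (nat \<Rightarrow> nat \<Rightarrow> nat \<Rightarrow> nat \<Rightarrow> 'x \<times> (real^'r^'p)) \<Rightarrow> nat \<Rightarrow> real^'r^'p" where
  "Gm k s i = (1 / real \<tau>) *\<^sub>R (\<Sum>t<\<tau>. G k s i t)"

definition w :: "nat \<Rightarrow> (nat \<Rightarrow> nat \<Rightarrow> nat \<Rightarrow> nat \<Rightarrow> 'x \<times> (real^'r^'p)) \<Rightarrow> nat \<Rightarrow> nat \<Rightarrow> real^'r^'p" where
  "w k s i t = G k s i t - est_mean i (z k s i t)"

lemma Y_in: "Y k s \<in> S"
  by (simp add: Y_def P_in)

lemma fst_loc: "fst (loc k s i t) = Y k s - \<eta> *\<^sub>R (\<Sum>l<t. G k s i l + C k s i)"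
  unfolding loc_def G_def z_def by (rule fst_local_iter)

lemma z_eq: "z k s i t = P (Y k s - \<eta> *\<^sub>R (\<Sum>l<t. G k s i l + C k s i))"
  unfolding fst_loc[symmetric] unfolding z_def loc_def
  by (rule snd_local_iter) (rule P_fixed[OF Y_in])

lemma z_in: "z k s i t \<in> S"
  by (simp add: z_eq P_in)

lemma norm_z_diff_le: "norm (z k s i t - Y k s) \<le> M * norm (\<eta> *\<^sub>R (\<Sum>l<t. G k s i l + C k s i))"
  using M_bound[OF Y_in, of k s "- (\<eta> *\<^sub>R (\<Sum>l<t. G k s i l + C k s i))"] by (simp add: z_eq)

lemma C_0: "C 0 s i = 0"
  by (simp add: C_def)

text \<open>With corrections summing to zero, the local displacements average to
  \<open>\<eta> * real \<tau>\<close> times the mean estimate, and the server factor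
  \<open>sqrt (real n)\<close> completes this to \<open>h\<close>.\<close>

lemma server_step:
  assumes "(\<Sum>i<n. C k s i) = 0"
  shows "server_iterate P F n \<tau> m \<mu> \<eta> (sqrt (real n)) x1 s (Suc k)
    = Y k s - h *\<^sub>R ((1 / real n) *\<^sub>R (\<Sum>i<n. Gm k s i))"
proof -
  have "(\<Sum>i<n. fst (loc k s i \<tau>)) = (\<Sum>i<n. Y k s - \<eta> *\<^sub>R (real \<tau> *\<^sub>R (Gm k s i + C k s i)))"
    using pos(2) by (intro sum.cong)
      (auto simp: fst_loc Gm_def sum.distrib sum_constant_scaleR scaleR_add_right
        simp del: sum_constant)
  also have "\<dots> = real n *\<^sub>R Y k s - \<eta> *\<^sub>R (real \<tau> *\<^sub>R (\<Sum>i<n. Gm k s i))"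
    using assms by (simp add: sum_subtractf sum.distrib sum_constant_scaleR
        scaleR_sum_right[symmetric] del: sum_constant)
  finally have l: "(\<Sum>i<n. fst (loc k s i \<tau>)) = real n *\<^sub>R Y k s - (\<eta> * real \<tau>) *\<^sub>R (\<Sum>i<n. Gm k s i)"
    by simp
  have "server_iterate P F n \<tau> m \<mu> \<eta> (sqrt (real n)) x1 s (Suc k)
      = Y k s + sqrt (real n) *\<^sub>R ((1 / real n) *\<^sub>R (\<Sum>i<n. fst (loc k s i \<tau>)) - Y k s)"
    by (simp add: server_iterate_def Let_def case_prod_beta loc_def C_def Y_def)
  also have "\<dots> = Y k s - h *\<^sub>R ((1 / real n) *\<^sub>R (\<Sum>i<n. Gm k s i))"
    using pos(1) by (simp add: l h_def scaleR_diff_right mult_ac)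
  finally show ?thesis .
qed

lemma C_step:
  assumes "(\<Sum>i<n. C k s i) = 0"
  shows "C (Suc k) s i = (1 / real n) *\<^sub>R (\<Sum>i<n. Gm k s i) - Gm k s i"
proof -
  have "C (Suc k) s i = (1 / h) *\<^sub>R (Y k s - server_iterate P F n \<tau> m \<mu> \<eta> (sqrt (real n)) x1 s (Suc k)) - Gm k s i"
    by (simp add: server_iterate_def Let_def case_prod_beta loc_def C_def Y_def h_def Gm_def G_def z_def)
  then show ?thesis
    using h_pos by (simp add: server_step[OF assms])
qed

text \<open>By \<open>C_step\<close> new corrections are deviations from an average. The step lemmas
  take the vanishing sum as a hypothesis precisely so that this induction can use them.\<close>

lemma C_sum: "(\<Sum>i<n. C k s i) = 0"
proof (induction k)
  case (Suc k)
  then show ?case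
    using pos(1) by (simp add: C_step sum_subtractf sum_constant_scaleR del: sum_constant)
qed (simp add: C_0)

lemma Y_Suc: "Y (Suc k) s = P (Y k s - h *\<^sub>R ((1 / real n) *\<^sub>R (\<Sum>i<n. Gm k s i)))"
  unfolding Y_def[of "Suc k"] server_step[OF C_sum] ..

lemma C_Suc: "C (Suc k) s i = (1 / real n) *\<^sub>R (\<Sum>i<n. Gm k s i) - Gm k s i"
  by (rule C_step[OF C_sum])

definition noise_mean where
  "noise_mean k s = (1 / real n) *\<^sub>R (\<Sum>i<n. (1 / real \<tau>) *\<^sub>R (\<Sum>t<\<tau>. w k s i t))"
definition noise_client :: "nat \<Rightarrow> (nat \<Rightarrow> nat \<Rightarrow> nat \<Rightarrow> nat \<Rightarrow> 'x \<times> (real^'r^'p)) \<Rightarrow> real" where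
  "noise_client k s = (1 / real n) * (\<Sum>i<n. (norm ((1 / real \<tau>) *\<^sub>R (\<Sum>t<\<tau>. w k s i t)))\<^sup>2)"
definition noise_partial :: "nat \<Rightarrow> (nat \<Rightarrow> nat \<Rightarrow> nat \<Rightarrow> nat \<Rightarrow> 'x \<times> (real^'r^'p)) \<Rightarrow> real" where
  "noise_partial k s = (1 / real n) * (\<Sum>i<n. (1 / real \<tau> ^ 3) * (\<Sum>t<\<tau>. (norm (\<Sum>l<t. w k s i l))\<^sup>2))"
definition exact_step where
  "exact_step k s = P (Y k s - h *\<^sub>R gm (Y k s)) - Y k s"

lemma round_inequality_at:
  assumes "\<And>i t. i < n \<Longrightarrow> t < \<tau> \<Longrightarrow> norm (G k s i t) \<le> chiG" and "40 * \<beta> \<le> 3 * chi"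
  shows "(subopt (Y k s))\<^sup>2 \<le> 8 / h * (global_obj n D F (Y k s) - global_obj n D F (Y (Suc k) s))
    + 8 / real n * (hetero (Y k s) (C k s) - hetero (Y (Suc k) s) (C (Suc k) s))
    + 198 / 5 * (norm (noise_mean k s))\<^sup>2 + 16 / real n * noise_client k s
    + 61 / 20 / real n * noise_partial k s
    + (15 + 4 / real n) * (chi * \<beta>) - 8 / h * (noise_mean k s \<bullet> exact_step k s)"
proof -
  interpret R: fed_round S P \<gamma> LP "global_obj n D F" gr n \<tau> L M chi chiG \<eta> h \<beta>
    "Y k s" "C k s" "z k s" "G k s" "w k s" "\<lambda>i t. est_mean i (z k s i t) - gr i (z k s i t)"
    by unfold_locales
      (use assms est_props(2) z_in Y_in norm_z_diff_le C_sum in \<open>auto simp: w_def\<close>)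
  have Gb: "R.Gb = (1 / real n) *\<^sub>R (\<Sum>i<n. Gm k s i)"
    by (simp add: R.Gb_def R.Gm_def Gm_def)
  have "R.yp = Y (Suc k) s"
    by (simp add: R.yp_def Gb Y_Suc)
  moreover have "R.cp = C (Suc k) s"
    by (auto simp: R.cp_def Gb C_Suc R.Gm_def Gm_def)
  moreover have "R.wb = noise_mean k s" "R.W_client = noise_client k s" "R.W_partial = noise_partial k s"
    by (simp_all add: R.wb_def R.wm_def R.W_client_def R.W_partial_def noise_mean_def noise_client_def
        noise_partial_def)
  moreover have "R.yt - Y k s = exact_step k s"
    by (simp add: R.yt_def exact_step_def)
  ultimately show ?thesis
    using R.round_inequality[OF assms(2)] by simp
qed

end

section \<open>Independence of the samples\<close>

lemma indep_vars_PiM_coordinates: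
  assumes M: "\<And>i. i \<in> I \<Longrightarrow> prob_space (M i)" and "I \<noteq> {}"
  shows "prob_space.indep_vars (PiM I M) M (\<lambda>i q. q i) I"
proof -
  interpret prob_space "PiM I M" by (rule prob_space_PiM[OF M])
  have "distr (PiM I M) (PiM I M) (\<lambda>q. \<lambda>i\<in>I. q i) = distr (PiM I M) (PiM I M) (\<lambda>q. q)"
    by (intro distr_cong) (auto simp: space_PiM PiE_def extensional_restrict)
  also have "\<dots> = PiM I (\<lambda>i. distr (PiM I M) (M i) (\<lambda>q. q i))"
    using distr_PiM_component[of I M, OF M] by (auto simp: distr_id2 intro!: PiM_cong)
  finally show ?thesis
    by (subst indep_vars_iff_distr_eq_PiM'[OF assms(2)]) auto
qed

text \<open>A function of the coordinates in \<open>A\<close> only factors through the restriction to \<open>A\<close>: the other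
  coordinates may be frozen at a point \<open>b0\<close>.\<close>
lemma distr_disjoint_coordinates:
  assumes M: "\<And>i. i \<in> A \<union> B \<Longrightarrow> prob_space (M i)" and AB: "A \<inter> B = {}" "A \<union> B \<noteq> {}"
    and r: "r \<in> measurable (PiM (A \<union> B) M) N"
    and r_eq: "\<And>q q'. q \<in> space (PiM (A \<union> B) M) \<Longrightarrow> q' \<in> space (PiM (A \<union> B) M) \<Longrightarrow>
      (\<And>i. i \<in> A \<Longrightarrow> q i = q' i) \<Longrightarrow> r q = r q'"
    and u: "u \<in> measurable (PiM B M) N'"
  shows "distr (PiM (A \<union> B) M) (N \<Otimes>\<^sub>M N') (\<lambda>q. (r q, u (restrict q B)))
    = distr (PiM (A \<union> B) M) N r \<Otimes>\<^sub>M distr (PiM (A \<union> B) M) N' (\<lambda>q. u (restrict q B))"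
proof -
  let ?Q = "PiM (A \<union> B) M"
  interpret prob_space ?Q by (rule prob_space_PiM[OF M])
  interpret B: prob_space "PiM B M" by (rule prob_space_PiM[OF M]) simp
  obtain b0 where b0: "b0 \<in> space (PiM B M)"
    using B.not_empty by blast
  define e where "e = (\<lambda>a. merge A B (a, b0))"
  have e: "e \<in> measurable (PiM A M) ?Q"
    unfolding e_def using b0 by measurable
  have ind: "indep_var (PiM A M) (\<lambda>q. restrict q A) (PiM B M) (\<lambda>q. restrict q B)"
    using indep_var_restrict[OF indep_vars_PiM_coordinates[OF M AB(2)], of A B] AB(1) by auto
  have re: "r (e (restrict q A)) = r q" if q: "q \<in> space ?Q" for q
  proof -
    have "restrict q A \<in> space (PiM A M)"
      using q by (auto simp: space_PiM)
    then have "e (restrict q A) \<in> space ?Q"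
      using e by (rule measurable_space[rotated])
    then show ?thesis
      using r_eq[OF _ q] AB(1) by (auto simp: e_def merge_def)
  qed
  have mA: "(\<lambda>q. restrict q A) \<in> measurable ?Q (PiM A M)" and mB: "(\<lambda>q. restrict q B) \<in> measurable ?Q (PiM B M)"
    by (auto intro!: measurable_restrict)
  have re_m: "(\<lambda>a. r (e a)) \<in> measurable (PiM A M) N"
    using measurable_compose[OF e r] .
  have "distr ?Q (N \<Otimes>\<^sub>M N') (\<lambda>q. (r q, u (restrict q B)))
      = distr ?Q (N \<Otimes>\<^sub>M N') (\<lambda>q. (r (e (restrict q A)), u (restrict q B)))"
    by (intro distr_cong) (auto simp: re)
  also have "\<dots> = distr (distr ?Q (PiM A M \<Otimes>\<^sub>M PiM B M) (\<lambda>q. (restrict q A, restrict q B)))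
      (N \<Otimes>\<^sub>M N') (\<lambda>(a, b). (r (e a), u b))"
    using re_m u mA mB by (subst distr_distr) (auto simp: comp_def intro!: measurable_Pair
        measurable_compose[OF measurable_fst re_m] measurable_compose[OF measurable_snd u] simp: case_prod_beta')
  also have "\<dots> = distr (distr ?Q (PiM A M) (\<lambda>q. restrict q A) \<Otimes>\<^sub>M distr ?Q (PiM B M) (\<lambda>q. restrict q B))
      (N \<Otimes>\<^sub>M N') (\<lambda>(a, b). (r (e a), u b))"
    using ind unfolding indep_var_distribution_eq by simp
  also have "\<dots> = distr (distr ?Q (PiM A M) (\<lambda>q. restrict q A)) N (\<lambda>a. r (e a))
      \<Otimes>\<^sub>M distr (distr ?Q (PiM B M) (\<lambda>q. restrict q B)) N' u"
  proof (rule pair_measure_distr[symmetric])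
    have "prob_space (distr (distr ?Q (PiM B M) (\<lambda>q. restrict q B)) N' u)"
      using mB u by (intro prob_space.prob_space_distr prob_space_axioms) auto
    then show "sigma_finite_measure (distr (distr ?Q (PiM B M) (\<lambda>q. restrict q B)) N' u)"
      by (rule prob_space_imp_sigma_finite)
  qed (use re_m u in auto)
  also have "distr (distr ?Q (PiM A M) (\<lambda>q. restrict q A)) N (\<lambda>a. r (e a)) = distr ?Q N r"
    using re_m mA re by (subst distr_distr) (auto simp: comp_def intro!: distr_cong)
  also have "distr (distr ?Q (PiM B M) (\<lambda>q. restrict q B)) N' u = distr ?Q N' (\<lambda>q. u (restrict q B))"
    using u mB by (subst distr_distr) (auto simp: comp_def)
  finally show ?thesis .
qed

text \<open>Riemannian gradients are continuous only on \<open>S\<close>. Multiplication by the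
  indicator of \<open>S\<close> extends them to Borel maps without changing the values that
  occur.\<close>

lemma measurable_continuous_on_compose:
  fixes g :: "'a::euclidean_space \<Rightarrow> 'b::real_normed_vector"
  assumes "closed S" "continuous_on S g" "y \<in> borel_measurable M" "\<And>q. y q \<in> S"
  shows "(\<lambda>q. g (y q)) \<in> borel_measurable M"
proof -
  have "(\<lambda>q. indicator S (y q) *\<^sub>R g (y q)) \<in> borel_measurable M"
    using measurable_compose[OF assms(3) borel_measurable_continuous_on_indicator[OF _ assms(2)]] assms(1)
    by auto
  then show ?thesis
    using assms(4) by simp
qed

section \<open>The product space of all samples\<close>

context zo_fed
begin

definition I :: "(nat \<times> nat \<times> nat \<times> nat) set" where
  "I = {..<K} \<times> {..<n} \<times> {..<\<tau>} \<times> {..<m}"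

definition law :: "nat \<times> nat \<times> nat \<times> nat \<Rightarrow> ('x \<times> (real^'r^'p)) measure" where
  "law = (\<lambda>(k, i, t, j). sample_law (D i))"

definition Q :: "(nat \<times> nat \<times> nat \<times> nat \<Rightarrow> 'x \<times> (real^'r^'p)) measure" where
  "Q = PiM I law"

definition sc :: "(nat \<times> nat \<times> nat \<times> nat \<Rightarrow> 'x \<times> (real^'r^'p)) \<Rightarrow> nat \<Rightarrow> nat \<Rightarrow> nat \<Rightarrow> nat \<Rightarrow> 'x \<times> (real^'r^'p)"
  where "sc q = (\<lambda>k i t j. q (k, i, t, j))"

text \<open>The restriction makes each batch an extensional function, hence a point of the product
  space underlying \<open>batch i\<close>.\<close>

definition blk where "blk k i t q = (\<lambda>j\<in>{..<m}. q (k, i, t, j))"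

text \<open>Not depending on the batch of client \<open>i\<close> in step \<open>t\<close> of round
  \<open>k\<close>. This pointwise notion stands in for measurability with respect to the
  sigma-algebra of all other samples.\<close>

definition off_block :: "nat \<Rightarrow> nat \<Rightarrow> nat \<Rightarrow> ((nat \<times> nat \<times> nat \<times> nat \<Rightarrow> 'x \<times> (real^'r^'p)) \<Rightarrow> 'b) \<Rightarrow> bool" where
  "off_block k i t r \<longleftrightarrow> (\<forall>q\<in>space Q. \<forall>q'\<in>space Q.
    (\<forall>idx\<in>I. idx \<notin> {(k, i, t, j) | j. True} \<longrightarrow> q idx = q' idx) \<longrightarrow> r q = r q')"

lemma prob_law: "idx \<in> I \<Longrightarrow> prob_space (law idx)"
  by (auto simp: I_def law_def intro!: prob_space_sample_law prob_D)

sublocale Q: prob_space Q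
  unfolding Q_def by (rule prob_space_PiM[OF prob_law])

lemma blk_measurable:
  assumes "k < K" "i < n" "t < \<tau>"
  shows "blk k i t \<in> measurable Q (batch i)"
proof -
  have "(\<lambda>q. q (k, i, t, j)) \<in> measurable Q (sample_law (D i))" if "j < m" for j
    using measurable_component_singleton[of "(k, i, t, j)" I law] assms that
    by (simp add: Q_def I_def law_def)
  then show ?thesis
    unfolding blk_def batch_law_def by (intro measurable_restrict) auto
qed

lemma distr_blk:
  assumes "k < K" "i < n" "t < \<tau>"
  shows "distr Q (batch i) (blk k i t) = batch i"
proof -
  have "distr (PiM I law) (\<Pi>\<^sub>M j\<in>{..<m}. law (k, i, t, j)) (\<lambda>q. \<lambda>j\<in>{..<m}. q (k, i, t, j))
      = (\<Pi>\<^sub>M j\<in>{..<m}. law (k, i, t, j))"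
    by (rule distr_PiM_reindex) (use assms prob_law in \<open>auto simp: I_def inj_on_def\<close>)
  then show ?thesis
    by (simp add: Q_def blk_def[abs_def] batch_law_def law_def)
qed

lemma distr_off_block_pair:
  assumes "k < K" "i < n" "t < \<tau>" and r: "r \<in> measurable Q N" and off: "off_block k i t r"
  shows "distr Q (N \<Otimes>\<^sub>M batch i) (\<lambda>q. (r q, blk k i t q)) = distr Q N r \<Otimes>\<^sub>M batch i"
proof -
  let ?B = "{(k, i, t, j) | j. j < m}"
  have I: "I = (I - ?B) \<union> ?B"
    using assms(1-3) by (auto simp: I_def)
  let ?u = "\<lambda>q. \<lambda>j\<in>{..<m}. q (k, i, t, j)"
  have u: "?u \<in> measurable (PiM ?B law) (batch i)"
    unfolding batch_law_def
  proof (intro measurable_restrict)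
    fix j assume "j \<in> {..<m}"
    then show "(\<lambda>q. q (k, i, t, j)) \<in> measurable (PiM ?B law) (sample_law (D i))"
      using measurable_component_singleton[of "(k, i, t, j)" ?B law] by (simp add: law_def)
  qed
  have Q: "PiM ((I - ?B) \<union> ?B) law = Q"
    unfolding Q_def using I by simp
  have eq: "?u (restrict q ?B) = blk k i t q" for q
    by (auto simp: blk_def restrict_def)
  have "distr (PiM ((I - ?B) \<union> ?B) law) (N \<Otimes>\<^sub>M batch i) (\<lambda>q. (r q, ?u (restrict q ?B)))
    = distr (PiM ((I - ?B) \<union> ?B) law) N r \<Otimes>\<^sub>M distr (PiM ((I - ?B) \<union> ?B) law) (batch i) (\<lambda>q. ?u (restrict q ?B))"
  proof (rule distr_disjoint_coordinates)
    show "(I - ?B) \<union> ?B \<noteq> {}"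
      using I assms(1-3) pos(3) by (auto simp: I_def)
    show "prob_space (law idx)" if "idx \<in> (I - ?B) \<union> ?B" for idx
      using that I prob_law by blast
    fix q q' assume q: "q \<in> space (PiM ((I - ?B) \<union> ?B) law)" "q' \<in> space (PiM ((I - ?B) \<union> ?B) law)"
      and eq: "\<And>idx. idx \<in> I - ?B \<Longrightarrow> q idx = q' idx"
    have "\<forall>idx\<in>I. idx \<notin> {(k, i, t, j) | j. True} \<longrightarrow> q idx = q' idx"
      using eq by blast
    then show "r q = r q'"
      using off q unfolding off_block_def Q by blast
  next
    show "r \<in> measurable (PiM ((I - ?B) \<union> ?B) law) N"
      unfolding Q by (rule r)
    show "?u \<in> measurable (PiM ?B law) (batch i)"
      by (rule u)
  qed auto
  then show ?thesis
    unfolding Q eq distr_blk[OF assms(1-3)] .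
qed

text \<open>Conditional expectation given all other samples, in the form of Fubini's theorem: the
  batch is integrated first, with everything off the block frozen.\<close>

lemma off_block_integral:
  fixes \<psi> :: "'b \<times> (nat \<Rightarrow> 'x \<times> (real^'r^'p)) \<Rightarrow> real"
  assumes kit: "k < K" "i < n" "t < \<tau>" and r[measurable]: "r \<in> measurable Q N" and off: "off_block k i t r"
    and \<psi>[measurable]: "\<psi> \<in> borel_measurable (N \<Otimes>\<^sub>M batch i)"
    and int: "integrable Q (\<lambda>q. \<psi> (r q, blk k i t q))"
  shows "(\<integral>q. \<psi> (r q, blk k i t q) \<partial>Q) = (\<integral>q. (\<integral>b. \<psi> (r q, b) \<partial>batch i) \<partial>Q)"
proof -
  interpret B: prob_space "batch i" by (rule prob_batch[OF kit(2)])
  interpret R: prob_space "distr Q N r" by (rule Q.prob_space_distr[OF r])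
  interpret pair_sigma_finite "distr Q N r" "batch i" ..
  note [measurable] = blk_measurable[OF kit]
  have pm: "(\<lambda>q. (r q, blk k i t q)) \<in> measurable Q (N \<Otimes>\<^sub>M batch i)"
    by measurable
  have "integrable (distr Q (N \<Otimes>\<^sub>M batch i) (\<lambda>q. (r q, blk k i t q))) \<psi>"
    using int pm by (subst integrable_distr_eq) auto
  then have int2: "integrable (distr Q N r \<Otimes>\<^sub>M batch i) \<psi>"
    unfolding distr_off_block_pair[OF kit r off] .
  have "(\<integral>q. \<psi> (r q, blk k i t q) \<partial>Q) = (\<integral>p. \<psi> p \<partial>distr Q (N \<Otimes>\<^sub>M batch i) (\<lambda>q. (r q, blk k i t q)))"
    using pm by (subst integral_distr) auto
  also have "\<dots> = (\<integral>x. (\<integral>b. \<psi> (x, b) \<partial>batch i) \<partial>distr Q N r)"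
    unfolding distr_off_block_pair[OF kit r off] by (rule integral_fst'[OF int2, symmetric])
  also have "\<dots> = (\<integral>q. (\<integral>b. \<psi> (r q, b) \<partial>batch i) \<partial>Q)"
    using r by (subst integral_distr) (auto intro!: B.borel_measurable_lebesgue_integral)
  finally show ?thesis .
qed

text \<open>\<open>off_block_integral\<close> applied to the indicator of the exceptional set, whose
  inner integral vanishes for every frozen value.\<close>

lemma off_block_AE:
  assumes kit: "k < K" "i < n" "t < \<tau>" and r[measurable]: "r \<in> measurable Q N" and off: "off_block k i t r"
    and R: "{p \<in> space (N \<Otimes>\<^sub>M batch i). R (fst p) (snd p)} \<in> sets (N \<Otimes>\<^sub>M batch i)"
    and ae: "\<And>q. q \<in> space Q \<Longrightarrow> AE b in batch i. R (r q) b"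
  shows "AE q in Q. R (r q) (blk k i t q)"
proof -
  let ?X = "{p \<in> space (N \<Otimes>\<^sub>M batch i). \<not> R (fst p) (snd p)}"
  let ?\<psi> = "indicator ?X :: _ \<Rightarrow> real"
  note [measurable] = blk_measurable[OF kit]
  have X: "?X \<in> sets (N \<Otimes>\<^sub>M batch i)"
    using R by (rule sets.sets_Collect_neg)
  have \<psi>: "?\<psi> \<in> borel_measurable (N \<Otimes>\<^sub>M batch i)"
    using X by simp
  have pm: "(\<lambda>q. (r q, blk k i t q)) \<in> measurable Q (N \<Otimes>\<^sub>M batch i)"
    by measurable
  have int: "integrable Q (\<lambda>q. ?\<psi> (r q, blk k i t q))"
    by (intro Q.integrable_const_bound[of _ 1] measurable_compose[OF pm \<psi>]) (auto simp: indicator_def)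
  have "(\<integral>b. ?\<psi> (r q, b) \<partial>batch i) = 0" if "q \<in> space Q" for q
    using ae[OF that] by (intro integral_eq_zero_AE) (auto elim!: eventually_mono)
  then have "(\<integral>q. ?\<psi> (r q, blk k i t q) \<partial>Q) = (\<integral>q. 0 \<partial>Q)"
    unfolding off_block_integral[OF kit r off \<psi> int] by (intro Bochner_Integration.integral_cong) auto
  then have "AE q in Q. ?\<psi> (r q, blk k i t q) = 0"
    using integral_nonneg_eq_0_iff_AE[OF int] by simp
  then show ?thesis
    using AE_space
  proof eventually_elim
    case (elim q)
    then show ?case
      using measurable_space[OF pm elim(2)] by (auto simp: indicator_def split: if_splits)
  qed
qed

lemma est_blk: "est i x (sc q k i t) = est i x (blk k i t q)"
  by (rule zo_est_cong) (simp add: sc_def blk_def)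

lemma G_blk: "G k (sc q) i t = est i (z k (sc q) i t) (blk k i t q)"
  by (simp add: G_def est_blk)

lemma measurable_G:
  assumes "k < K" "i < n" "t < \<tau>" and zm: "(\<lambda>q. z k (sc q) i t) \<in> borel_measurable Q"
  shows "(\<lambda>q. G k (sc q) i t) \<in> borel_measurable Q"
  using measurable_compose[OF measurable_Pair[OF zm blk_measurable[OF assms(1-3)]] measurable_est[OF assms(2)]]
  by (simp add: G_blk)

text \<open>A local iterate involves all earlier estimates of its round, hence the complete
  induction.\<close>

lemma measurable_z:
  assumes "k < K" "i < n" "t \<le> \<tau>"
    and [measurable]: "(\<lambda>q. Y k (sc q)) \<in> borel_measurable Q" "(\<lambda>q. C k (sc q) i) \<in> borel_measurable Q"
  shows "(\<lambda>q. z k (sc q) i t) \<in> borel_measurable Q"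
  using assms(3)
proof (induction t rule: less_induct)
  case (less t)
  have [measurable]: "(\<lambda>q. G k (sc q) i l) \<in> borel_measurable Q" if "l \<in> {..<t}" for l
    using less that by (intro measurable_G assms(1,2)) auto
  show ?case
    unfolding z_eq by measurable
qed

lemma measurable_state:
  assumes "k \<le> K"
  shows "(\<lambda>q. Y k (sc q)) \<in> borel_measurable Q \<and> (\<forall>i<n. (\<lambda>q. C k (sc q) i) \<in> borel_measurable Q)"
  using assms
proof (induction k)
  case 0
  then show ?case
    by (simp add: C_0 Y_def server_iterate_def)
next
  case (Suc k)
  then have [measurable]: "(\<lambda>q. Y k (sc q)) \<in> borel_measurable Q"
    and C: "\<And>i. i < n \<Longrightarrow> (\<lambda>q. C k (sc q) i) \<in> borel_measurable Q"
    by auto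
  have "(\<lambda>q. G k (sc q) i t) \<in> borel_measurable Q" if "i < n" "t < \<tau>" for i t
    using Suc.prems C that by (intro measurable_G measurable_z) auto
  then have [measurable]: "(\<lambda>q. Gm k (sc q) i) \<in> borel_measurable Q" if "i \<in> {..<n}" for i
    unfolding Gm_def using that by auto
  have Gm: "(\<lambda>q. Gm k (sc q) i) \<in> borel_measurable Q" if "i < n" for i
    using that by auto
  show ?case
    unfolding Y_Suc C_Suc by (intro conjI allI impI borel_measurable_diff Gm) measurable
qed

lemma Y_measurable: "k \<le> K \<Longrightarrow> (\<lambda>q. Y k (sc q)) \<in> borel_measurable Q"
  and C_measurable: "k \<le> K \<Longrightarrow> i < n \<Longrightarrow> (\<lambda>q. C k (sc q) i) \<in> borel_measurable Q"
  using measurable_state by auto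

lemma z_measurable: "k < K \<Longrightarrow> i < n \<Longrightarrow> t \<le> \<tau> \<Longrightarrow> (\<lambda>q. z k (sc q) i t) \<in> borel_measurable Q"
  by (intro measurable_z Y_measurable C_measurable) auto

lemma w_measurable: "k < K \<Longrightarrow> i < n \<Longrightarrow> t < \<tau> \<Longrightarrow> (\<lambda>q. w k (sc q) i t) \<in> borel_measurable Q"
  unfolding w_def
  by (intro borel_measurable_diff measurable_G measurable_compose[OF _ measurable_est_mean] z_measurable) auto

section \<open>Which batches the iterates depend on\<close>

lemma state_off_block:
  assumes "k < K" "\<And>idx. idx \<in> I \<Longrightarrow> idx \<notin> {(k, i, t, j) | j. True} \<Longrightarrow> q idx = q' idx"
  shows "Y k (sc q) = Y k (sc q')" and "i' < n \<Longrightarrow> C k (sc q) i' = C k (sc q') i'"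
proof -
  have "sc q l i' t' j = sc q' l i' t' j" if "l < k" "i' < n" "t' < \<tau>" "j < m" for l i' t' j
    using assms that by (simp add: sc_def I_def)
  from fed_state_cong[of k n \<tau> m "sc q" "sc q'", OF this]
  show "Y k (sc q) = Y k (sc q')" "i' < n \<Longrightarrow> C k (sc q) i' = C k (sc q') i'"
    by (simp_all add: Y_def C_def server_iterate_def)
qed

lemma est_off_block:
  assumes "k < K" "i' < n" "t' < \<tau>" "(i', t') \<noteq> (i, t)"
    "\<And>idx. idx \<in> I \<Longrightarrow> idx \<notin> {(k, i, t, j) | j. True} \<Longrightarrow> q idx = q' idx"
  shows "est i' x (sc q k i' t') = est i' x (sc q' k i' t')"
  using assms by (intro zo_est_cong) (auto simp: sc_def I_def)

text \<open>Clients do not communicate within a round, and the iterate at step \<open>t'\<close> has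
  used only the batches before \<open>t'\<close>. So equality \<open>t' \<le> t\<close> is still
  allowed for the same client.\<close>

lemma z_off_block:
  assumes "k < K" "i' < n" "t' < \<tau>" "i' \<noteq> i \<or> t' \<le> t"
    "\<And>idx. idx \<in> I \<Longrightarrow> idx \<notin> {(k, i, t, j) | j. True} \<Longrightarrow> q idx = q' idx"
  shows "z k (sc q) i' t' = z k (sc q') i' t'"
proof -
  have Y: "Y k (sc q) = Y k (sc q')" and C: "C k (sc q) i' = C k (sc q') i'"
    using state_off_block[of k i t q q', OF assms(1,5)] assms(2) by auto
  have "local_iter P \<eta> (C k (sc q') i') (\<lambda>t z. est i' z (sc q k i' t)) (Y k (sc q')) t'
      = local_iter P \<eta> (C k (sc q') i') (\<lambda>t z. est i' z (sc q' k i' t)) (Y k (sc q')) t'"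
    using assms(1-4) by (intro local_iter_cong est_off_block[OF _ _ _ _ assms(5)]) auto
  then show ?thesis
    by (simp add: z_def loc_def Y C)
qed

lemma off_block_z:
  assumes "k < K" "i' < n" "t' < \<tau>" "i' \<noteq> i \<or> t' \<le> t"
  shows "off_block k i t (\<lambda>q. z k (sc q) i' t')"
  unfolding off_block_def by (intro ballI impI z_off_block[OF assms]) blast

text \<open>Strict inequality for the same client, because the noise of step \<open>t'\<close>
  contains the batch of step \<open>t'\<close>.\<close>

lemma off_block_w:
  assumes "k < K" "i' < n" "t' < \<tau>" "i' \<noteq> i \<or> t' < t"
  shows "off_block k i t (\<lambda>q. w k (sc q) i' t')"
  unfolding off_block_def
proof (intro ballI impI)
  fix q q' :: "nat \<times> nat \<times> nat \<times> nat \<Rightarrow> 'x \<times> (real^'r^'p)"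
  assume *: "\<forall>idx\<in>I. idx \<notin> {(k, i, t, j) | j. True} \<longrightarrow> q idx = q' idx"
  have "z k (sc q) i' t' = z k (sc q') i' t'"
    using assms * by (intro z_off_block[where i = i and t = t]) auto
  moreover have "est i' x (sc q k i' t') = est i' x (sc q' k i' t')" for x
    using assms * by (intro est_off_block[where i = i and t = t]) auto
  ultimately show "w k (sc q) i' t' = w k (sc q') i' t'"
    by (simp add: w_def G_def)
qed

lemma off_block_Y: "k < K \<Longrightarrow> off_block k i t (\<lambda>q. \<phi> (Y k (sc q)))"
  unfolding off_block_def by (intro ballI impI arg_cong[where f = \<phi>] state_off_block(1)) blast+

lemma off_block_Pair: "off_block k i t r \<Longrightarrow> off_block k i t r' \<Longrightarrow> off_block k i t (\<lambda>q. (r q, r' q))"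
  unfolding off_block_def by blast

text \<open>The estimator bound holds almost surely at each fixed point, with an exceptional set
  depending on the point. It transfers to the random local iterate because that iterate does not
  depend on the batch.\<close>

lemma G_bound:
  assumes kit: "k < K" "i < n" "t < \<tau>"
  shows "AE q in Q. norm (G k (sc q) i t) \<le> chiG"
proof -
  note [measurable] = measurable_est[OF kit(2), unfolded case_prod_beta']
  have "AE q in Q. norm (est i (z k (sc q) i t) (blk k i t q)) \<le> chiG"
  proof (rule off_block_AE[OF kit z_measurable off_block_z])
    show "AE b in batch i. norm (est i (z k (sc q) i t) b) \<le> chiG" for q
      by (rule est_props(1)[OF kit(2) z_in])
    show "{p \<in> space (borel \<Otimes>\<^sub>M batch i). norm (est i (fst p) (snd p)) \<le> chiG} \<in> sets (borel \<Otimes>\<^sub>M batch i)"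
      by measurable
  qed (use kit in auto)
  then show ?thesis
    by (simp add: G_blk)
qed

lemma est_integrable: "i < n \<Longrightarrow> x \<in> S \<Longrightarrow> integrable (batch i) (est i x)"
proof -
  assume *: "i < n" "x \<in> S"
  interpret B: prob_space "batch i" by (rule prob_batch[OF *(1)])
  have "est i x \<in> borel_measurable (batch i)"
    using measurable_compose[OF measurable_Pair1' measurable_est[OF *(1)], of x] by simp
  then show ?thesis
    using est_props(1)[OF *] by (intro B.integrable_const_bound)
qed

lemma norm_est_mean_le: "i < n \<Longrightarrow> x \<in> S \<Longrightarrow> norm (est_mean i x) \<le> chiG"
  unfolding est_mean_def by (intro norm_prob_integral_le prob_batch est_props(1) chiG_nonneg)

lemma w_bound:
  assumes "k < K" "i < n" "t < \<tau>"
  shows "AE q in Q. norm (w k (sc q) i t) \<le> 2 * chiG"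
  using G_bound[OF assms]
proof eventually_elim
  case (elim q)
  then show ?case
    using norm_est_mean_le[OF assms(2) z_in, of k "sc q" i t]
      norm_triangle_ineq4[of "G k (sc q) i t" "est_mean i (z k (sc q) i t)"]
    by (simp add: w_def)
qed

text \<open>The mean minimises the expected squared distance, so centering at
  \<open>est_mean i x\<close> instead of the gradient does not increase it.\<close>

lemma est_variance:
  assumes "i < n" "x \<in> S"
  shows "(\<integral>b. (norm (est i x b - est_mean i x))\<^sup>2 \<partial>batch i) \<le> V"
proof -
  interpret B: prob_space "batch i" by (rule prob_batch[OF assms(1)])
  note int = est_integrable[OF assms]
  have sq: "integrable (batch i) (\<lambda>b. (norm (est i x b))\<^sup>2)"
    using est_props(1)[OF assms] int
    by (intro B.integrable_const_bound[where B = "chiG\<^sup>2"]) (auto elim!: eventually_mono intro: power_mono)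
  have e: "(\<integral>b. (norm (est i x b - c))\<^sup>2 \<partial>batch i)
      = (\<integral>b. (norm (est i x b))\<^sup>2 \<partial>batch i) - 2 * (est_mean i x \<bullet> c) + (norm c)\<^sup>2" for c
  proof -
    have "(\<integral>b. (norm (est i x b - c))\<^sup>2 \<partial>batch i)
        = (\<integral>b. (norm (est i x b))\<^sup>2 - 2 * (est i x b \<bullet> c) + (norm c)\<^sup>2 \<partial>batch i)"
      by (intro Bochner_Integration.integral_cong)
        (auto simp: power2_norm_eq_inner inner_diff_left inner_diff_right inner_commute)
    also have "\<dots> = (\<integral>b. (norm (est i x b))\<^sup>2 \<partial>batch i) - 2 * (est_mean i x \<bullet> c) + (norm c)\<^sup>2"
      using sq int by (simp add: B.prob_space est_mean_def)
    finally show ?thesis .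
  qed
  have "0 \<le> (norm (est_mean i x - gr i x))\<^sup>2" by simp
  then have "(\<integral>b. (norm (est i x b - est_mean i x))\<^sup>2 \<partial>batch i) \<le> (\<integral>b. (norm (est i x b - gr i x))\<^sup>2 \<partial>batch i)"
    unfolding e by (simp add: power2_norm_eq_inner inner_diff_left inner_diff_right inner_commute)
  then show ?thesis
    using est_props(3)[OF assms] by linarith
qed

lemma integrable_AE_bounded:
  fixes f :: "(nat \<times> nat \<times> nat \<times> nat \<Rightarrow> 'x \<times> (real^'r^'p)) \<Rightarrow> real"
  shows "f \<in> borel_measurable Q \<Longrightarrow> AE q in Q. norm (f q) \<le> c \<Longrightarrow> integrable Q f"
  by (rule Q.integrable_const_bound)

text \<open>With \<open>U\<close> and the local iterate frozen, the batch integral of the noise is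
  \<open>est_mean\<close> minus itself.\<close>

lemma noise_orthogonal:
  fixes U :: "_ \<Rightarrow> real^'r^'p"
  assumes kit: "k < K" "i < n" "t < \<tau>" and U[measurable]: "U \<in> borel_measurable Q"
    and bd: "AE q in Q. norm (U q) \<le> c" and off: "off_block k i t U"
  shows "integrable Q (\<lambda>q. U q \<bullet> w k (sc q) i t)" and "(\<integral>q. U q \<bullet> w k (sc q) i t \<partial>Q) = 0"
proof -
  note [measurable] = measurable_est[OF kit(2), unfolded case_prod_beta'] measurable_est_mean[OF kit(2)]
    w_measurable[OF kit] z_measurable[OF kit(1,2) less_imp_le[OF kit(3)]]
  let ?\<psi> = "\<lambda>p. fst (fst p) \<bullet> (est i (snd (fst p)) (snd p) - est_mean i (snd (fst p)))"
  have eq: "U q \<bullet> w k (sc q) i t = ?\<psi> ((U q, z k (sc q) i t), blk k i t q)" for q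
    by (simp add: w_def G_blk)
  have "AE q in Q. norm (U q \<bullet> w k (sc q) i t) \<le> c * (2 * chiG)"
    using bd w_bound[OF kit]
  proof eventually_elim
    case (elim q)
    have "norm (U q) * norm (w k (sc q) i t) \<le> c * (2 * chiG)"
      using elim by (intro mult_mono) (auto intro: order_trans[OF norm_ge_zero])
    then show ?case
      using Cauchy_Schwarz_ineq2[of "U q" "w k (sc q) i t"] by simp
  qed
  then show int: "integrable Q (\<lambda>q. U q \<bullet> w k (sc q) i t)"
    by (intro integrable_AE_bounded) measurable
  have m\<psi>: "?\<psi> \<in> borel_measurable ((borel \<Otimes>\<^sub>M borel) \<Otimes>\<^sub>M batch i)"
  proof -
    have "(\<lambda>p. (snd (fst p), snd p)) \<in> measurable (((borel :: (real^'r^'p) measure) \<Otimes>\<^sub>M borel) \<Otimes>\<^sub>M batch i)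
        (borel \<Otimes>\<^sub>M batch i)"
      by measurable
    from measurable_compose[OF this measurable_est[OF kit(2)]]
    have "(\<lambda>p. est i (snd (fst p)) (snd p)) \<in> borel_measurable (((borel :: (real^'r^'p) measure) \<Otimes>\<^sub>M borel) \<Otimes>\<^sub>M batch i)"
      by simp
    then show ?thesis by measurable
  qed
  have "(\<integral>q. U q \<bullet> w k (sc q) i t \<partial>Q)
      = (\<integral>q. (\<integral>b. ?\<psi> ((U q, z k (sc q) i t), b) \<partial>batch i) \<partial>Q)"
    unfolding eq
  proof (rule off_block_integral[OF kit _ _ m\<psi>])
    show "(\<lambda>q. (U q, z k (sc q) i t)) \<in> measurable Q (borel \<Otimes>\<^sub>M borel)"
      by measurable
    show "off_block k i t (\<lambda>q. (U q, z k (sc q) i t))"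
      using kit off by (intro off_block_Pair off_block_z) auto
    show "integrable Q (\<lambda>q. ?\<psi> ((U q, z k (sc q) i t), blk k i t q))"
      using int unfolding eq .
  qed
  also have "\<dots> = (\<integral>q. 0 \<partial>Q)"
  proof (intro Bochner_Integration.integral_cong refl)
    fix q
    interpret B: prob_space "batch i" by (rule prob_batch[OF kit(2)])
    have "integrable (batch i) (est i (z k (sc q) i t))"
      by (rule est_integrable[OF kit(2) z_in])
    then show "(\<integral>b. ?\<psi> ((U q, z k (sc q) i t), b) \<partial>batch i) = 0"
      by (simp add: B.prob_space est_mean_def[symmetric])
  qed
  finally show "(\<integral>q. U q \<bullet> w k (sc q) i t \<partial>Q) = 0" by simp
qed

lemma noise_variance:
  assumes kit: "k < K" "i < n" "t < \<tau>"
  shows "(\<integral>q. w k (sc q) i t \<bullet> w k (sc q) i t \<partial>Q) \<le> V"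
proof -
  note [measurable] = measurable_est[OF kit(2), unfolded case_prod_beta'] measurable_est_mean[OF kit(2)]
    w_measurable[OF kit] z_measurable[OF kit(1,2) less_imp_le[OF kit(3)]]
  let ?\<psi> = "\<lambda>p. (norm (est i (fst p) (snd p) - est_mean i (fst p)))\<^sup>2"
  have eq: "w k (sc q) i t \<bullet> w k (sc q) i t = ?\<psi> (z k (sc q) i t, blk k i t q)" for q
    by (simp add: w_def G_blk power2_norm_eq_inner)
  have "AE q in Q. norm (w k (sc q) i t \<bullet> w k (sc q) i t) \<le> (2 * chiG)\<^sup>2"
    using w_bound[OF kit]
  proof eventually_elim
    case (elim q)
    show ?case
      using power_mono[OF elim norm_ge_zero, of 2] by (simp add: power2_norm_eq_inner)
  qed
  then have int: "integrable Q (\<lambda>q. w k (sc q) i t \<bullet> w k (sc q) i t)"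
    by (intro integrable_AE_bounded) measurable
  have "(\<integral>q. w k (sc q) i t \<bullet> w k (sc q) i t \<partial>Q)
      = (\<integral>q. (\<integral>b. ?\<psi> (z k (sc q) i t, b) \<partial>batch i) \<partial>Q)"
    unfolding eq
  proof (rule off_block_integral[OF kit _ off_block_z])
    show "?\<psi> \<in> borel_measurable (borel \<Otimes>\<^sub>M batch i)"
      by measurable
    show "integrable Q (\<lambda>q. ?\<psi> (z k (sc q) i t, blk k i t q))"
      using int unfolding eq .
  qed (use kit in auto)
  also have "\<dots> \<le> V"
    using est_variance[OF kit(2) z_in]
    by (intro prob_integral_mono_const[OF Q.prob_space_axioms] V_nonneg) auto
  finally show ?thesis .
qed

text \<open>Of two distinct noises one is always off the block of the other: either one for
  different clients, the earlier one for the same client. The noise whose block is avoided is then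
  integrated out.\<close>

lemma noise_inner:
  assumes "k < K" "p \<in> {..<n} \<times> {..<\<tau>}" "p' \<in> {..<n} \<times> {..<\<tau>}"
  defines "v \<equiv> \<lambda>q p. w k (sc q) (fst p) (snd p)"
  shows "integrable Q (\<lambda>q. v q p \<bullet> v q p')"
    and "(\<integral>q. v q p \<bullet> v q p' \<partial>Q) \<le> (if p = p' then V else 0)"
proof -
  have p: "fst p < n" "snd p < \<tau>" "fst p' < n" "snd p' < \<tau>"
    using assms(2,3) by auto
  have m: "(\<lambda>q. v q p) \<in> borel_measurable Q" "(\<lambda>q. v q p') \<in> borel_measurable Q"
    unfolding v_def using p assms(1) by (auto intro: w_measurable)
  have bd: "AE q in Q. norm (v q p) \<le> 2 * chiG" "AE q in Q. norm (v q p') \<le> 2 * chiG"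
    unfolding v_def using p assms(1) by (auto intro: w_bound)
  have "AE q in Q. norm (v q p \<bullet> v q p') \<le> 2 * chiG * (2 * chiG)"
    using bd
  proof eventually_elim
    case (elim q)
    have "norm (v q p) * norm (v q p') \<le> 2 * chiG * (2 * chiG)"
      using elim chiG_nonneg by (intro mult_mono) auto
    then show ?case
      using Cauchy_Schwarz_ineq2[of "v q p" "v q p'"] by simp
  qed
  then show "integrable Q (\<lambda>q. v q p \<bullet> v q p')"
    using m by (intro integrable_AE_bounded) auto
  consider "p = p'" | "fst p \<noteq> fst p' \<or> snd p < snd p'" "p \<noteq> p'" | "fst p' \<noteq> fst p \<or> snd p' < snd p" "p \<noteq> p'"
    by (metis linorder_neqE_nat prod_eqI)
  then show "(\<integral>q. v q p \<bullet> v q p' \<partial>Q) \<le> (if p = p' then V else 0)"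
  proof cases
    case 1
    then show ?thesis
      using noise_variance[OF assms(1) p(1,2)] by (simp add: v_def)
  next
    case 2
    have "(\<integral>q. v q p \<bullet> w k (sc q) (fst p') (snd p') \<partial>Q) = 0"
      by (rule noise_orthogonal(2)[OF assms(1) p(3,4) m(1) bd(1)])
        (use 2 p assms(1) in \<open>simp add: v_def off_block_w\<close>)
    then show ?thesis
      using 2 by (simp add: v_def)
  next
    case 3
    have "(\<integral>q. v q p' \<bullet> w k (sc q) (fst p) (snd p) \<partial>Q) = 0"
      by (rule noise_orthogonal(2)[OF assms(1) p(1,2) m(2) bd(2)])
        (use 3 p assms(1) in \<open>simp add: v_def off_block_w\<close>)
    then show ?thesis
      using 3 by (simp add: v_def inner_commute)
  qed
qed

lemma noise_sum_variance:
  assumes "k < K" and J: "J \<subseteq> {..<n} \<times> {..<\<tau>}"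
  shows "integrable Q (\<lambda>q. (norm (\<Sum>p\<in>J. w k (sc q) (fst p) (snd p)))\<^sup>2)"
    and "(\<integral>q. (norm (\<Sum>p\<in>J. w k (sc q) (fst p) (snd p)))\<^sup>2 \<partial>Q) \<le> real (card J) * V"
proof -
  have fin: "finite J"
    using J by (rule finite_subset) auto
  have eq: "(norm (\<Sum>p\<in>J. w k (sc q) (fst p) (snd p)))\<^sup>2
      = (\<Sum>p\<in>J. \<Sum>p'\<in>J. w k (sc q) (fst p) (snd p) \<bullet> w k (sc q) (fst p') (snd p'))" for q
    by (simp add: power2_norm_eq_inner inner_sum_left inner_sum_right) (rule sum.swap)
  note ni = noise_inner[OF assms(1) subsetD[OF J] subsetD[OF J]]
  show "integrable Q (\<lambda>q. (norm (\<Sum>p\<in>J. w k (sc q) (fst p) (snd p)))\<^sup>2)"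
    unfolding eq using ni(1) by (intro Bochner_Integration.integrable_sum) auto
  have "(\<integral>q. (norm (\<Sum>p\<in>J. w k (sc q) (fst p) (snd p)))\<^sup>2 \<partial>Q)
      = (\<Sum>p\<in>J. \<Sum>p'\<in>J. (\<integral>q. w k (sc q) (fst p) (snd p) \<bullet> w k (sc q) (fst p') (snd p') \<partial>Q))"
  proof -
    have "(\<integral>q. (norm (\<Sum>p\<in>J. w k (sc q) (fst p) (snd p)))\<^sup>2 \<partial>Q)
        = (\<Sum>p\<in>J. (\<integral>q. (\<Sum>p'\<in>J. w k (sc q) (fst p) (snd p) \<bullet> w k (sc q) (fst p') (snd p')) \<partial>Q))"
      unfolding eq by (intro Bochner_Integration.integral_sum Bochner_Integration.integrable_sum ni(1))
    also have "\<dots> = (\<Sum>p\<in>J. \<Sum>p'\<in>J. (\<integral>q. w k (sc q) (fst p) (snd p) \<bullet> w k (sc q) (fst p') (snd p') \<partial>Q))"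
      by (intro sum.cong refl Bochner_Integration.integral_sum ni(1))
    finally show ?thesis .
  qed
  also have "\<dots> \<le> (\<Sum>p\<in>J. \<Sum>p'\<in>J. if p = p' then V else 0)"
    using ni(2) by (intro sum_mono) auto
  also have "\<dots> = real (card J) * V"
    using fin by (simp add: sum.delta)
  finally show "(\<integral>q. (norm (\<Sum>p\<in>J. w k (sc q) (fst p) (snd p)))\<^sup>2 \<partial>Q) \<le> real (card J) * V" .
qed

end

section \<open>Expected decrease\<close>

context zo_fed
begin

section \<open>Expectations of the noise terms\<close>

lemma noise_mean_eq:
  "noise_mean k s = (1 / (real n * real \<tau>)) *\<^sub>R (\<Sum>p\<in>{..<n} \<times> {..<\<tau>}. w k s (fst p) (snd p))"
  by (simp add: noise_mean_def sum.cartesian_product case_prod_beta' scaleR_sum_right[symmetric])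

lemma noise_mean_variance:
  assumes "k < K"
  shows "integrable Q (\<lambda>q. (norm (noise_mean k (sc q)))\<^sup>2)"
    and "(\<integral>q. (norm (noise_mean k (sc q)))\<^sup>2 \<partial>Q) \<le> V / (real n * real \<tau>)"
proof -
  let ?J = "{..<n} \<times> {..<\<tau>}"
  have eq: "(norm (noise_mean k s))\<^sup>2
      = 1 / (real n * real \<tau>)\<^sup>2 * (norm (\<Sum>p\<in>?J. w k s (fst p) (snd p)))\<^sup>2" for s
    by (simp add: noise_mean_eq power_divide)
  note nv = noise_sum_variance[OF assms, of ?J]
  show "integrable Q (\<lambda>q. (norm (noise_mean k (sc q)))\<^sup>2)"
    unfolding eq using nv(1) by simp
  have "(\<integral>q. (norm (noise_mean k (sc q)))\<^sup>2 \<partial>Q) \<le> 1 / (real n * real \<tau>)\<^sup>2 * (real (card ?J) * V)"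
    unfolding eq integral_mult_right_zero using nv(2) by (intro mult_left_mono) auto
  also have "\<dots> = V / (real n * real \<tau>)"
    using pos by (simp add: power2_eq_square)
  finally show "(\<integral>q. (norm (noise_mean k (sc q)))\<^sup>2 \<partial>Q) \<le> V / (real n * real \<tau>)" .
qed

lemma client_sum_variance:
  assumes "k < K" "i < n" "t \<le> \<tau>"
  shows "integrable Q (\<lambda>q. (norm (\<Sum>l<t. w k (sc q) i l))\<^sup>2)"
    and "(\<integral>q. (norm (\<Sum>l<t. w k (sc q) i l))\<^sup>2 \<partial>Q) \<le> real t * V"
proof -
  have eq: "(\<Sum>l<t. w k s i l) = (\<Sum>p\<in>{i} \<times> {..<t}. w k s (fst p) (snd p))" for s
    using sum.cartesian_product[of "\<lambda>i l. w k s i l" "{..<t}" "{i}"] by (simp add: case_prod_beta')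
  have "{i} \<times> {..<t} \<subseteq> {..<n} \<times> {..<\<tau>}"
    using assms by auto
  from noise_sum_variance[OF assms(1) this]
  show "integrable Q (\<lambda>q. (norm (\<Sum>l<t. w k (sc q) i l))\<^sup>2)"
    "(\<integral>q. (norm (\<Sum>l<t. w k (sc q) i l))\<^sup>2 \<partial>Q) \<le> real t * V"
    unfolding eq by simp_all
qed

lemma noise_client_expectation:
  assumes "k < K"
  shows "integrable Q (\<lambda>q. noise_client k (sc q))" and "(\<integral>q. noise_client k (sc q) \<partial>Q) \<le> V / real \<tau>"
proof -
  have eq: "noise_client k s = (1 / real n) * (\<Sum>i<n. 1 / (real \<tau>)\<^sup>2 * (norm (\<Sum>t<\<tau>. w k s i t))\<^sup>2)" for s
    by (simp add: noise_client_def power_divide)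
  note cv = client_sum_variance[OF assms]
  show "integrable Q (\<lambda>q. noise_client k (sc q))"
    unfolding eq using cv(1) by (intro integrable_mult_right Bochner_Integration.integrable_sum) auto
  have "(\<integral>q. noise_client k (sc q) \<partial>Q)
      = (1 / real n) * (\<Sum>i<n. 1 / (real \<tau>)\<^sup>2 * (\<integral>q. (norm (\<Sum>t<\<tau>. w k (sc q) i t))\<^sup>2 \<partial>Q))"
    unfolding eq using cv(1) by (simp add: Bochner_Integration.integral_sum)
  also have "\<dots> \<le> (1 / real n) * (\<Sum>i<n. 1 / (real \<tau>)\<^sup>2 * (real \<tau> * V))"
    using cv(2) by (intro mult_left_mono sum_mono) auto
  also have "\<dots> = V / real \<tau>"
    using pos by (simp add: power2_eq_square)
  finally show "(\<integral>q. noise_client k (sc q) \<partial>Q) \<le> V / real \<tau>" .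
qed

lemma noise_partial_expectation:
  assumes "k < K"
  shows "integrable Q (\<lambda>q. noise_partial k (sc q))" and "(\<integral>q. noise_partial k (sc q) \<partial>Q) \<le> V / real \<tau>"
proof -
  note cv = client_sum_variance[OF assms _ less_imp_le]
  have int: "integrable Q (\<lambda>q. \<Sum>t<\<tau>. (norm (\<Sum>l<t. w k (sc q) i l))\<^sup>2)" if "i < n" for i
    using cv(1) that by (intro Bochner_Integration.integrable_sum) auto
  show "integrable Q (\<lambda>q. noise_partial k (sc q))"
    unfolding noise_partial_def
    by (intro integrable_mult_right Bochner_Integration.integrable_sum int) auto
  have 1: "(\<integral>q. (\<Sum>t<\<tau>. (norm (\<Sum>l<t. w k (sc q) i l))\<^sup>2) \<partial>Q) \<le> real \<tau> * (real \<tau> * V)" if i: "i < n" for i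
  proof -
    have "(\<integral>q. (\<Sum>t<\<tau>. (norm (\<Sum>l<t. w k (sc q) i l))\<^sup>2) \<partial>Q) = (\<Sum>t<\<tau>. (\<integral>q. (norm (\<Sum>l<t. w k (sc q) i l))\<^sup>2 \<partial>Q))"
      using cv(1) i by (intro Bochner_Integration.integral_sum) auto
    also have "\<dots> \<le> (\<Sum>t<\<tau>. real \<tau> * V)"
    proof (intro sum_mono)
      fix t assume "t \<in> {..<\<tau>}"
      then show "(\<integral>q. (norm (\<Sum>l<t. w k (sc q) i l))\<^sup>2 \<partial>Q) \<le> real \<tau> * V"
        \<comment> \<open>The partial sum up to \<open>t\<close> has variance at most
          \<open>real t * V\<close>, crudely replaced by \<open>real \<tau> * V\<close>.\<close>
        using cv(2)[OF i, of t] V_nonneg mult_right_mono[of "real t" "real \<tau>" V] by auto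
    qed
    finally show ?thesis by simp
  qed
  have "(\<integral>q. noise_partial k (sc q) \<partial>Q)
      = (1 / real n) * (\<Sum>i<n. (1 / real \<tau> ^ 3) * (\<integral>q. (\<Sum>t<\<tau>. (norm (\<Sum>l<t. w k (sc q) i l))\<^sup>2) \<partial>Q))"
    unfolding noise_partial_def integral_mult_right_zero using int
    by (subst Bochner_Integration.integral_sum) auto
  also have "\<dots> \<le> (1 / real n) * (\<Sum>i<n. (1 / real \<tau> ^ 3) * (real \<tau> * (real \<tau> * V)))"
    using 1 by (intro mult_left_mono sum_mono) auto
  also have "\<dots> = V / real \<tau>"
    using pos by (simp add: power3_eq_cube)
  finally show "(\<integral>q. noise_partial k (sc q) \<partial>Q) \<le> V / real \<tau>" .
qed

section \<open>Integrability of the terms of the round inequality\<close>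

lemma closed_S: "closed S"
  using compact by (rule compact_imp_closed)

lemma continuous_on_gr: "i < n \<Longrightarrow> continuous_on S (gr i)"
proof -
  assume i: "i < n"
  have "lipschitz_on L S (gr i)"
    using gr_lipschitz[OF i] L_pos by (intro lipschitz_onI) (auto simp: dist_norm)
  then show ?thesis by (rule lipschitz_on_continuous_on)
qed

lemma continuous_on_f: "continuous_on S (global_obj n D F)"
  using client_oracle unfolding global_obj_def oracle_assm_def
  by (intro continuous_intros continuous_at_imp_continuous_on ballI differentiable_imp_continuous_within)
    (use pos in auto)

lemma gr_Y_measurable: "k \<le> K \<Longrightarrow> i < n \<Longrightarrow> (\<lambda>q. gr i (Y k (sc q))) \<in> borel_measurable Q"
  by (intro measurable_continuous_on_compose[OF closed_S continuous_on_gr] Y_measurable Y_in)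

lemma gm_Y_measurable: "k \<le> K \<Longrightarrow> (\<lambda>q. gm (Y k (sc q))) \<in> borel_measurable Q"
  unfolding gm_def by (intro borel_measurable_scaleR borel_measurable_sum gr_Y_measurable) auto

lemma f_Y_integrable: "k \<le> K \<Longrightarrow> integrable Q (\<lambda>q. global_obj n D F (Y k (sc q)))"
proof -
  assume k: "k \<le> K"
  have "bounded (global_obj n D F ` S)"
    by (intro compact_imp_bounded compact_continuous_image continuous_on_f compact)
  then obtain B where "\<forall>x\<in>S. norm (global_obj n D F x) \<le> B"
    by (auto simp: bounded_iff)
  then show ?thesis
    using Y_in by (intro integrable_AE_bounded[where c = B] AE_I2
        measurable_continuous_on_compose[OF closed_S continuous_on_f Y_measurable[OF k]]) auto
qed

lemma subopt_Y_integrable: "k \<le> K \<Longrightarrow> integrable Q (\<lambda>q. (subopt (Y k (sc q)))\<^sup>2)"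
proof -
  assume k: "k \<le> K"
  note [measurable] = Y_measurable[OF k] gm_Y_measurable[OF k]
  have "(\<lambda>q. (subopt (Y k (sc q)))\<^sup>2) \<in> borel_measurable Q"
    unfolding subopt_def by measurable
  then show ?thesis
  proof (rule integrable_AE_bounded)
    show "AE q in Q. norm ((subopt (Y k (sc q)))\<^sup>2) \<le> (12 / 11 * chi)\<^sup>2"
      using power_mono[OF subopt_le[OF Y_in] subopt_nonneg, of _ _ 2] by simp
  qed
qed

lemma G_bound_all: "k < K \<Longrightarrow> AE q in Q. \<forall>i<n. \<forall>t<\<tau>. norm (G k (sc q) i t) \<le> chiG"
  using G_bound by (auto simp: AE_all_countable)

lemma C_bound:
  assumes "k \<le> K"
  shows "AE q in Q. \<forall>i<n. norm (C k (sc q) i) \<le> 2 * chiG"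
proof (cases k)
  case 0
  then show ?thesis
    using chiG_nonneg by (simp add: C_0)
next
  case (Suc l)
  then have "l < K" using assms by simp
  from G_bound_all[OF this] show ?thesis
  proof eventually_elim
    case (elim q)
    have Gm: "norm (Gm l (sc q) i) \<le> chiG" if "i < n" for i
      using sum_norm_bound[of "{..<\<tau>}" "G l (sc q) i" chiG] elim that pos by (simp add: Gm_def field_simps)
    have "norm ((1 / real n) *\<^sub>R (\<Sum>i<n. Gm l (sc q) i)) \<le> chiG"
      using sum_norm_bound[of "{..<n}" "Gm l (sc q)" chiG] Gm pos by (simp add: field_simps)
    then show ?case
      unfolding Suc C_Suc using Gm norm_triangle_ineq4 by (smt (verit, best))
  qed
qed

lemma hetero_nonneg: "0 \<le> hetero x c"
  unfolding hetero_def by (intro mult_nonneg_nonneg sum_nonneg) auto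

lemma hetero_integrable:
  assumes k: "k \<le> K"
  shows "integrable Q (\<lambda>q. hetero (Y k (sc q)) (C k (sc q)))"
proof (rule integrable_AE_bounded)
  show "(\<lambda>q. hetero (Y k (sc q)) (C k (sc q))) \<in> borel_measurable Q"
  proof -
    have [measurable]: "(\<lambda>q. gr i (Y k (sc q)) - gm (Y k (sc q)) + C k (sc q) i) \<in> borel_measurable Q"
      if "i \<in> {..<n}" for i
      using that k by (intro borel_measurable_add borel_measurable_diff gr_Y_measurable gm_Y_measurable
          C_measurable) auto
    show ?thesis
      unfolding hetero_def by measurable
  qed
  show "AE q in Q. norm (hetero (Y k (sc q)) (C k (sc q))) \<le> (2 * chi + 2 * chiG)\<^sup>2"
    using C_bound[OF k]
  proof eventually_elim
    case (elim q)
    let ?y = "Y k (sc q)"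
    have "(norm (gr i ?y - gm ?y + C k (sc q) i))\<^sup>2 \<le> (2 * chi + 2 * chiG)\<^sup>2" if "i < n" for i
    proof (rule power_mono)
      have "norm (gr i ?y - gm ?y + C k (sc q) i) \<le> norm (gr i ?y) + norm (gm ?y) + norm (C k (sc q) i)"
        by (meson add_mono norm_triangle_ineq norm_triangle_ineq4 order_refl order_trans)
      then show "norm (gr i ?y - gm ?y + C k (sc q) i) \<le> 2 * chi + 2 * chiG"
        using elim that gr_bound[OF that Y_in, of k "sc q"] norm_gm_le[OF Y_in, of k "sc q"] by fastforce
    qed auto
    then have "(\<Sum>i<n. (norm (gr i ?y - gm ?y + C k (sc q) i))\<^sup>2) \<le> (\<Sum>i<n. (2 * chi + 2 * chiG)\<^sup>2)"
      by (intro sum_mono) auto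
    then have "hetero ?y (C k (sc q)) \<le> (2 * chi + 2 * chiG)\<^sup>2"
      using pos(1) by (simp add: hetero_def field_simps)
    then show ?case
      using hetero_nonneg by simp
  qed
qed

text \<open>The exact step is a function of the state before the round, hence off every block of the
  round and orthogonal to each noise in it.\<close>

lemma cross_expectation:
  assumes k: "k < K"
  shows "integrable Q (\<lambda>q. noise_mean k (sc q) \<bullet> exact_step k (sc q))"
    and "(\<integral>q. noise_mean k (sc q) \<bullet> exact_step k (sc q) \<partial>Q) = 0"
proof -
  have kK: "k \<le> K" using k by simp
  note [measurable] = Y_measurable[OF kK] gm_Y_measurable[OF kK]
  have m: "(\<lambda>q. exact_step k (sc q)) \<in> borel_measurable Q"
    unfolding exact_step_def by measurable
  obtain B where B: "\<forall>x\<in>S. norm x \<le> B"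
    using compact_imp_bounded[OF compact] by (auto simp: bounded_iff)
  have bd: "AE q in Q. norm (exact_step k (sc q)) \<le> B + B"
    unfolding exact_step_def using B P_in Y_in
    by (intro AE_I2 order_trans[OF norm_triangle_ineq4] add_mono) auto
  have off: "off_block k i t (\<lambda>q. exact_step k (sc q))" for i t
    unfolding exact_step_def using k by (rule off_block_Y[of k i t "\<lambda>y. P (y - h *\<^sub>R gm y) - y"])
  note no = noise_orthogonal[OF k _ _ m bd off]
  have eq: "noise_mean k s \<bullet> exact_step k s
      = 1 / (real n * real \<tau>) * (\<Sum>p\<in>{..<n} \<times> {..<\<tau>}. exact_step k s \<bullet> w k s (fst p) (snd p))" for s
    by (simp add: noise_mean_eq inner_commute[of _ "exact_step k s"] inner_sum_right)
  show "integrable Q (\<lambda>q. noise_mean k (sc q) \<bullet> exact_step k (sc q))"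
    unfolding eq using no(1) by (intro integrable_mult_right Bochner_Integration.integrable_sum) auto
  have "(\<integral>q. (\<Sum>p\<in>{..<n} \<times> {..<\<tau>}. exact_step k (sc q) \<bullet> w k (sc q) (fst p) (snd p)) \<partial>Q)
      = (\<Sum>p\<in>{..<n} \<times> {..<\<tau>}. (\<integral>q. exact_step k (sc q) \<bullet> w k (sc q) (fst p) (snd p) \<partial>Q))"
    using no(1) by (intro Bochner_Integration.integral_sum) auto
  also have "\<dots> = 0"
    using no(2) by (intro sum.neutral) auto
  finally show "(\<integral>q. noise_mean k (sc q) \<bullet> exact_step k (sc q) \<partial>Q) = 0"
    unfolding eq by simp
qed

lemma round_expectation:
  assumes k: "k < K" and small: "40 * \<beta> \<le> 3 * chi"
  defines "f \<equiv> \<lambda>k. (\<integral>q. global_obj n D F (Y k (sc q)) \<partial>Q)"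
    and "H \<equiv> \<lambda>k. (\<integral>q. hetero (Y k (sc q)) (C k (sc q)) \<partial>Q)"
  shows "(\<integral>q. (subopt (Y k (sc q)))\<^sup>2 \<partial>Q) \<le> 8 / h * (f k - f (Suc k)) + 8 / real n * (H k - H (Suc k))
    + 64 / (real n * real \<tau>) * V + (15 + 4 / real n) * (chi * \<beta>)"
proof -
  have kK: "k \<le> K" "Suc k \<le> K" using k by auto
  let ?R = "\<lambda>q. 8 / h * (global_obj n D F (Y k (sc q)) - global_obj n D F (Y (Suc k) (sc q)))
    + 8 / real n * (hetero (Y k (sc q)) (C k (sc q)) - hetero (Y (Suc k) (sc q)) (C (Suc k) (sc q)))
    + 198 / 5 * (norm (noise_mean k (sc q)))\<^sup>2 + 16 / real n * noise_client k (sc q)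
    + 61 / 20 / real n * noise_partial k (sc q)
    + (15 + 4 / real n) * (chi * \<beta>) - 8 / h * (noise_mean k (sc q) \<bullet> exact_step k (sc q))"
  note int = f_Y_integrable[OF kK(1)] f_Y_integrable[OF kK(2)] hetero_integrable[OF kK(1)]
    hetero_integrable[OF kK(2)] noise_mean_variance(1)[OF k] noise_client_expectation(1)[OF k]
    noise_partial_expectation(1)[OF k] cross_expectation(1)[OF k]
  have "(\<integral>q. (subopt (Y k (sc q)))\<^sup>2 \<partial>Q) \<le> (\<integral>q. ?R q \<partial>Q)"
  proof (rule integral_mono_AE)
    show "AE q in Q. (subopt (Y k (sc q)))\<^sup>2 \<le> ?R q"
      using G_bound_all[OF k] by eventually_elim (intro round_inequality_at small, auto)
  qed (use int subopt_Y_integrable[OF kK(1)] in auto)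
  also have "\<dots> = 8 / h * (f k - f (Suc k)) + 8 / real n * (H k - H (Suc k))
    + 198 / 5 * (\<integral>q. (norm (noise_mean k (sc q)))\<^sup>2 \<partial>Q) + 16 / real n * (\<integral>q. noise_client k (sc q) \<partial>Q)
    + 61 / 20 / real n * (\<integral>q. noise_partial k (sc q) \<partial>Q) + (15 + 4 / real n) * (chi * \<beta>)"
    using int cross_expectation(2)[OF k] by (simp add: f_def H_def Q.prob_space)
  also have "\<dots> \<le> 8 / h * (f k - f (Suc k)) + 8 / real n * (H k - H (Suc k))
    + 198 / 5 * (V / (real n * real \<tau>)) + 16 / real n * (V / real \<tau>)
    + 61 / 20 / real n * (V / real \<tau>) + (15 + 4 / real n) * (chi * \<beta>)"
    by (intro add_mono mult_left_mono order_refl noise_mean_variance(2) noise_client_expectation(2)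
        noise_partial_expectation(2) k) auto
  finally have "(\<integral>q. (subopt (Y k (sc q)))\<^sup>2 \<partial>Q) \<le> 8 / h * (f k - f (Suc k)) + 8 / real n * (H k - H (Suc k))
    + 198 / 5 * (V / (real n * real \<tau>)) + 16 / real n * (V / real \<tau>)
    + 61 / 20 / real n * (V / real \<tau>) + (15 + 4 / real n) * (chi * \<beta>)" .
  \<comment> \<open>The three noise coefficients sum to 58.65, which is below 64.\<close>
  moreover have "198 / 5 * (V / (real n * real \<tau>)) + 16 / real n * (V / real \<tau>) + 61 / 20 / real n * (V / real \<tau>)
      \<le> 64 / (real n * real \<tau>) * V"
    using V_nonneg pos by (simp add: field_simps)
  ultimately show ?thesis by linarith
qed

theorem expected_subopt_le:
  "(\<integral>q. (\<Sum>k<K. (subopt (Y k (sc q)))\<^sup>2) / real K \<partial>Q)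
    \<le> 8 * Omega1 S P D F n \<tau> \<eta> (sqrt (real n)) x1 / (sqrt (real n) * \<eta> * real \<tau> * real K)
      + 64 / (real n * real \<tau>) * V + 16 * (3 + real n) * (chiG + chi) * chif / real n * \<mu>"
proof -
  let ?f = "global_obj n D F"
  let ?gap = "?f (P x1) - (INF x\<in>S. ?f x)"
  let ?het = "hetero (P x1) (\<lambda>_. 0)"
  have f_lower: "(INF x\<in>S. ?f x) \<le> ?f y" if "y \<in> S" for y
    using that by (intro cINF_lower bounded_imp_bdd_below compact_imp_bounded compact_continuous_image
        continuous_on_f compact)
  \<comment> \<open>Since
    \<open>h\<^sup>2 = real n * \<eta>\<^sup>2 * (real \<tau>)\<^sup>2\<close>, the weight of the
    heterogeneity in the initialization constant is exactly the \<open>h / real n\<close> required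
    by the Lyapunov function, after division by \<open>h\<close>.\<close>
  have "(real n * h) * (\<eta>\<^sup>2 * (real \<tau>)\<^sup>2) = h * h\<^sup>2"
    using pos by (simp add: h_def power_mult_distrib)
  then have coeff: "\<eta>\<^sup>2 * (real \<tau>)\<^sup>2 / (real n * h) = h / real n * (1 / real n)"
    using pos h_pos by (simp add: h_def field_simps power2_eq_square)
  have Om: "Omega1 S P D F n \<tau> \<eta> (sqrt (real n)) x1 = ?gap + h / real n * ?het"
    using coeff by (simp add: Omega1_def Let_def hetero_def gm_eq[OF P_in] h_def mult.assoc)
  have \<Omega>: "8 * Omega1 S P D F n \<tau> \<eta> (sqrt (real n)) x1 / (sqrt (real n) * \<eta> * real \<tau> * real K)
      = (8 / h * ?gap + 8 / real n * ?het) / real K"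
    unfolding Om h_def[symmetric] using h_pos pos by (simp add: field_simps)
  have f0: "0 \<le> ?gap"
    using f_lower[OF P_in] by simp
  define T where "T = 16 * (3 + real n) * (chiG + chi) * chif / real n * \<mu>"
  have T: "T = (16 + 48 / real n) * ((chiG + chi) * \<beta>)"
    using pos(1) by (simp add: T_def \<beta>_def field_simps)
  have cb: "0 \<le> chi * \<beta>" "chi * \<beta> \<le> (chiG + chi) * \<beta>"
    using chi_pos beta_nonneg chiG_nonneg by (auto intro: mult_right_mono)
  have "4 / real n \<le> 48 / real n"
    by (rule divide_right_mono) auto
  \<comment> \<open>The factor \<open>16 * (3 + real n) / real n\<close> equals
    \<open>16 + 48 / real n\<close>. It dominates both the bias coefficient of a round and the 16
    needed when the bias is large.\<close>
  then have T_ge: "(15 + 4 / real n) * (chi * \<beta>) \<le> T" "16 * (chi * \<beta>) \<le> T"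
    unfolding T by (intro mult_mono[OF _ cb(2)] add_mono; use cb(1) in simp)+
  have int: "integrable Q (\<lambda>q. (subopt (Y k (sc q)))\<^sup>2)" if "k < K" for k
    using that by (intro subopt_Y_integrable) simp
  have "(\<Sum>k<K. (\<integral>q. (subopt (Y k (sc q)))\<^sup>2 \<partial>Q))
      \<le> 8 / h * ?gap + 8 / real n * ?het + real K * (64 / (real n * real \<tau>) * V + T)"
  proof (cases "40 * \<beta> \<le> 3 * chi")
    case True
    define f where "f k = (\<integral>q. ?f (Y k (sc q)) \<partial>Q)" for k
    define H where "H k = (\<integral>q. hetero (Y k (sc q)) (C k (sc q)) \<partial>Q)" for k
    have "(\<Sum>k<K. (\<integral>q. (subopt (Y k (sc q)))\<^sup>2 \<partial>Q))
        \<le> (\<Sum>k<K. 8 / h * (f k - f (Suc k)) + 8 / real n * (H k - H (Suc k))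
          + (64 / (real n * real \<tau>) * V + T))"
    proof (intro sum_mono)
      fix k assume "k \<in> {..<K}"
      then show "(\<integral>q. (subopt (Y k (sc q)))\<^sup>2 \<partial>Q) \<le> 8 / h * (f k - f (Suc k)) + 8 / real n * (H k - H (Suc k))
          + (64 / (real n * real \<tau>) * V + T)"
        using round_expectation[OF _ True, of k] T_ge(1) by (simp add: f_def H_def)
    qed
    also have "\<dots> = 8 / h * (f 0 - f K) + 8 / real n * (H 0 - H K) + real K * (64 / (real n * real \<tau>) * V + T)"
      by (simp only: sum.distrib sum_distrib_left[symmetric] sum_lessThan_telescope' sum_constant card_lessThan)
        (simp add: distrib_left)
    also have "\<dots> \<le> 8 / h * ?gap + 8 / real n * ?het + real K * (64 / (real n * real \<tau>) * V + T)"
    proof (intro add_mono mult_left_mono order_refl)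
      have "f 0 = ?f (P x1)"
        by (simp add: f_def Y_def server_iterate_def Q.prob_space)
      moreover have "(INF x\<in>S. ?f x) \<le> f K"
        unfolding f_def
        using integral_mono[OF _ f_Y_integrable[of K], of "\<lambda>_. INF x\<in>S. ?f x"] f_lower[OF Y_in]
        by (simp add: Q.prob_space)
      ultimately show "f 0 - f K \<le> ?gap" by simp
      have "H 0 = ?het"
        by (simp add: H_def Y_def C_0 server_iterate_def Q.prob_space hetero_def)
      moreover have "0 \<le> H K"
        unfolding H_def by (intro Bochner_Integration.integral_nonneg hetero_nonneg)
      ultimately show "H 0 - H K \<le> ?het" by simp
    qed (use h_pos in auto)
    finally show ?thesis .
  next
    case False
    have "(subopt (Y k s))\<^sup>2 \<le> T" for k s
    proof -
      have "(subopt (Y k s))\<^sup>2 \<le> (12 / 11 * chi)\<^sup>2"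
        by (intro power_mono subopt_le Y_in subopt_nonneg)
      \<comment> \<open>Here the threshold 3/40 is almost tight: (12/11)^2 is about 1.19, against 16
        * 3/40 = 1.2.\<close>
      also have "\<dots> \<le> 16 * (chi * (3 / 40 * chi))"
        by (simp add: power2_eq_square)
      also have "\<dots> \<le> 16 * (chi * \<beta>)"
        using False chi_pos by (intro mult_left_mono) auto
      finally show ?thesis using T_ge(2) by simp
    qed
    then have "(\<integral>q. (subopt (Y k (sc q)))\<^sup>2 \<partial>Q) \<le> T" for k
      using T_ge(2) cb by (intro prob_integral_mono_const Q.prob_space_axioms) auto
    then have "(\<Sum>k<K. (\<integral>q. (subopt (Y k (sc q)))\<^sup>2 \<partial>Q)) \<le> (\<Sum>k<K. T)"
      by (intro sum_mono)
    moreover have "0 \<le> 8 / h * ?gap + 8 / real n * ?het + real K * (64 / (real n * real \<tau>) * V)"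
      using f0 h_pos hetero_nonneg[of "P x1" "\<lambda>_. 0"] V_nonneg
      by (intro add_nonneg_nonneg mult_nonneg_nonneg) auto
    ultimately show ?thesis by (simp add: distrib_left)
  qed
  then have "(\<integral>q. (\<Sum>k<K. (subopt (Y k (sc q)))\<^sup>2) / real K \<partial>Q)
      \<le> (8 / h * ?gap + 8 / real n * ?het + real K * (64 / (real n * real \<tau>) * V + T)) / real K"
    using int by (simp add: Bochner_Integration.integral_sum divide_right_mono)
  also have "\<dots> = (8 / h * ?gap + 8 / real n * ?het) / real K + (64 / (real n * real \<tau>) * V + T)"
    using pos(4) by (simp add: add_divide_distrib)
  finally show ?thesis
    unfolding \<Omega> T_def by simp
qed

end

section \<open>Transfer to the given samples and the rate\<close>

lemma (in zo_fed) mean_subopt_eq: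
  assumes "\<And>k i t j. k < K \<Longrightarrow> i < n \<Longrightarrow> t < \<tau> \<Longrightarrow> j < m \<Longrightarrow> s k i t j = s' k i t j"
  shows "mean_subopt S P D F n \<tau> m K \<mu> \<eta> (sqrt (real n)) x1 s = (\<Sum>k<K. (subopt (Y k s'))\<^sup>2) / real K"
proof -
  have "server_iterate P F n \<tau> m \<mu> \<eta> (sqrt (real n)) x1 s k = server_iterate P F n \<tau> m \<mu> \<eta> (sqrt (real n)) x1 s' k"
    if "k < K" for k
    unfolding server_iterate_def using assms that
    by (intro fed_state_cong[THEN conjunct1]) auto
  then have "(norm (grad_map S P (global_obj n D F) h (P (server_iterate P F n \<tau> m \<mu> \<eta> (sqrt (real n)) x1 s k))))\<^sup>2
      = (subopt (Y k s'))\<^sup>2" if "k < K" for k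
    using that norm_grad_map[OF Y_in, of k s'] by (simp add: Y_def)
  then show ?thesis
    by (simp add: mean_subopt_def h_def[symmetric])
qed

text \<open>The algorithm reads finitely many samples, so its suboptimality factors through the map
  \<open>q\<close> that collects them. Independence and the prescribed marginals say that the law of
  \<open>q\<close> is the product measure for which the bound is known.\<close>

lemma zo_fed_run_bound:
  fixes S :: "(real^'r^'p) set" and P :: "real^'r^'p \<Rightarrow> real^'r^'p"
    and D :: "nat \<Rightarrow> 'x measure" and W :: "'w measure" and x1 :: "real^'r^'p"
  assumes "compact S" "smooth_submanifold S" "0 < \<gamma>" "projection_on S P" "0 < chi" "0 < L" "0 < M"
    and "\<forall>x\<in>S. \<forall>u. norm (P (x + u) - x) \<le> M * norm u" and "is_max_D2 S P \<gamma> LP"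
    and run: "zo_fed_run S P \<gamma> \<sigma> chi L chiG chif chi1 chi2 n \<tau> m K \<mu> \<eta> D F W Z"
    and "step_size_cond M L \<gamma> chiG chi LP (sqrt (real n) * \<eta> * real \<tau>)"
  defines "subopt \<equiv> \<lambda>\<omega>. mean_subopt S P D F n \<tau> m K \<mu> \<eta> (sqrt (real n)) x1 (\<lambda>k i t j. Z k i t j \<omega>)"
  shows "integrable W subopt"
    and "(\<integral>\<omega>. subopt \<omega> \<partial>W)
      \<le> 8 * Omega1 S P D F n \<tau> \<eta> (sqrt (real n)) x1 / (sqrt (real n) * \<eta> * real \<tau> * real K)
        + 64 / (real n * real \<tau>) * (chi1 * \<mu>\<^sup>2 + chi2 / real m)
        + 16 * (3 + real n) * (chiG + chi) * chif / real n * \<mu>"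
    and "0 \<le> chiG" and "0 \<le> chif"
proof -
  interpret A: zo_fed S P \<gamma> LP \<sigma> chi L M chiG chif chi1 chi2 \<mu> \<eta> n \<tau> m K D F x1
    by unfold_locales (use assms in \<open>auto simp: zo_fed_run_def\<close>)
  show "0 \<le> chiG" by (rule A.chiG_nonneg)
  show "0 \<le> chif"
    using A.beta_nonneg A.pos(5) by (simp add: A.\<beta>_def zero_le_mult_iff)
  have samp: "sampling W D n \<tau> m K Z"
    using run by (simp add: zo_fed_run_def)
  then interpret W: prob_space W by (simp add: sampling_def)
  define X where "X = (\<lambda>(k, i, t, j). Z k i t j)"
  define q where "q = (\<lambda>\<omega>. \<lambda>idx\<in>A.I. X idx \<omega>)"
  have ind: "W.indep_vars A.law X A.I"
    using samp by (simp add: sampling_def A.law_def A.I_def X_def)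
  have rv: "W.random_variable (A.law idx) (X idx)" if "idx \<in> A.I" for idx
    using ind that by (simp add: W.indep_vars_def)
  have q: "q \<in> measurable W A.Q"
    unfolding q_def A.Q_def using rv by (intro measurable_restrict) auto
  have "A.I \<noteq> {}"
    using A.pos by (auto simp: A.I_def)
  have "distr W A.Q q = PiM A.I (\<lambda>idx. distr W (A.law idx) (X idx))"
    using W.indep_vars_iff_distr_eq_PiM'[OF \<open>A.I \<noteq> {}\<close> rv] ind by (simp add: A.Q_def q_def)
  also have "\<dots> = A.Q"
    unfolding A.Q_def using samp
    by (intro PiM_cong) (auto simp: sampling_def A.law_def A.I_def X_def)
  finally have dq: "distr W A.Q q = A.Q" .
  let ?\<phi> = "\<lambda>q. (\<Sum>k<K. (A.subopt (A.Y k (A.sc q)))\<^sup>2) / real K"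
  have eq: "subopt \<omega> = ?\<phi> (q \<omega>)" for \<omega>
    unfolding subopt_def by (rule A.mean_subopt_eq) (simp add: A.sc_def q_def A.I_def X_def)
  have int: "integrable A.Q ?\<phi>"
    using A.subopt_Y_integrable by (intro integrable_divide Bochner_Integration.integrable_sum) auto
  have "integrable (distr W A.Q q) ?\<phi>"
    unfolding dq by (rule int)
  then show "integrable W subopt"
    unfolding eq[abs_def] by (rule integrable_distr[OF q])
  have "(\<integral>\<omega>. subopt \<omega> \<partial>W) = (\<integral>q. ?\<phi> q \<partial>distr W A.Q q)"
    unfolding eq using borel_measurable_integrable[OF int] q by (subst integral_distr) auto
  also have "\<dots> = (\<integral>q. ?\<phi> q \<partial>A.Q)"
    unfolding dq ..
  finally show "(\<integral>\<omega>. subopt \<omega> \<partial>W)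
      \<le> 8 * Omega1 S P D F n \<tau> \<eta> (sqrt (real n)) x1 / (sqrt (real n) * \<eta> * real \<tau> * real K)
        + 64 / (real n * real \<tau>) * (chi1 * \<mu>\<^sup>2 + chi2 / real m)
        + 16 * (3 + real n) * (chiG + chi) * chif / real n * \<mu>"
    using A.expected_subopt_le by (simp add: A.V_def)
qed

text \<open>Absolute values appear in the constant because \<open>a\<close>, \<open>b\<close> and
  \<open>c\<close> come without a sign. The \<open>chi2\<close> term is charged to
  \<open>r'\<close>, all others to \<open>r\<close>, using
  \<open>1 / (real n * real \<tau> * real K) \<le> r\<close> from
  \<open>sqrt (real n) \<le> real n\<close>.\<close>

lemma rate_of_bound:
  fixes N \<Omega> \<eta> \<mu> chi chiG chif chi1 chi2 \<sigma> a b c :: real and n \<tau> m K :: nat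
  assumes pos: "0 < n" "0 < \<tau>" "0 < m" "0 < K" "0 < \<mu>" "0 < \<eta>" "0 < N" "0 < chi"
    and nonneg: "0 \<le> chiG" "0 \<le> chif"
    and G: "chiG \<le> a * N" and f: "chif \<le> a * N" and 1: "chi1 \<le> a * N\<^sup>2" and 2: "chi2 \<le> a * (N\<^sup>2 + \<sigma>\<^sup>2)"
    and b: "\<Omega> / \<eta> \<le> b" and c: "\<mu> \<le> c / (N * real n * real \<tau> * real K)"
  defines "r \<equiv> 1 / (sqrt (real n) * real \<tau> * real K)" and "r' \<equiv> 1 / (real n * real \<tau> * real m)"
  shows "8 * \<Omega> / (sqrt (real n) * \<eta> * real \<tau> * real K)
      + 64 / (real n * real \<tau>) * (chi1 * \<mu>\<^sup>2 + chi2 / real m)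
      + 16 * (3 + real n) * (chiG + chi) * chif / real n * \<mu>
    \<le> (8 * \<bar>b\<bar> + 64 * \<bar>a\<bar> * c\<^sup>2 + 64 * \<bar>a\<bar> * (N\<^sup>2 + \<sigma>\<^sup>2) + 64 * (\<bar>a\<bar> * N + chi) * \<bar>a\<bar> * \<bar>c\<bar>) * (r + r')"
proof -
  have n1: "1 \<le> real n" "1 \<le> real \<tau>" "1 \<le> real K"
    using pos by auto
  have r: "0 \<le> r" "0 \<le> r'"
    by (simp_all add: r_def r'_def)
  have sq: "sqrt (real n) \<le> real n"
    using n1 real_sqrt_le_mono[of "real n" "(real n)\<^sup>2"] by (simp add: power2_eq_square)
  have sr: "1 / (real n * real \<tau> * real K) \<le> r"
    unfolding r_def using pos sq by (intro divide_left_mono mult_right_mono) auto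
  have cpos: "\<mu> * N \<le> \<bar>c\<bar> / (real n * real \<tau> * real K)"
  proof -
    have "\<mu> * N \<le> c / (real n * real \<tau> * real K)"
      using mult_right_mono[OF c, of N] pos by simp
    also have "\<dots> \<le> \<bar>c\<bar> / (real n * real \<tau> * real K)"
      by (intro divide_right_mono) auto
    finally show ?thesis .
  qed
  have "8 * \<Omega> / (sqrt (real n) * \<eta> * real \<tau> * real K) = 8 * (\<Omega> / \<eta>) * r"
    by (simp add: r_def)
  also have "\<dots> \<le> 8 * \<bar>b\<bar> * r"
    using b r by (intro mult_right_mono) auto
  finally have t1: "8 * \<Omega> / (sqrt (real n) * \<eta> * real \<tau> * real K) \<le> 8 * \<bar>b\<bar> * r" .
  have t2: "64 / (real n * real \<tau>) * (chi1 * \<mu>\<^sup>2) \<le> 64 * \<bar>a\<bar> * c\<^sup>2 * r"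
  proof -
    have "chi1 * \<mu>\<^sup>2 \<le> (\<bar>a\<bar> * N\<^sup>2) * \<mu>\<^sup>2"
      using 1 mult_right_mono[OF abs_ge_self[of a] zero_le_power2[of N]] by (intro mult_right_mono) auto
    also have "\<dots> = \<bar>a\<bar> * (\<mu> * N)\<^sup>2"
      by (simp add: power_mult_distrib)
    also have "\<dots> \<le> \<bar>a\<bar> * (\<bar>c\<bar> / (real n * real \<tau> * real K))\<^sup>2"
      using cpos pos by (intro mult_left_mono power_mono) auto
    also have "\<dots> = \<bar>a\<bar> * c\<^sup>2 * (1 / (real n * real \<tau> * real K))\<^sup>2"
      by (simp add: power_divide)
    also have "\<dots> \<le> \<bar>a\<bar> * c\<^sup>2 * r"
    proof (intro mult_left_mono)
      \<comment> \<open>A number in [0, 1] dominates its square, so the quadratic term in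
        \<open>\<mu>\<close> obeys the same rate as a linear one.\<close>
      have one: "1 / (real n * real \<tau> * real K) \<le> 1"
        using n1 mult_mono[of 1 "real n * real \<tau>" 1 "real K"] mult_mono[of 1 "real n" 1 "real \<tau>"] by simp
      have "(1 / (real n * real \<tau> * real K))\<^sup>2 \<le> 1 / (real n * real \<tau> * real K) * 1"
        unfolding power2_eq_square by (intro mult_left_mono one) auto
      then show "(1 / (real n * real \<tau> * real K))\<^sup>2 \<le> r"
        using sr by simp
    qed auto
    finally have X: "chi1 * \<mu>\<^sup>2 \<le> \<bar>a\<bar> * c\<^sup>2 * r" .
    have "64 / (real n * real \<tau>) * (chi1 * \<mu>\<^sup>2) \<le> 64 / (real n * real \<tau>) * (\<bar>a\<bar> * c\<^sup>2 * r)"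
      using X by (intro mult_left_mono) auto
    also have "\<dots> \<le> 64 * (\<bar>a\<bar> * c\<^sup>2 * r)"
    proof (intro mult_right_mono)
      show "64 / (real n * real \<tau>) \<le> 64"
        using n1 mult_mono[of 1 "real n" 1 "real \<tau>"] by (simp add: field_simps)
    qed (use r in auto)
    finally show ?thesis by simp
  qed
  have t3: "64 / (real n * real \<tau>) * (chi2 / real m) \<le> 64 * \<bar>a\<bar> * (N\<^sup>2 + \<sigma>\<^sup>2) * r'"
  proof -
    have "64 / (real n * real \<tau>) * (chi2 / real m) = 64 * chi2 * r'"
      by (simp add: r'_def)
    also have "\<dots> \<le> 64 * (\<bar>a\<bar> * (N\<^sup>2 + \<sigma>\<^sup>2)) * r'"
      using 2 r mult_right_mono[OF abs_ge_self[of a] add_nonneg_nonneg[OF zero_le_power2[of N] zero_le_power2[of \<sigma>]]]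
      by (intro mult_right_mono) auto
    finally show ?thesis by simp
  qed
  have t4: "16 * (3 + real n) * (chiG + chi) * chif / real n * \<mu> \<le> 64 * (\<bar>a\<bar> * N + chi) * \<bar>a\<bar> * \<bar>c\<bar> * r"
  proof -
    have aN: "a * N \<le> \<bar>a\<bar> * N"
      using pos by (intro mult_right_mono) auto
    have "(3 + real n) / real n \<le> 4"
      using n1 by (simp add: field_simps)
    then have "16 * ((3 + real n) / real n) * (chiG + chi) * (chif * \<mu>) \<le> 16 * 4 * (\<bar>a\<bar> * N + chi) * (\<bar>a\<bar> * N * \<mu>)"
      using order_trans[OF G aN] order_trans[OF f aN] nonneg pos by (intro mult_mono add_mono) auto
    also have "\<dots> = 64 * (\<bar>a\<bar> * N + chi) * \<bar>a\<bar> * (\<mu> * N)"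
      by simp
    also have "\<dots> \<le> 64 * (\<bar>a\<bar> * N + chi) * \<bar>a\<bar> * (\<bar>c\<bar> * r)"
    proof (intro mult_left_mono)
      show "\<mu> * N \<le> \<bar>c\<bar> * r"
        using cpos mult_left_mono[OF sr, of "\<bar>c\<bar>"] by simp
    qed (use pos in auto)
    finally show ?thesis by (simp add: mult_ac)
  qed
  let ?A = "8 * \<bar>b\<bar>" and ?B = "64 * \<bar>a\<bar> * c\<^sup>2" and ?C = "64 * \<bar>a\<bar> * (N\<^sup>2 + \<sigma>\<^sup>2)"
    and ?D = "64 * (\<bar>a\<bar> * N + chi) * \<bar>a\<bar> * \<bar>c\<bar>"
  have "?A * r + ?B * r + ?C * r' + ?D * r \<le> ?A * (r + r') + ?B * (r + r') + ?C * (r + r') + ?D * (r + r')"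
    using r pos by (intro add_mono mult_left_mono) auto
  then show ?thesis
    using t1 t2 t3 t4 by (simp only: distrib_left distrib_right)
qed

theorem theorem4p1:
  fixes S :: "(real^'r^'p) set" and P :: "real^'r^'p \<Rightarrow> real^'r^'p"
    and \<gamma> \<sigma> chi L M LP :: real
  assumes "compact S" and "smooth_submanifold S"
    and "0 < \<gamma>" and "prox_smooth (2 * \<gamma>) S"
    and "projection_on S P"
    and "0 < chi" and "0 < L"
    and "0 < M" and "\<forall>x\<in>S. \<forall>u. norm (P (x + u) - x) \<le> M * norm u"
    and "is_max_D2 S P \<gamma> LP"
  shows
    "(\<forall>n \<tau> m K \<mu> \<eta> \<eta>g chiG chif chi1 chi2 (D :: nat \<Rightarrow> 'x measure) F x1 (W :: 'w measure) Z.
        zo_fed_run S P \<gamma> \<sigma> chi L chiG chif chi1 chi2 n \<tau> m K \<mu> \<eta> D F W Z \<and>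
        \<eta>g = sqrt (real n) \<and>
        step_size_cond M L \<gamma> chiG chi LP (\<eta>g * \<eta> * real \<tau>)
        \<longrightarrow>
        integrable W (\<lambda>\<omega>. mean_subopt S P D F n \<tau> m K \<mu> \<eta> \<eta>g x1 (\<lambda>k i t j. Z k i t j \<omega>)) \<and>
        (\<integral>\<omega>. mean_subopt S P D F n \<tau> m K \<mu> \<eta> \<eta>g x1 (\<lambda>k i t j. Z k i t j \<omega>) \<partial>W)
          \<le> 8 * Omega1 S P D F n \<tau> \<eta> \<eta>g x1 / (sqrt (real n) * \<eta> * real \<tau> * real K)
            + 64 / (real n * real \<tau>) * (chi1 * \<mu>\<^sup>2 + chi2 / real m)
            + 16 * (3 + real n) * (chiG + chi) * chif / real n * \<mu>)
     \<and>
     (\<forall>a b c. \<exists>C. \<forall>n \<tau> m K \<mu> \<eta> \<eta>g chiG chif chi1 chi2 (D :: nat \<Rightarrow> 'x measure) F x1 (W :: 'w measure) Z.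
        zo_fed_run S P \<gamma> \<sigma> chi L chiG chif chi1 chi2 n \<tau> m K \<mu> \<eta> D F W Z \<and>
        \<eta>g = sqrt (real n) \<and>
        step_size_cond M L \<gamma> chiG chi LP (\<eta>g * \<eta> * real \<tau>) \<and>
        chiG \<le> a * real (CARD('p) * CARD('r)) \<and>
        chif \<le> a * real (CARD('p) * CARD('r)) \<and>
        chi1 \<le> a * (real (CARD('p) * CARD('r)))\<^sup>2 \<and>
        chi2 \<le> a * ((real (CARD('p) * CARD('r)))\<^sup>2 + \<sigma>\<^sup>2) \<and>
        Omega1 S P D F n \<tau> \<eta> \<eta>g x1 / \<eta> \<le> b \<and>
        \<mu> \<le> c / (real (CARD('p) * CARD('r)) * real n * real \<tau> * real K)
        \<longrightarrow>
        (\<integral>\<omega>. mean_subopt S P D F n \<tau> m K \<mu> \<eta> \<eta>g x1 (\<lambda>k i t j. Z k i t j \<omega>) \<partial>W)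
          \<le> C * (1 / (sqrt (real n) * real \<tau> * real K) + 1 / (real n * real \<tau> * real m)))"
proof (intro conjI allI impI)
  fix n \<tau> m K \<mu> \<eta> \<eta>g chiG chif chi1 chi2 x1 Z
    and D :: "nat \<Rightarrow> 'x measure" and F and W :: "'w measure"
  assume *: "zo_fed_run S P \<gamma> \<sigma> chi L chiG chif chi1 chi2 n \<tau> m K \<mu> \<eta> D F W Z \<and>
        \<eta>g = sqrt (real n) \<and> step_size_cond M L \<gamma> chiG chi LP (\<eta>g * \<eta> * real \<tau>)"
  then have \<eta>g: "\<eta>g = sqrt (real n)"
    and run: "zo_fed_run S P \<gamma> \<sigma> chi L chiG chif chi1 chi2 n \<tau> m K \<mu> \<eta> D F W Z"
    and step: "step_size_cond M L \<gamma> chiG chi LP (sqrt (real n) * \<eta> * real \<tau>)"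
    by auto
  note bound = zo_fed_run_bound(1,2)[OF assms(1-3,5-10) run step, of x1]
  show "integrable W (\<lambda>\<omega>. mean_subopt S P D F n \<tau> m K \<mu> \<eta> \<eta>g x1 (\<lambda>k i t j. Z k i t j \<omega>))"
    unfolding \<eta>g by (rule bound(1))
  show "(\<integral>\<omega>. mean_subopt S P D F n \<tau> m K \<mu> \<eta> \<eta>g x1 (\<lambda>k i t j. Z k i t j \<omega>) \<partial>W)
          \<le> 8 * Omega1 S P D F n \<tau> \<eta> \<eta>g x1 / (sqrt (real n) * \<eta> * real \<tau> * real K)
            + 64 / (real n * real \<tau>) * (chi1 * \<mu>\<^sup>2 + chi2 / real m)
            + 16 * (3 + real n) * (chiG + chi) * chif / real n * \<mu>"
    unfolding \<eta>g by (rule bound(2))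
next
  fix a b c :: real
  let ?N = "real (CARD('p) * CARD('r))"
  \<comment> \<open>The constant of \<open>rate_of_bound\<close>; it involves only \<open>a\<close>,
    \<open>b\<close>, \<open>c\<close>, the dimension, \<open>\<sigma>\<close> and
    \<open>chi\<close>, hence is uniform in \<open>n\<close>, \<open>\<tau>\<close>,
    \<open>m\<close> and \<open>K\<close>.\<close>
  let ?C = "8 * \<bar>b\<bar> + 64 * \<bar>a\<bar> * c\<^sup>2 + 64 * \<bar>a\<bar> * (?N\<^sup>2 + \<sigma>\<^sup>2) + 64 * (\<bar>a\<bar> * ?N + chi) * \<bar>a\<bar> * \<bar>c\<bar>"
  show "\<exists>C. \<forall>n \<tau> m K \<mu> \<eta> \<eta>g chiG chif chi1 chi2 (D :: nat \<Rightarrow> 'x measure) F x1 (W :: 'w measure) Z.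
        zo_fed_run S P \<gamma> \<sigma> chi L chiG chif chi1 chi2 n \<tau> m K \<mu> \<eta> D F W Z \<and>
        \<eta>g = sqrt (real n) \<and>
        step_size_cond M L \<gamma> chiG chi LP (\<eta>g * \<eta> * real \<tau>) \<and>
        chiG \<le> a * ?N \<and> chif \<le> a * ?N \<and> chi1 \<le> a * ?N\<^sup>2 \<and> chi2 \<le> a * (?N\<^sup>2 + \<sigma>\<^sup>2) \<and>
        Omega1 S P D F n \<tau> \<eta> \<eta>g x1 / \<eta> \<le> b \<and>
        \<mu> \<le> c / (?N * real n * real \<tau> * real K)
        \<longrightarrow>
        (\<integral>\<omega>. mean_subopt S P D F n \<tau> m K \<mu> \<eta> \<eta>g x1 (\<lambda>k i t j. Z k i t j \<omega>) \<partial>W)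
          \<le> C * (1 / (sqrt (real n) * real \<tau> * real K) + 1 / (real n * real \<tau> * real m))"
  proof (intro exI[of _ ?C] allI impI, elim conjE)
    fix n \<tau> m K \<mu> \<eta> \<eta>g chiG chif chi1 chi2 x1 Z
      and D :: "nat \<Rightarrow> 'x measure" and F and W :: "'w measure"
    assume run: "zo_fed_run S P \<gamma> \<sigma> chi L chiG chif chi1 chi2 n \<tau> m K \<mu> \<eta> D F W Z"
      and \<eta>g: "\<eta>g = sqrt (real n)"
      and step: "step_size_cond M L \<gamma> chiG chi LP (\<eta>g * \<eta> * real \<tau>)"
      and orders: "chiG \<le> a * ?N" "chif \<le> a * ?N" "chi1 \<le> a * ?N\<^sup>2" "chi2 \<le> a * (?N\<^sup>2 + \<sigma>\<^sup>2)"
        "Omega1 S P D F n \<tau> \<eta> \<eta>g x1 / \<eta> \<le> b" "\<mu> \<le> c / (?N * real n * real \<tau> * real K)"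
    note bound = zo_fed_run_bound(2)[OF assms(1-3,5-10) run step[unfolded \<eta>g], of x1]
      and nonneg = zo_fed_run_bound(3,4)[OF assms(1-3,5-10) run step[unfolded \<eta>g]]
    have pos: "0 < n" "0 < \<tau>" "0 < m" "0 < K" "0 < \<mu>" "0 < \<eta>"
      using run by (auto simp: zo_fed_run_def)
    have N: "0 < ?N" by simp
    show "(\<integral>\<omega>. mean_subopt S P D F n \<tau> m K \<mu> \<eta> \<eta>g x1 (\<lambda>k i t j. Z k i t j \<omega>) \<partial>W)
          \<le> ?C * (1 / (sqrt (real n) * real \<tau> * real K) + 1 / (real n * real \<tau> * real m))"
      unfolding \<eta>g
      by (rule order_trans[OF bound rate_of_bound[OF pos N assms(6) nonneg orders[unfolded \<eta>g]]])
  qed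
qed

end
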